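(* Let $\delta:=1-\frac{1+\log\log 2}{\log 2}\approx 0.08607$. As $N\to+\infty$, $$\mathcal{E}(N)=(\log N)^{\delta+o(1)}.$$
   Context: For an integer $N\geqslant 1$ and a nonzero tuple of non-negative weights $w=(w(1),\dots,w(N))\in(\mathbb{R}_+)^N$, where $\mathbb{R}_+=[0,+\infty)$, put $\|w\|_1=\sum_{m\leqslant N}w(m)$ and define the weighted multiplicative energy $$\mathcal{E}(N,w):=\sum_{\substack{m_1,m_2,n_1,n_2\leqslant N\\ m_1m_2=n_1n_2}}w(m_1)w(m_2)w(n_1)w(n_2),$$ the variables being positive integers. Define $$\mathcal{E}(N):=\inf_{w}\frac{N^2\,\mathcal{E}(N,w)}{\|w\|_1^4},$$ the infimum being over all nonzero $w\in(\mathbb{R}_+)^N$. Here $\log$ is the natural logarithm. *)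

theory Defs
  imports Complex_Main
begin

text \<open>
  A tuple of weights indexed by \<open>{1..N}\<close> is encoded as a function on \<open>nat\<close> of which
  only the values on \<open>{1..N}\<close> are constrained, or used below.
\<close>

definition weights :: "nat \<Rightarrow> (nat \<Rightarrow> real) set" where
  "weights N = {w. (\<forall>m\<in>{1..N}. 0 \<le> w m) \<and> (\<exists>m\<in>{1..N}. w m \<noteq> 0)}"

definition weight_norm1 :: "nat \<Rightarrow> (nat \<Rightarrow> real) \<Rightarrow> real" where
  "weight_norm1 N w = (\<Sum>m\<in>{1..N}. w m)"

definition weighted_energy :: "nat \<Rightarrow> (nat \<Rightarrow> real) \<Rightarrow> real" where
  "weighted_energy N w =
     (\<Sum>(m1, m2, n1, n2) \<in> {(m1, m2, n1, n2).
          m1 \<in> {1..N} \<and> m2 \<in> {1..N} \<and> n1 \<in> {1..N} \<and> n2 \<in> {1..N} \<and> m1 * m2 = n1 * n2}.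
        w m1 * w m2 * w n1 * w n2)"

text \<open>
  For \<open>N \<ge> 1\<close> this is the infimum of a nonempty set of reals bounded below by \<open>0\<close>;
  the value at \<open>N = 0\<close> is irrelevant.
\<close>

definition min_energy :: "nat \<Rightarrow> real" where
  "min_energy N =
     (INF w\<in>weights N. (real N)\<^sup>2 * weighted_energy N w / weight_norm1 N w ^ 4)"

definition energy_exponent :: real where
  "energy_exponent = 1 - (1 + ln (ln 2)) / ln 2"

end

(*
  Lower bound. If r(k) is the weighted number of ways to write k = m1 m2, then E(N, w) is the sum
  of the r(k)^2, so Cauchy-Schwarz gives ||w||^4 <= A(N) E(N, w), where A(N) is the number of
  distinct products in the N by N multiplication table. Erdos' argument bounds A(N): either
  m1 m2 has more than lnln N / ln 2 prime factors, or m1 and m2 together have at most that many,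
  and Rankin's trick with z^Omega for z = 1 / ln 2 and z = 1 / (2 ln 2) shows that both events
  have probability at most a constant times (ln N)^-delta.

  Upper bound. The indicator of {m : Omega(m) ~ lnln N / (2 ln 2)} fails, because of integers
  whose prime factors are unevenly distributed. Cut the lnln-scale into J + 2 equal pieces and
  take w to be the indicator of the integers q m <= N, where q is a large prime and m has
  exactly kappa ~ lnln N / (2 (J + 2) ln 2) prime factors in each of J middle pieces. A solution
  of m1 m2 = n1 n2 has the form m1 = ab, n1 = ac, m2 = cd, n2 = bd. Summing over the large primes
  leaves a sum of 1 / (a d max(b, c)^2). If t is the highest piece containing prime factors of
  b and c, this gains a factor (ln N)^(-t / (J + 2)), which is at most 4^(-kappa t), and
  exactly offsets the number of ways to distribute the prime factors between a and b in the
  first t pieces. Hence the energy is at most of the order of ||w||^4 (ln N)^(delta + O(1/J)) / N^2.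
*)

theory Submission
  imports Defs "HOL-Number_Theory.Prime_Powers" "HOL-Library.FuncSet"
begin

section \<open>Chebyshev and Mertens estimates\<close>

text \<open>The threshold lnln N / ln 2 lies between the typical number of prime factors of an
  integer up to N^2, about lnln N, and that of a product m1 m2, about 2 lnln N. It is the point at
  which the two tail probabilities have the same exponent delta. The exponent of the upper bound
  arises as follows. With L = lnln N and h = 1 / (J + 2), the sum of 1 / m over the integers m of
  the construction is about G = ((h L)^\<kappa> / \<kappa>!)^J. Up to powers (ln N)^O(h), the energy
  is of order (N / ln N)^2 G^2 and the norm of order (N / ln N) G, so the quotient is about (ln N)^2
  / G^2. Since \<kappa> is about h L / (2 ln 2), Stirling's formula makes G^2 about (2 e ln 2)^(L /
  ln 2) = (ln N)^(2 - delta). Constants depending on J are harmless, because N tends to infinity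
  before J does. Hence Chebyshev and Mertens estimates with O(1) errors suffice: the reciprocal
  prime sum h L + O(1) of a piece is only raised to a power \<kappa> of order L.\<close>

lemma sum_divisors_swap:
  fixes f :: "nat \<Rightarrow> nat \<Rightarrow> 'a::comm_monoid_add"
  shows "(\<Sum>m\<in>{1..n}. \<Sum>d | d dvd m. f d (m div d)) = (\<Sum>d\<in>{1..n}. \<Sum>e\<in>{1..n div d}. f d e)"
proof -
  have "(\<Sum>m\<in>{1..n}. \<Sum>d | d dvd m. f d (m div d)) =
      (\<Sum>(m, d)\<in>(SIGMA m:{1..n}. {d. d dvd m}). f d (m div d))"
    by (subst sum.Sigma) auto
  also have "\<dots> = (\<Sum>(d, e)\<in>(SIGMA d:{1..n}. {1..n div d}). f d e)"
  proof (rule sum.reindex_bij_witness[of _ "\<lambda>(d, e). (d * e, d)" "\<lambda>(m, d). (d, m div d)"], goal_cases)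
    case (2 a)
    then obtain d e where a: "a = (d * e, d)" and de: "d > 0" "e > 0" "d * e \<le> n"
      by (cases a) (auto elim!: dvdE)
    have "d \<le> d * e" using de by simp
    hence "d \<le> n" using de by linarith
    then show ?case
      using a de by (auto simp: Suc_le_eq less_eq_div_iff_mult_less_eq mult.commute)
  next
    case (4 b)
    then obtain d e where b: "b = (d, e)" and de: "d > 0" "e > 0" "e * d \<le> n"
      by (cases b) (auto simp: Suc_le_eq less_eq_div_iff_mult_less_eq)
    then show ?case by (auto simp: Suc_le_eq mult.commute)
  qed auto
  also have "\<dots> = (\<Sum>d\<in>{1..n}. \<Sum>e\<in>{1..n div d}. f d e)"
    by (subst sum.Sigma) auto
  finally show ?thesis .
qed

lemma ln_fact_Suc: "ln (fact (Suc n) :: real) = ln (real (Suc n)) + ln (fact n)"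
  by (simp only: fact_Suc of_nat_mult) (subst ln_mult, auto)

lemma ln_fact_eq_sum: "ln (fact n :: real) = (\<Sum>m\<in>{1..n}. ln (real m))"
  by (induction n) (simp_all add: ln_mult add.commute)

lemma ln_fact_mangoldt: "ln (fact n :: real) = (\<Sum>d\<in>{1..n}. mangoldt d * real (n div d))"
proof -
  have "ln (fact n :: real) = (\<Sum>m\<in>{1..n}. \<Sum>d | d dvd m. mangoldt d)"
    unfolding ln_fact_eq_sum by (intro sum.cong refl) (simp add: mangoldt_sum)
  also have "\<dots> = (\<Sum>d\<in>{1..n}. \<Sum>e\<in>{1..n div d}. mangoldt d)"
    by (rule sum_divisors_swap)
  finally show ?thesis by (simp add: mult.commute)
qed

section \<open>Chebyshev's upper bound for \<open>psi\<close>\<close>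

definition psi :: "nat \<Rightarrow> real" where
  "psi n = (\<Sum>d\<in>{1..n}. mangoldt d)"

text \<open>The identity for ln n! writes the logarithm of the central binomial coefficient as the
  sum of \<open>mangoldt d\<close> times (2m div d) - 2 (m div d). This weight is never negative and
  is at least 1 for m < d \<le> 2m, while the binomial coefficient is at most 4^m.\<close>

lemma psi_double_le: "psi (2 * m) \<le> psi m + real m * ln 4"
proof -
  have ext: "ln (fact m :: real) = (\<Sum>d\<in>{1..2*m}. mangoldt d * real (m div d))"
    unfolding ln_fact_mangoldt by (rule sum.mono_neutral_left) auto
  have "psi (2 * m) - psi m = (\<Sum>d\<in>{1..2*m} - {1..m}. mangoldt d)"
    unfolding psi_def by (subst sum_diff) auto
  also have "\<dots> = (\<Sum>d\<in>{1..2*m}. if d \<in> {1..m} then 0 else mangoldt d)"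
    by (rule sum.mono_neutral_cong_left) auto
  also have "\<dots> \<le> (\<Sum>d\<in>{1..2*m}. mangoldt d * (real (2 * m div d) - 2 * real (m div d)))"
  proof (rule sum_mono)
    fix d assume d: "d \<in> {1..2*m}"
    have "2 * (m div d) \<le> 2 * m div d"
      using d div_times_less_eq_dividend[of m d]
      by (subst less_eq_div_iff_mult_less_eq) (auto simp: mult.assoc simp del: div_times_less_eq_dividend)
    hence ge: "2 * real (m div d) \<le> real (2 * m div d)" by linarith
    show "(if d \<in> {1..m} then 0 else mangoldt d)
        \<le> mangoldt d * (real (2 * m div d) - 2 * real (m div d))"
    proof (cases "d \<in> {1..m}")
      case True
      then show ?thesis using ge mangoldt_nonneg[of d] by simp
    next
      case False
      hence "m div d = 0" "2 * m div d \<ge> 1" using d by (auto simp: Suc_le_eq div_greater_zero_iff)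
      then show ?thesis using False mangoldt_nonneg[of d]
        by (simp add: mult_le_cancel_left1)
    qed
  qed
  also have "\<dots> = ln (fact (2 * m)) - 2 * ln (fact m :: real)"
    unfolding ext ln_fact_mangoldt[of "2 * m"]
    by (simp add: sum_subtractf right_diff_distrib sum_distrib_left mult_ac)
  also have "\<dots> = ln (real ((2 * m) choose m))"
  proof -
    have "real (fact m * fact m * ((2 * m) choose m)) = real (fact (2 * m))"
      using binomial_fact_lemma[of m "2 * m"] by (simp only: mult_2 le_add1 diff_add_inverse)
    hence "(fact (2 * m) :: real) = fact m * fact m * real ((2 * m) choose m)"
      by (simp only: of_nat_mult of_nat_fact)
    moreover have "real ((2 * m) choose m) > 0" by (simp add: zero_less_binomial_iff)
    ultimately show ?thesis by (simp add: ln_mult)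
  qed
  also have "\<dots> \<le> ln (4 ^ m)"
  proof (subst ln_le_cancel_iff)
    have "real (2 * m choose m) \<le> real (2 ^ (2 * m))"
      by (intro of_nat_mono binomial_le_pow2)
    thus "real (2 * m choose m) \<le> 4 ^ m" by (simp add: power_mult)
  qed (auto simp: zero_less_binomial_iff)
  finally show ?thesis by (simp add: ln_realpow)
qed

lemma psi_Suc: "psi (Suc n) = psi n + mangoldt (Suc n)"
  by (simp add: psi_def)

lemma ln4_le: "ln (4::real) \<le> 2"
proof -
  have "ln (4::real) = 2 * ln 2" using ln_realpow[of 2 2] by simp
  thus ?thesis using ln_2_less_1 by simp
qed

lemma psi_le: "psi n \<le> 4 * real n"
proof (induction n rule: less_induct)
  case (less n)
  show ?case
  proof (cases "n = 0")
    case True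
    then show ?thesis by (simp add: psi_def)
  next
    case False
    define m where "m = n div 2"
    have IH: "psi m \<le> 4 * real m" using less False by (simp add: m_def)
    \<comment> \<open>The gap between 6m and 8m absorbs an odd n, for which
      \<open>mangoldt n\<close> is at most n - 1 = 2m.\<close>
    have dbl: "psi (2 * m) \<le> 6 * real m"
      using psi_double_le[of m] IH mult_left_mono[OF ln4_le, of "real m"] by simp
    show ?thesis
    proof (cases "even n")
      case True
      hence "n = 2 * m" by (simp add: m_def)
      thus ?thesis using dbl by simp
    next
      case False
      hence n: "n = Suc (2 * m)" by (simp add: m_def)
      have "mangoldt n \<le> ln (real n)" using n by (intro mangoldt_le) auto
      also have "\<dots> \<le> real n - 1" using n by (intro ln_le_minus_one) auto
      finally show ?thesis using dbl n psi_Suc[of "2 * m"] by simp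
    qed
  qed
qed

section \<open>Stirling bounds and Mertens' first theorem\<close>

lemma ln_fact_le: "ln (fact n :: real) \<le> real n * ln (real n)"
proof (cases "n = 0")
  case False
  have "(fact n :: real) \<le> real n ^ n" using fact_le_power[of n, where ?'a = real] by simp
  hence "ln (fact n :: real) \<le> ln (real n ^ n)" using False by (subst ln_le_cancel_iff) auto
  thus ?thesis using False by (simp add: ln_realpow)
qed simp

lemma one_plus_inverse_ln_bounds:
  assumes "n \<ge> (1::nat)"
  shows "real n * (ln (real (Suc n)) - ln (real n)) \<le> 1"
    and "1 \<le> real (Suc n) * (ln (real (Suc n)) - ln (real n))"
proof -
  have d: "ln (real (Suc n)) - ln (real n) = ln (real (Suc n) / real n)"
    using assms by (simp add: ln_div)
  have "ln (real (Suc n) / real n) \<le> real (Suc n) / real n - 1"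
    using assms by (intro ln_le_minus_one) auto
  thus "real n * (ln (real (Suc n)) - ln (real n)) \<le> 1"
    unfolding d using assms by (simp add: field_simps)
  have "ln (real n / real (Suc n)) \<le> real n / real (Suc n) - 1"
    using assms by (intro ln_le_minus_one) auto
  hence "ln (real n) - ln (real (Suc n)) \<le> real n / real (Suc n) - 1"
    using assms by (simp add: ln_div)
  thus "1 \<le> real (Suc n) * (ln (real (Suc n)) - ln (real n))"
    by (simp add: field_simps)
qed

lemma ln_fact_ge: "real n * ln (real n) - real n \<le> ln (fact n :: real)"
proof (induction n)
  case (Suc n)
  show ?case
  proof (cases "n = 0")
    case False
    have "real n * (ln (real (Suc n)) - ln (real n)) \<le> 1"
      using False by (intro one_plus_inverse_ln_bounds) auto
    thus ?thesis using Suc ln_fact_Suc[of n] by (simp add: algebra_simps)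
  qed simp
qed simp

text \<open>Bounding n! by n^n would lose e^\<kappa>, a power of ln N, in the final estimate; here
  only a factor e n is lost.\<close>

lemma ln_fact_le_stirling:
  assumes "n \<ge> 1"
  shows "ln (fact n :: real) \<le> real n * ln (real n) - real n + ln (real n) + 1"
  using assms
proof (induction n rule: nat_induct_at_least)
  case (Suc n)
  have "1 \<le> real (Suc n) * (ln (real (Suc n)) - ln (real n))"
    using Suc by (intro one_plus_inverse_ln_bounds) auto
  thus ?case using Suc ln_fact_Suc[of n] by (simp add: algebra_simps)
qed simp

text \<open>Replacing the floors in the identity for ln n! by n / d costs at most
  \<open>psi n\<close>, which is O(n) by Chebyshev; dividing by n leaves a bounded error.\<close>

lemma sum_mangoldt_over_le:
  assumes "n \<ge> 1"
  shows "(\<Sum>d\<in>{1..n}. mangoldt d / real d) \<le> ln (real n) + 4"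
proof -
  have "real n * (\<Sum>d\<in>{1..n}. mangoldt d / real d) \<le> (\<Sum>d\<in>{1..n}. mangoldt d * real (n div d) + mangoldt d)"
    unfolding sum_distrib_left
  proof (rule sum_mono)
    fix d assume "d \<in> {1..n}"
    hence "real n / real d \<le> real (n div d) + 1"
      using floor_divide_of_nat_eq[of n d, where ?'a = real]
      by linarith
    from mult_left_mono[OF this mangoldt_nonneg[of d]]
    show "real n * (mangoldt d / real d) \<le> mangoldt d * real (n div d) + mangoldt d"
      by (simp add: algebra_simps)
  qed
  also have "\<dots> = ln (fact n) + psi n"
    by (simp add: sum.distrib ln_fact_mangoldt psi_def)
  also have "\<dots> \<le> real n * (ln (real n) + 4)"
    using ln_fact_le[of n] psi_le[of n] by (simp add: algebra_simps)
  finally show ?thesis using assms by simp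
qed

lemma sum_mangoldt_over_ge:
  assumes "n \<ge> 1"
  shows "ln (real n) - 1 \<le> (\<Sum>d\<in>{1..n}. mangoldt d / real d)"
proof -
  have "real n * (ln (real n) - 1) \<le> ln (fact n)"
    using ln_fact_ge[of n] by (simp add: algebra_simps)
  also have "\<dots> \<le> (\<Sum>d\<in>{1..n}. mangoldt d * (real n / real d))"
    unfolding ln_fact_mangoldt
    by (intro sum_mono mult_left_mono mangoldt_nonneg of_nat_div_le_of_nat)
  also have "\<dots> = real n * (\<Sum>d\<in>{1..n}. mangoldt d / real d)"
    by (simp add: sum_distrib_left mult_ac)
  finally show ?thesis using assms by simp
qed

section \<open>From prime powers to primes\<close>

definition primes_upto :: "nat \<Rightarrow> nat set" where
  "primes_upto n = {p. prime p \<and> p \<le> n}"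

lemma finite_primes_upto [simp]: "finite (primes_upto n)"
  by (rule finite_subset[of _ "{..n}"]) (auto simp: primes_upto_def)

lemma primes_upto_subset: "primes_upto n \<subseteq> {1..n}"
  by (auto simp: primes_upto_def Suc_le_eq prime_gt_0_nat)

lemma sum_ln_primes_le: "(\<Sum>p\<in>primes_upto n. ln (real p)) \<le> 4 * real n"
proof -
  have "(\<Sum>p\<in>primes_upto n. ln (real p)) = (\<Sum>p\<in>primes_upto n. mangoldt p)"
    by (intro sum.cong) (auto simp: primes_upto_def)
  also have "\<dots> \<le> psi n"
    unfolding psi_def by (intro sum_mono2 primes_upto_subset mangoldt_nonneg) auto
  finally show ?thesis using psi_le[of n] by simp
qed

lemma ln_le_sqrt:
  assumes "x > 0"
  shows "ln x \<le> 2 * sqrt x"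
proof -
  have "ln (sqrt x) \<le> sqrt x - 1" using assms by (intro ln_le_minus_one) auto
  moreover have "ln (sqrt x) = ln x / 2" using assms by (simp add: ln_sqrt)
  ultimately show ?thesis by simp
qed

text \<open>Since ln k \<le> 2 sqrt k, the terms are at most 2 / k^(3/2), which for k \<ge> 2 is
  dominated by the telescoping difference 4 / sqrt (k - 1) - 4 / sqrt k.\<close>

lemma sum_ln_over_square_le: "n \<ge> 1 \<Longrightarrow> (\<Sum>k\<in>{1..n}. ln (real k) / real k ^ 2) \<le> 4 - 4 / sqrt (real n)"
proof (induction n rule: nat_induct_at_least)
  case (Suc n)
  define a b where "a = sqrt (real n)" and "b = sqrt (real (Suc n))"
  have ab: "a > 0" "b > 0" "a \<le> b" and b2: "b ^ 2 = real (Suc n)" and a2: "a ^ 2 + 1 = b ^ 2"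
    using Suc by (auto simp: a_def b_def)
  have "ln (real (Suc n)) / real (Suc n) ^ 2 \<le> 2 * b / (b ^ 2) ^ 2"
    unfolding b2 unfolding b_def by (intro divide_right_mono ln_le_sqrt) auto
  also have "\<dots> = 2 / (b * b ^ 2)"
    using ab by (simp add: power2_eq_square)
  also have "\<dots> \<le> 4 / (a * b * (a + b))"
  proof -
    have "a * (a + b) \<le> b * (b + b)"
      using ab by (intro mult_mono add_mono) auto
    hence "2 * b * (a * (a + b)) \<le> 2 * b * (b * (b + b))"
      using ab by (intro mult_left_mono) auto
    hence "2 * (a * b * (a + b)) \<le> 4 * (b * b ^ 2)"
      by (simp add: power2_eq_square algebra_simps)
    thus ?thesis using ab by (simp add: divide_simps mult_ac)
  qed
  also have "\<dots> = 4 * ((b ^ 2 - a ^ 2) / (a * b * (a + b)))"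
    using a2 by (simp add: algebra_simps)
  also have "(b ^ 2 - a ^ 2) / (a * b * (a + b)) = 1 / a - 1 / b"
  proof -
    have "b ^ 2 - a ^ 2 = (b - a) * (a + b)" by (simp add: power2_eq_square algebra_simps)
    moreover have "a + b > 0" using ab by simp
    moreover have "1 / a - 1 / b = (b - a) / (a * b)" using ab by (simp add: field_simps)
    ultimately show ?thesis by simp
  qed
  finally have "ln (real (Suc n)) / real (Suc n) ^ 2 \<le> 4 / a - 4 / b"
    by (simp add: algebra_simps)
  thus ?case using Suc by (simp add: a_def b_def)
qed simp

lemma sum_ln_over_primes_le:
  assumes "n \<ge> 1"
  shows "(\<Sum>p\<in>primes_upto n. ln (real p) / real p) \<le> ln (real n) + 4"
proof -
  have "(\<Sum>p\<in>primes_upto n. ln (real p) / real p) = (\<Sum>p\<in>primes_upto n. mangoldt p / real p)"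
    by (intro sum.cong) (auto simp: primes_upto_def)
  also have "\<dots> \<le> (\<Sum>d\<in>{1..n}. mangoldt d / real d)"
    by (intro sum_mono2 primes_upto_subset divide_nonneg_nonneg mangoldt_nonneg) auto
  finally show ?thesis using sum_mangoldt_over_le[OF assms] by simp
qed

text \<open>Only exponents of at least 2 occur, so for each p a geometric series of ratio at most
  1/2 leaves 2 ln p / p^2. Extending the sum over p to all integers gives twice the bound 4 of
  \<open>sum_ln_over_square_le\<close>.\<close>

lemma sum_mangoldt_prime_powers_le:
  "(\<Sum>d\<in>{d\<in>{1..n}. \<not> prime d}. mangoldt d / real d) \<le> 8"
proof -
  let ?B = "{d\<in>{1..n}. primepow d \<and> \<not> prime d}"
  let ?D = "primes_upto n \<times> {..n}"
  let ?f = "\<lambda>(p, k). p ^ (k + 2) :: nat"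
  have "(\<Sum>d\<in>{d\<in>{1..n}. \<not> prime d}. mangoldt d / real d) = (\<Sum>d\<in>?B. mangoldt d / real d)"
    by (rule sum.mono_neutral_right) (auto simp: mangoldt_def)
  also have "\<dots> \<le> (\<Sum>d\<in>?f ` ?D. mangoldt d / real d)"
  proof (rule sum_mono2)
    show "?B \<subseteq> ?f ` ?D"
    proof
      fix d assume d: "d \<in> ?B"
      then obtain p k where pk: "prime p" "k > 0" "d = p ^ k"
        by (auto simp: primepow_def)
      have "k \<noteq> 1"
      proof
        assume "k = 1"
        hence "d = p" using pk(3) by simp
        thus False using pk(1) d by simp
      qed
      then obtain l where k: "k = l + 2" using pk(2) by (intro that[of "k - 2"]) simp
      have "p ^ 1 \<le> p ^ k" using pk prime_ge_1_nat[of p] by (intro power_increasing) auto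
      hence "p \<le> n" using pk(3) d by simp
      moreover have "k < p ^ k" using pk prime_ge_2_nat[of p] by (intro power_gt_expt) auto
      moreover have "d \<le> n" using d by simp
      ultimately have "(p, l) \<in> ?D" using pk(1,3) k by (simp add: primes_upto_def)
      moreover have "d = ?f (p, l)" using pk(3) k by simp
      ultimately show "d \<in> ?f ` ?D" by (rule rev_image_eqI)
    qed
  qed (auto intro!: divide_nonneg_nonneg mangoldt_nonneg)
  also have "\<dots> \<le> (\<Sum>x\<in>?D. mangoldt (?f x) / real (?f x))"
    by (rule sum_image_le[where g = "\<lambda>d. mangoldt d / real d", unfolded o_def])
       (auto intro!: divide_nonneg_nonneg mangoldt_nonneg)
  also have "\<dots> = (\<Sum>p\<in>primes_upto n. \<Sum>k\<le>n. mangoldt (p ^ (k + 2)) / real (p ^ (k + 2)))"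
    by (simp add: sum.cartesian_product case_prod_unfold)
  also have "\<dots> \<le> (\<Sum>p\<in>primes_upto n. 2 * (ln (real p) / real p ^ 2))"
  proof (rule sum_mono)
    fix p assume "p \<in> primes_upto n"
    hence p: "prime p" "p \<ge> 2" by (auto simp: primes_upto_def prime_ge_2_nat)
    define x where "x = 1 / real p"
    have x: "0 < x" "x \<le> 1 / 2" using p by (auto simp: x_def field_simps)
    have mp: "mangoldt (p ^ (k + 2)) = ln (real p)" for k using p by (simp del: power_Suc add_2_eq_Suc')
    have "(\<Sum>k\<le>n. x ^ k) = (1 - x ^ Suc n) / (1 - x)"
      using x by (simp add: sum_gp0)
    also have "\<dots> \<le> 1 / (1 - x)"
      using x by (intro divide_right_mono) auto
    also have "\<dots> \<le> 2" using x by (simp add: field_simps)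
    finally have geo: "(\<Sum>k\<le>n. x ^ k) \<le> 2" .
    have "(\<Sum>k\<le>n. mangoldt (p ^ (k + 2)) / real (p ^ (k + 2))) = ln (real p) * x ^ 2 * (\<Sum>k\<le>n. x ^ k)"
      using p unfolding sum_distrib_left mp
      by (intro sum.cong refl) (simp add: x_def power_add power_divide power2_eq_square mult_ac)
    also have "\<dots> \<le> ln (real p) * x ^ 2 * 2"
      using p geo by (intro mult_left_mono) auto
    also have "\<dots> = 2 * (ln (real p) / real p ^ 2)"
      by (simp add: x_def power_divide)
    finally show "(\<Sum>k\<le>n. mangoldt (p ^ (k + 2)) / real (p ^ (k + 2))) \<le> 2 * (ln (real p) / real p ^ 2)" .
  qed
  also have "\<dots> \<le> (\<Sum>k\<in>{1..n}. 2 * (ln (real k) / real k ^ 2))"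
    using primes_upto_subset by (intro sum_mono2) (auto intro!: divide_nonneg_nonneg)
  also have "\<dots> \<le> 8"
  proof (cases "n \<ge> 1")
    case True
    have "4 / sqrt (real n) \<ge> 0" by simp
    with sum_ln_over_square_le[OF True] show ?thesis
      unfolding sum_distrib_left[symmetric] by linarith
  qed (auto simp: not_le)
  finally show ?thesis .
qed

lemma sum_ln_over_primes_ge:
  assumes "n \<ge> 1"
  shows "ln (real n) - 9 \<le> (\<Sum>p\<in>primes_upto n. ln (real p) / real p)"
proof -
  have "(\<Sum>d\<in>{1..n}. mangoldt d / real d) =
      (\<Sum>d\<in>{d\<in>{1..n}. \<not> prime d}. mangoldt d / real d) + (\<Sum>d\<in>primes_upto n. mangoldt d / real d)"
    by (subst sum.union_disjoint[symmetric])
       (auto simp: primes_upto_def Suc_le_eq prime_gt_0_nat intro!: sum.cong)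
  also have "(\<Sum>d\<in>primes_upto n. mangoldt d / real d) = (\<Sum>p\<in>primes_upto n. ln (real p) / real p)"
    by (intro sum.cong) (auto simp: primes_upto_def)
  finally show ?thesis
    using sum_mangoldt_prime_powers_le[of n] sum_mangoldt_over_ge[OF assms] by linarith
qed

section \<open>Mertens' second theorem\<close>

text \<open>
  Abel summation, with the integral of \<open>1 / (t ln t)\<close> replaced by the increments of
  \<open>ln \<circ> ln\<close>: for \<open>u = ln n\<close> and \<open>v = ln (n + 1)\<close>, the number \<open>1 - u / v\<close> differs from
  \<open>ln (v / u)\<close> by at most the telescoping quantity \<open>1 / u - 1 / v\<close>.
\<close>

lemma sum_over_ln_bounded:
  fixes a :: "nat \<Rightarrow> real"
  assumes "\<And>n. n \<ge> 2 \<Longrightarrow> \<bar>(\<Sum>d\<in>{2..n}. a d) - ln (real n)\<bar> \<le> C"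
  shows "\<exists>C'. \<forall>n\<ge>2. \<bar>(\<Sum>d\<in>{2..n}. a d / ln (real d)) - ln (ln (real n))\<bar> \<le> C'"
proof -
  define A where "A n = (\<Sum>d\<in>{2..n}. a d)" for n
  define S where "S n = (\<Sum>d\<in>{2..n}. a d / ln (real d))" for n
  have A: "ln (real n) - C \<le> A n" "A n \<le> ln (real n) + C" if "n \<ge> 2" for n
    using assms[OF that] unfolding A_def by linarith+
  have C: "C \<ge> 0" using A[of 2] by simp
  have main: "S n - A n / ln (real n) \<le> ln (ln (real n)) - ln (ln 2) + C * (1 / ln 2 - 1 / ln (real n)) \<and>
      ln (ln (real n)) - ln (ln 2) - (C + 1) * (1 / ln 2 - 1 / ln (real n)) \<le> S n - A n / ln (real n)"
    if "n \<ge> 2" for n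
    using that
  proof (induction n rule: nat_induct_at_least)
    case base
    then show ?case by (simp add: S_def A_def)
  next
    case (Suc n)
    define u v where "u = ln (real n)" and "v = ln (real (Suc n))"
    have u: "u > 0" and uv: "u < v" using Suc by (auto simp: u_def v_def)
    have "real n * (v - u) \<le> 1"
      unfolding u_def v_def using Suc by (intro one_plus_inverse_ln_bounds) auto
    moreover have "1 * (v - u) \<le> real n * (v - u)" using uv Suc by (intro mult_right_mono) auto
    ultimately have d1: "v - u \<le> 1" by simp
    have step: "S (Suc n) - A (Suc n) / v = (S n - A n / u) + A n * (1 / u - 1 / v)"
      using u uv Suc by (simp add: S_def A_def v_def algebra_simps add_divide_distrib)
    have pos: "1 / u - 1 / v \<ge> 0" using u uv by (simp add: field_simps)
    have dln: "ln v - ln u = ln (v / u)" using u uv by (simp add: ln_div)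
    have up: "1 - u / v \<le> ln (v / u)"
    proof -
      have "ln (u / v) \<le> u / v - 1" using u uv by (intro ln_le_minus_one) auto
      moreover have "ln (u / v) = - ln (v / u)" using u uv by (simp add: ln_div)
      ultimately show ?thesis by simp
    qed
    have lo: "ln (v / u) \<le> (1 - u / v) + (1 / u - 1 / v)"
    proof -
      have "ln (v / u) \<le> v / u - 1" using u uv by (intro ln_le_minus_one) auto
      also have "\<dots> = (1 - u / v) + (v - u) * (1 / u - 1 / v)"
        using u uv by (simp add: field_simps)
      also have "\<dots> \<le> (1 - u / v) + 1 * (1 / u - 1 / v)"
        using d1 pos by (intro add_left_mono mult_right_mono) auto
      finally show ?thesis by simp
    qed
    have e: "u * (1 / u - 1 / v) = 1 - u / v" using u uv by (simp add: field_simps)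
    obtain t where t: "t = 1 / u - 1 / v" by blast
    note pos' = pos[folded t] and e' = e[folded t] and lo' = lo[folded t] and step' = step[folded t]
    have "A n * t \<le> (u + C) * t"
      using pos' A[of n] Suc by (intro mult_right_mono) (auto simp: u_def)
    hence 1: "A n * t \<le> ln v - ln u + C * t"
      using up e' unfolding dln distrib_right by linarith
    have "(u - C) * t \<le> A n * t"
      using pos' A[of n] Suc by (intro mult_right_mono) (auto simp: u_def)
    hence 2: "ln v - ln u - (C + 1) * t \<le> A n * t"
      using lo' e' unfolding dln distrib_right left_diff_distrib by linarith
    have telescope: "1 / ln 2 - 1 / v = (1 / ln 2 - 1 / u) + t" by (simp add: t)
    show ?case
      using Suc.IH 1 2 step' unfolding u_def[symmetric] v_def[symmetric] telescope distrib_left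
      by linarith
  qed
  show ?thesis
  proof (intro exI allI impI)
    fix n :: nat assume n: "n \<ge> 2"
    define u where "u = ln (real n)"
    have u: "u \<ge> ln 2" "ln 2 > (0::real)" using n by (auto simp: u_def)
    have u0: "0 < u" using u by linarith
    have "A n / u \<le> (u + C) / u" using A[OF n] u0 by (intro divide_right_mono) (simp_all add: u_def)
    also have "\<dots> = 1 + C / u" using u0 by (simp add: add_divide_distrib)
    also have "\<dots> \<le> 1 + C / ln 2" using u u0 C by (intro add_left_mono divide_left_mono) auto
    finally have 1: "A n / u \<le> 1 + C / ln 2" .
    have "1 - C / ln 2 \<le> 1 - C / u" using u u0 C by (intro diff_left_mono divide_left_mono) auto
    also have "\<dots> = (u - C) / u" using u0 by (simp add: diff_divide_distrib)
    also have "\<dots> \<le> A n / u" using A[OF n] u u0 by (intro divide_right_mono) (simp_all add: u_def)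
    finally have 2: "1 - C / ln 2 \<le> A n / u" .
    have 3: "C * (1 / ln 2 - 1 / u) \<le> C / ln 2" "(C + 1) * (1 / ln 2 - 1 / u) \<le> (C + 1) / ln 2"
      using mult_left_mono[of "1 / ln 2 - 1 / u" "1 / ln 2" C]
        mult_left_mono[of "1 / ln 2 - 1 / u" "1 / ln 2" "C + 1"] u u0 C by auto
    have "(C + 1) / ln 2 = C / ln 2 + 1 / ln (2::real)" by (simp add: add_divide_distrib)
    moreover have "1 / ln (2::real) \<ge> 0" by simp
    ultimately show "\<bar>(\<Sum>d\<in>{2..n}. a d / ln (real d)) - ln (ln (real n))\<bar>
        \<le> 1 + 2 * (C / ln 2) + 1 / ln 2 + \<bar>ln (ln 2)\<bar>"
      using main[OF n] 1 2 3 unfolding S_def[symmetric] u_def[symmetric]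
      by (intro abs_leI) linarith+
  qed
qed

lemma sum_primes_upto_eq:
  fixes f :: "nat \<Rightarrow> real"
  shows "(\<Sum>p\<in>primes_upto n. f p) = (\<Sum>d\<in>{2..n}. if prime d then f d else 0)"
  by (rule sum.mono_neutral_cong_left) (auto simp: primes_upto_def prime_ge_2_nat)

lemma mertens_second:
  obtains C where "\<And>n. n \<ge> 2 \<Longrightarrow> \<bar>(\<Sum>p\<in>primes_upto n. 1 / real p) - ln (ln (real n))\<bar> \<le> C"
proof -
  define a where "a d = (if prime d then ln (real d) / real d else 0)" for d :: nat
  have "\<bar>(\<Sum>d\<in>{2..n}. a d) - ln (real n)\<bar> \<le> 9" if "n \<ge> 2" for n
    using sum_ln_over_primes_le[of n] sum_ln_over_primes_ge[of n] that
    unfolding sum_primes_upto_eq a_def by auto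
  from sum_over_ln_bounded[of a 9, OF this] obtain C where
    C: "\<And>n. n \<ge> 2 \<Longrightarrow> \<bar>(\<Sum>d\<in>{2..n}. a d / ln (real d)) - ln (ln (real n))\<bar> \<le> C"
    by blast
  have "(\<Sum>d\<in>{2..n}. a d / ln (real d)) = (\<Sum>p\<in>primes_upto n. 1 / real p)" for n
    unfolding sum_primes_upto_eq by (intro sum.cong) (auto simp: a_def)
  with C show ?thesis by (intro that) simp
qed

text \<open>By Mertens the sum of ln p / p over n / K < p \<le> n is ln K + O(1), hence at least 1
  for a suitable constant K; as p is at least n / K there, the sum of ln p is at least n / K. The
  interval stays away from 0 because the large primes of the construction must exceed
  \<open>Y\<close>.\<close>

lemma chebyshev_lower:
  obtains K :: nat where "K > 0"
    "\<And>n. n \<ge> K \<Longrightarrow> real n / real K \<le> (\<Sum>p\<in>primes_upto n - primes_upto (n div K). ln (real p))"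
proof -
  \<comment> \<open>14 = 4 + 9 + 1: the errors in the two bounds for the sum of ln p / p, and the 1
    that has to be left over.\<close>
  define K where "K = nat \<lceil>exp (14::real)\<rceil>"
  have K1: "exp 14 \<le> real K" unfolding K_def by linarith
  have "0 < exp (14::real)" by simp
  hence K0: "real K > 0" using K1 by linarith
  have lnK: "ln (real K) \<ge> 14"
    using K1 K0 by (simp add: ln_ge_iff)
  show ?thesis
  proof (rule that[of K])
    show "K > 0" using K0 by simp
    fix n assume n: "n \<ge> K"
    let ?B = "primes_upto n - primes_upto (n div K)"
    have q: "n div K \<ge> 1" using n K0 by (simp add: Suc_le_eq div_greater_zero_iff)
    have sub: "primes_upto (n div K) \<subseteq> primes_upto n"
      using div_le_dividend[of n K] by (auto simp: primes_upto_def intro: order.trans)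
    have "ln (real (n div K)) \<le> ln (real n / real K)"
      using q of_nat_div_le_of_nat[of n K, where ?'a = real] by (subst ln_le_cancel_iff) auto
    also have "\<dots> = ln (real n) - ln (real K)" using n K0 by (simp add: ln_div)
    finally have "1 \<le> (\<Sum>p\<in>?B. ln (real p) / real p)"
      using sum_ln_over_primes_le[OF q] sum_ln_over_primes_ge[of n] lnK n K0
      by (subst sum_diff[OF _ sub]) auto
    hence "real n / real K * 1 \<le> real n / real K * (\<Sum>p\<in>?B. ln (real p) / real p)"
      by (intro mult_left_mono) auto
    also have "\<dots> \<le> (\<Sum>p\<in>?B. ln (real p))"
      unfolding sum_distrib_left
    proof (rule sum_mono)
      fix p assume p: "p \<in> ?B"
      hence pp: "prime p" and "n div K < p" by (auto simp: primes_upto_def)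
      hence "n < p * K" using K0 by (simp add: div_less_iff_less_mult)
      hence "real n / real K \<le> real p" using K0
        by (simp add: field_simps flip: of_nat_mult)
      moreover have "ln (real p) / real p \<ge> 0" using prime_ge_1_nat[OF pp] by simp
      ultimately have "real n / real K * (ln (real p) / real p) \<le> real p * (ln (real p) / real p)"
        by (rule mult_right_mono)
      thus "real n / real K * (ln (real p) / real p) \<le> ln (real p)"
        using prime_gt_0_nat[OF pp] by simp
    qed
    finally show "real n / real K \<le> (\<Sum>p\<in>?B. ln (real p))" by simp
  qed
qed

text \<open>Each prime counted contributes at least ln y to a sum of size at most 4x. The
  denominator is ln y because in the applications only the lower end point is fixed, while x runs
  over quotients such as \<open>real N / (real a * real (max b c))\<close>.\<close>

lemma card_primes_between_le:
  assumes "1 < y"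
  shows "real (card {p. prime p \<and> y < real p \<and> real p \<le> x}) \<le> 4 * max x 0 / ln y"
proof -
  let ?B = "{p. prime p \<and> y < real p \<and> real p \<le> x}"
  have sub: "?B \<subseteq> primes_upto (nat \<lfloor>x\<rfloor>)"
    by (auto simp: primes_upto_def le_nat_floor)
  have "real (card ?B) * ln y = (\<Sum>p\<in>?B. ln y)" by simp
  also have "\<dots> \<le> (\<Sum>p\<in>?B. ln (real p))"
    using assms by (intro sum_mono) auto
  also have "\<dots> \<le> (\<Sum>p\<in>primes_upto (nat \<lfloor>x\<rfloor>). ln (real p))"
    using sub by (intro sum_mono2) (auto simp: primes_upto_def dest: prime_ge_1_nat)
  also have "\<dots> \<le> 4 * real (nat \<lfloor>x\<rfloor>)" by (rule sum_ln_primes_le)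
  also have "\<dots> \<le> 4 * max x 0" by linarith
  finally show ?thesis using assms by (simp add: field_simps)
qed

section \<open>Sums of powers of the number of prime factors\<close>

definition bigomega :: "nat set \<Rightarrow> nat \<Rightarrow> nat" where
  "bigomega P m = (\<Sum>p\<in>P. multiplicity p m)"

lemma bigomega_1 [simp]: "bigomega P (Suc 0) = 0"
  by (simp add: bigomega_def)

lemma bigomega_mult:
  assumes "\<And>p. p \<in> P \<Longrightarrow> prime p" "a > 0" "b > 0"
  shows "bigomega P (a * b) = bigomega P a + bigomega P b"
proof -
  have "bigomega P (a * b) = (\<Sum>p\<in>P. multiplicity p a + multiplicity p b)"
    unfolding bigomega_def using assms
    by (intro sum.cong refl prime_elem_multiplicity_mult_distrib) auto
  thus ?thesis by (simp add: bigomega_def sum.distrib)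
qed

lemma bigomega_prime:
  assumes "\<And>p. p \<in> P \<Longrightarrow> prime p" "finite P" "prime q"
  shows "bigomega P q = (if q \<in> P then 1 else 0)"
proof -
  have "bigomega P q = (\<Sum>p\<in>P. if p = q then 1 else 0)"
    unfolding bigomega_def using assms
    by (intro sum.cong refl) (auto simp: prime_multiplicity_other)
  thus ?thesis using assms(2) by simp
qed

lemma bigomega_prime_times:
  assumes "\<And>p. p \<in> P \<Longrightarrow> prime p" "finite P" "prime q" "m > 0"
  shows "bigomega P (q * m) = (if q \<in> P then Suc (bigomega P m) else bigomega P m)"
  using bigomega_mult[of P q m] bigomega_prime[of P q] assms by (auto simp: prime_gt_0_nat)

lemma bigomega_insert_not_dvd:
  assumes "finite P" "p \<notin> P" "\<not> p dvd m"
  shows "bigomega (insert p P) m = bigomega P m"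
  using assms by (simp add: bigomega_def not_dvd_imp_multiplicity_0)

lemma bigomega_primes_upto_eq:
  assumes "1 \<le> m" "m \<le> n"
  shows "bigomega (primes_upto n) m = bigomega (primes_upto m) m"
  unfolding bigomega_def
proof (rule sum.mono_neutral_right)
  show "\<forall>i\<in>primes_upto n - primes_upto m. multiplicity i m = 0"
  proof
    fix p assume "p \<in> primes_upto n - primes_upto m"
    hence "\<not> p dvd m" using assms by (auto simp: primes_upto_def dest: dvd_imp_le)
    thus "multiplicity p m = 0" by (rule not_dvd_imp_multiplicity_0)
  qed
qed (use assms in \<open>auto simp: primes_upto_def\<close>)

lemma sum_multiples:
  fixes g :: "nat \<Rightarrow> 'a::comm_monoid_add"
  assumes "p > 0"
  shows "(\<Sum>m\<in>{m\<in>{1..n}. p dvd m}. g m) = (\<Sum>m\<in>{1..n div p}. g (p * m))"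
  by (rule sum.reindex_bij_witness[of _ "\<lambda>m. p * m" "\<lambda>m. m div p"])
     (use assms in \<open>auto elim!: dvdE simp: less_eq_div_iff_mult_less_eq mult.commute Suc_le_eq\<close>)

text \<open>
  Adding a prime \<open>p\<close> to \<open>P\<close> changes the sum over \<open>{1..n}\<close> by \<open>D n\<close>, which satisfies
  \<open>D n = z * D (n div p) + (z - 1) * (\<Sum>m\<in>{1..n div p}. z ^ bigomega P m)\<close>.
\<close>

lemma sum_power_bigomega_le_prod:
  fixes z :: real
  assumes z: "1 \<le> z" "z < 2" and "finite P" "\<And>p. p \<in> P \<Longrightarrow> prime p"
  shows "(\<Sum>m\<in>{1..n}. z ^ bigomega P m) \<le> real n * (\<Prod>p\<in>P. 1 + (z - 1) / (real p - z))"
  using assms(3,4)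
proof (induction P arbitrary: n)
  case empty
  then show ?case by (simp add: bigomega_def)
next
  case (insert p P)
  define c where "c = (\<Prod>p\<in>P. 1 + (z - 1) / (real p - z))"
  have IH: "(\<Sum>m\<in>{1..n}. z ^ bigomega P m) \<le> real n * c" for n
    unfolding c_def using insert by auto
  have p: "prime p" "real p \<ge> 2" using insert.prems by (auto simp: prime_ge_2_nat)
  \<comment> \<open>The hypothesis z < 2 keeps p - z positive at p = 2.\<close>
  have pz: "real p - z > 0" "p > 0" using p z by auto
  define D where "D n = (\<Sum>m\<in>{1..n}. z ^ bigomega (insert p P) m - z ^ bigomega P m)" for n
  have rec: "D n = z * D (n div p) + (z - 1) * (\<Sum>m\<in>{1..n div p}. z ^ bigomega P m)" for n
  proof -
    have "D n = (\<Sum>m\<in>{m\<in>{1..n}. p dvd m}. z ^ bigomega (insert p P) m - z ^ bigomega P m)"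
      unfolding D_def using insert.hyps
      by (intro sum.mono_neutral_right) (auto simp: bigomega_insert_not_dvd)
    also have "\<dots> = (\<Sum>m\<in>{1..n div p}. z ^ bigomega (insert p P) (p * m) - z ^ bigomega P (p * m))"
      using pz by (intro sum_multiples) auto
    also have "\<dots> = (\<Sum>m\<in>{1..n div p}. z * z ^ bigomega (insert p P) m - z ^ bigomega P m)"
    proof (rule sum.cong[OF refl])
      fix m assume "m \<in> {1..n div p}"
      hence "bigomega (insert p P) (p * m) = Suc (bigomega (insert p P) m)" "bigomega P (p * m) = bigomega P m"
        using insert.hyps insert.prems p by (subst bigomega_prime_times; auto)+
      thus "z ^ bigomega (insert p P) (p * m) - z ^ bigomega P (p * m) = z * z ^ bigomega (insert p P) m - z ^ bigomega P m"
        by simp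
    qed
    also have "\<dots> = z * D (n div p) + (z - 1) * (\<Sum>m\<in>{1..n div p}. z ^ bigomega P m)"
      by (simp add: D_def sum_subtractf sum_distrib_left algebra_simps)
    finally show ?thesis .
  qed
  \<comment> \<open>A fixed point of the recurrence: the bound k n for \<open>D n\<close> reproduces
    itself because z k + (z - 1) c = p k.\<close>
  define k where "k = (z - 1) * c / (real p - z)"
  have c0: "c \<ge> 0" unfolding c_def
  proof (intro prod_nonneg ballI)
    fix q assume "q \<in> P"
    hence "real q \<ge> 2" using insert.prems prime_ge_2_nat[of q] by auto
    thus "0 \<le> 1 + (z - 1) / (real q - z)" using z by simp
  qed
  have k0: "k \<ge> 0" using c0 pz z by (simp add: k_def)
  have k: "z * k + (z - 1) * c = real p * k" using pz by (simp add: k_def field_simps)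
  have D: "D n \<le> k * real n" for n
  proof (induction n rule: less_induct)
    case (less n)
    show ?case
    proof (cases "n = 0")
      case False
      have "n div p < n" using False p prime_gt_1_nat[of p] by (intro div_less_dividend) auto
      hence "D n \<le> z * (k * real (n div p)) + (z - 1) * (real (n div p) * c)"
        unfolding rec[of n] using less z IH by (intro add_mono mult_left_mono) auto
      also have "\<dots> = real (n div p) * (z * k + (z - 1) * c)" by (simp add: algebra_simps)
      also have "\<dots> = (real (n div p) * real p) * k" unfolding k by simp
      also have "real (n div p) * real p \<le> real n"
        using div_times_less_eq_dividend[of n p] by (simp flip: of_nat_mult)
      finally show ?thesis using k0 by (simp add: mult_right_mono mult.commute)
    qed (simp add: D_def)
  qed
  have "(\<Sum>m\<in>{1..n}. z ^ bigomega (insert p P) m) = D n + (\<Sum>m\<in>{1..n}. z ^ bigomega P m)"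
    by (simp add: D_def sum_subtractf)
  also have "\<dots> \<le> k * real n + real n * c" using D[of n] IH[of n] by linarith
  also have "\<dots> = real n * (\<Prod>p\<in>insert p P. 1 + (z - 1) / (real p - z))"
    using insert.hyps by (simp add: c_def[symmetric] k_def algebra_simps)
  finally show ?case .
qed

section \<open>Euler products as powers of the logarithm\<close>

lemma sum_inverse_squares_le: "n \<ge> 1 \<Longrightarrow> (\<Sum>k\<in>{2..n}. 1 / real k ^ 2) \<le> 1 - 1 / real n"
proof (induction n rule: nat_induct_at_least)
  case (Suc n)
  have "1 / real (Suc n) ^ 2 \<le> 1 / (real n * real (Suc n))"
    using Suc by (intro divide_left_mono) (auto simp: power2_eq_square)
  also have "\<dots> = 1 / real n - 1 / real (Suc n)"
    using Suc by (simp add: field_simps)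
  finally show ?case using Suc by simp
qed simp

lemma sum_inverse_prime_squares_le: "(\<Sum>p\<in>primes_upto n. 1 / real p ^ 2) \<le> 1"
proof -
  have "(\<Sum>p\<in>primes_upto n. 1 / real p ^ 2) \<le> (\<Sum>k\<in>{2..n}. 1 / real k ^ 2)"
    by (rule sum_mono2) (auto simp: primes_upto_def prime_ge_2_nat)
  also have "\<dots> \<le> 1"
  proof (cases "n \<ge> 1")
    case True
    have "1 / real n \<ge> 0" by simp
    with sum_inverse_squares_le[OF True] show ?thesis by linarith
  qed (auto simp: not_le)
  finally show ?thesis .
qed

text \<open>The terms of order 1 / p^2 add up to at most \<open>B\<close>, so the product behaves
  like the exponential of t times the sum of 1 / p, which Mertens turns into a constant times (ln
  n)^t.\<close>

lemma prod_le_exp_primes: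
  fixes f :: "nat \<Rightarrow> real"
  assumes "\<And>p. prime p \<Longrightarrow> 0 \<le> f p"
    and "\<And>p. prime p \<Longrightarrow> f p \<le> exp (t / real p + B / real p ^ 2)" and "B \<ge> 0"
  shows "(\<Prod>p\<in>primes_upto n. f p) \<le> exp (t * (\<Sum>p\<in>primes_upto n. 1 / real p) + B)"
proof -
  have "(\<Prod>p\<in>primes_upto n. f p) \<le> (\<Prod>p\<in>primes_upto n. exp (t / real p + B / real p ^ 2))"
    using assms by (intro prod_mono) (auto simp: primes_upto_def)
  also have "\<dots> = exp (t * (\<Sum>p\<in>primes_upto n. 1 / real p) + B * (\<Sum>p\<in>primes_upto n. 1 / real p ^ 2))"
    by (simp add: exp_sum[symmetric] sum.distrib sum_distrib_left)
  also have "\<dots> \<le> exp (t * (\<Sum>p\<in>primes_upto n. 1 / real p) + B)"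
    using mult_left_mono[OF sum_inverse_prime_squares_le \<open>B \<ge> 0\<close>, of n] by simp
  finally show ?thesis .
qed

lemma sum_power_bigomega_le_ge1:
  fixes z :: real
  assumes z: "1 \<le> z" "z < 2"
  obtains C where "C > 0"
    "\<And>n. n \<ge> 2 \<Longrightarrow> (\<Sum>m\<in>{1..n}. z ^ bigomega (primes_upto n) m) \<le> C * real n * ln (real n) powr (z - 1)"
proof -
  obtain M where M: "\<And>n. n \<ge> 2 \<Longrightarrow> \<bar>(\<Sum>p\<in>primes_upto n. 1 / real p) - ln (ln (real n))\<bar> \<le> M"
    using mertens_second by blast
  \<comment> \<open>Chosen so that (z - 1) z / (p (p - z)) \<le> B / p^2, using p - z \<ge> p (1 - z
    / 2) for p \<ge> 2.\<close>
  define B where "B = (z - 1) * z / (1 - z / 2)"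
  have B: "B \<ge> 0" using z by (simp add: B_def)
  show ?thesis
  proof (rule that[of "exp ((z - 1) * M + B)"])
    fix n :: nat assume n: "n \<ge> 2"
    have "(\<Prod>p\<in>primes_upto n. 1 + (z - 1) / (real p - z)) \<le>
        exp ((z - 1) * (\<Sum>p\<in>primes_upto n. 1 / real p) + B)"
    proof (rule prod_le_exp_primes[OF _ _ B])
      fix p :: nat assume "prime p"
      hence p: "real p \<ge> 2" using prime_ge_2_nat[of p] by simp
      thus "0 \<le> 1 + (z - 1) / (real p - z)" using z by simp
      have "real p * (1 - z / 2) \<le> real p - z" using p z mult_right_mono[OF p, of "z / 2"]
        by (simp add: algebra_simps)
      hence "(z - 1) * z / (real p * (real p - z)) \<le> (z - 1) * z / (real p * (real p * (1 - z / 2)))"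
        using p z by (intro divide_left_mono mult_left_mono mult_pos_pos) auto
      also have "\<dots> = B / real p ^ 2" using p z by (simp add: B_def power2_eq_square)
      finally have 1: "(z - 1) * z / (real p * (real p - z)) \<le> B / real p ^ 2" .
      have "(z - 1) / (real p - z) = (z - 1) / real p + (z - 1) * z / (real p * (real p - z))"
        using p z by (simp add: field_simps)
      also have "\<dots> \<le> (z - 1) / real p + B / real p ^ 2" using 1 by simp
      finally show "1 + (z - 1) / (real p - z) \<le> exp ((z - 1) / real p + B / real p ^ 2)"
        using exp_ge_add_one_self[of "(z - 1) / real p + B / real p ^ 2"] by linarith
    qed
    also have "\<dots> \<le> exp ((z - 1) * (ln (ln (real n)) + M) + B)"
      using M[OF n] z by (simp add: mult_left_mono)
    also have "\<dots> = exp ((z - 1) * M + B) * ln (real n) powr (z - 1)"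
      using n by (simp add: powr_def exp_add[symmetric] algebra_simps)
    finally have le: "(\<Prod>p\<in>primes_upto n. 1 + (z - 1) / (real p - z)) \<le> exp ((z - 1) * M + B) * ln (real n) powr (z - 1)" .
    have "(\<Sum>m\<in>{1..n}. z ^ bigomega (primes_upto n) m) \<le> real n * (\<Prod>p\<in>primes_upto n. 1 + (z - 1) / (real p - z))"
      using z by (intro sum_power_bigomega_le_prod) (auto simp: primes_upto_def)
    also have "\<dots> \<le> real n * (exp ((z - 1) * M + B) * ln (real n) powr (z - 1))"
      by (intro mult_left_mono le) auto
    finally show "(\<Sum>m\<in>{1..n}. z ^ bigomega (primes_upto n) m) \<le> exp ((z - 1) * M + B) * real n * ln (real n) powr (z - 1)"
      by (simp add: mult_ac)
  qed auto
qed

text \<open>Dividing the multiples of a new prime p by p shows that they contribute at most z / p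
  times the whole sum. As z / p < 1, the resulting inequality can be solved for that sum, which
  produces the Euler factor at p.\<close>

lemma sum_power_bigomega_over_le_prod:
  fixes z :: real
  assumes z: "0 \<le> z" "z \<le> 1" and "finite P" "\<And>p. p \<in> P \<Longrightarrow> prime p"
  shows "(\<Sum>m\<in>{m\<in>{1..n}. prime_factors m \<subseteq> P}. z ^ bigomega P m / real m) \<le> (\<Prod>p\<in>P. 1 / (1 - z / real p))"
  using assms(3,4)
proof (induction P)
  case empty
  have "{m\<in>{1..n}. prime_factors m \<subseteq> {}} \<subseteq> {1}"
    by (auto simp: prime_factorization_empty_iff)
  hence "(\<Sum>m\<in>{m\<in>{1..n}. prime_factors m \<subseteq> {}}. z ^ bigomega {} m / real m) \<le> (\<Sum>m\<in>{1::nat}. z ^ bigomega {} m / real m)"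
    using z by (intro sum_mono2) auto
  then show ?case by (simp add: bigomega_def)
next
  case (insert p P)
  define R where "R P = (\<Sum>m\<in>{m\<in>{1..n}. prime_factors m \<subseteq> P}. z ^ bigomega P m / real m)" for P
  have p: "prime p" "real p \<ge> 2" using insert.prems by (auto simp: prime_ge_2_nat)
  hence p0: "p > 0" by auto
  have zp: "z / real p < 1" using p z by (simp add: field_simps)
  let ?Q = "insert p P"
  let ?A = "{m\<in>{1..n}. prime_factors m \<subseteq> ?Q \<and> \<not> p dvd m}"
  let ?B = "{m\<in>{m\<in>{1..n}. p dvd m}. prime_factors m \<subseteq> ?Q}"
  have "R ?Q = (\<Sum>m\<in>?A. z ^ bigomega ?Q m / real m) + (\<Sum>m\<in>?B. z ^ bigomega ?Q m / real m)"
    unfolding R_def by (subst sum.union_disjoint[symmetric]) (auto intro!: sum.cong)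
  also have "(\<Sum>m\<in>?A. z ^ bigomega ?Q m / real m) = (\<Sum>m\<in>?A. z ^ bigomega P m / real m)"
    using insert.hyps by (intro sum.cong) (auto simp: bigomega_insert_not_dvd)
  also have "\<dots> \<le> R P"
    unfolding R_def using z by (intro sum_mono2) (auto simp: in_prime_factors_iff)
  also have "(\<Sum>m\<in>?B. z ^ bigomega ?Q m / real m) =
      (\<Sum>m\<in>{m\<in>{1..n}. p dvd m}. if prime_factors m \<subseteq> ?Q then z ^ bigomega ?Q m / real m else 0)"
    by (rule sum.inter_filter) auto
  also have "\<dots> = (\<Sum>m\<in>{1..n div p}. if prime_factors (p * m) \<subseteq> ?Q then z ^ bigomega ?Q (p * m) / real (p * m) else 0)"
    by (rule sum_multiples) (rule p0)
  also have "\<dots> \<le> (\<Sum>m\<in>{1..n}. if prime_factors m \<subseteq> ?Q then z / real p * (z ^ bigomega ?Q m / real m) else 0)"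
  proof (rule order.trans[OF sum_mono sum_mono2])
    fix m assume "m \<in> {1..n div p}"
    hence m: "m > 0" by auto
    have "bigomega ?Q (p * m) = Suc (bigomega ?Q m)"
      using insert.hyps insert.prems p m by (subst bigomega_prime_times; auto)
    moreover have "prime_factors m \<subseteq> prime_factors (p * m)"
      using m p0 by (simp add: prime_factors_product)
    ultimately show "(if prime_factors (p * m) \<subseteq> ?Q then z ^ bigomega ?Q (p * m) / real (p * m) else 0)
        \<le> (if prime_factors m \<subseteq> ?Q then z / real p * (z ^ bigomega ?Q m / real m) else 0)"
      using z by auto
  next
    show "{1..n div p} \<subseteq> {1..n}" using div_le_dividend[of n p] by (auto intro: order.trans)
  qed (use z in auto)
  also have "\<dots> = z / real p * R ?Q"
    unfolding R_def sum_distrib_left by (rule sum.inter_filter[symmetric]) auto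
  finally have "R ?Q \<le> R P + z / real p * R ?Q" by simp
  hence "R ?Q * (1 - z / real p) \<le> R P" by (simp add: algebra_simps)
  hence "R ?Q \<le> R P * (1 / (1 - z / real p))" using zp by (simp add: field_simps)
  also have "\<dots> \<le> (\<Prod>p\<in>P. 1 / (1 - z / real p)) * (1 / (1 - z / real p))"
    using insert zp by (intro mult_right_mono) (auto simp: R_def)
  finally show ?case using insert.hyps by (simp add: R_def mult.commute)
qed

lemma sum_hyperbola_swap:
  fixes g :: "nat \<Rightarrow> nat \<Rightarrow> 'a::comm_monoid_add"
  shows "(\<Sum>d\<in>{1..n}. \<Sum>e\<in>{1..n div d}. g d e) = (\<Sum>e\<in>{1..n}. \<Sum>d\<in>{1..n div e}. g d e)"
proof -
  have eq: "{1..n div d} = {e\<in>{1..n}. d * e \<le> n}" if "d \<in> {1..n}" for d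
  proof -
    have "e \<le> n" if "e * d \<le> n" for e
      using that \<open>d \<in> {1..n}\<close> by (metis atLeastAtMost_iff le_trans mult.right_neutral mult_le_mono2)
    thus ?thesis using that by (auto simp: less_eq_div_iff_mult_less_eq Suc_le_eq mult.commute)
  qed
  have "(\<Sum>d\<in>{1..n}. \<Sum>e\<in>{1..n div d}. g d e) = (\<Sum>d\<in>{1..n}. \<Sum>e\<in>{e\<in>{1..n}. d * e \<le> n}. g d e)"
    by (intro sum.cong eq refl)
  also have "\<dots> = (\<Sum>e\<in>{1..n}. \<Sum>d\<in>{d\<in>{1..n}. d * e \<le> n}. g d e)"
    by (rule sum.swap_restrict) auto
  also have "\<dots> = (\<Sum>e\<in>{1..n}. \<Sum>d\<in>{1..n div e}. g d e)"
    using eq by (intro sum.cong refl) (simp add: mult.commute)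
  finally show ?thesis .
qed

text \<open>
  Weighting by \<open>ln n = ln (n / m) + ln m\<close> and opening \<open>ln m\<close> as a divisor sum of
  \<open>mangoldt\<close> saves a logarithm over the trivial bound.
\<close>

lemma sum_multiplicative_ln_le:
  fixes f :: "nat \<Rightarrow> real"
  assumes f: "\<And>m. 0 \<le> f m" "\<And>m. f m \<le> 1"
    and mult: "\<And>a b. a > 0 \<Longrightarrow> b > 0 \<Longrightarrow> f (a * b) = f a * f b"
  shows "(\<Sum>m\<in>{1..n}. f m) * ln (real n) \<le> 5 * real n * (\<Sum>m\<in>{1..n}. f m / real m)"
proof -
  have "(\<Sum>m\<in>{1..n}. f m * ln (real m)) = (\<Sum>m\<in>{1..n}. \<Sum>d | d dvd m. f d * f (m div d) * mangoldt d)"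
  proof (intro sum.cong refl)
    fix m assume m: "m \<in> {1..n}"
    have "f m * ln (real m) = (\<Sum>d | d dvd m. f m * mangoldt d)"
      using m by (simp add: mangoldt_sum sum_distrib_left[symmetric])
    also have "\<dots> = (\<Sum>d | d dvd m. f d * f (m div d) * mangoldt d)"
    proof (intro sum.cong refl)
      fix d assume "d \<in> {d. d dvd m}"
      hence "m = d * (m div d)" "d > 0" "m div d > 0" using m by (auto elim!: dvdE)
      hence "f m = f d * f (m div d)" by (metis mult)
      thus "f m * mangoldt d = f d * f (m div d) * mangoldt d" by simp
    qed
    finally show "f m * ln (real m) = (\<Sum>d | d dvd m. f d * f (m div d) * mangoldt d)" .
  qed
  also have "\<dots> = (\<Sum>d\<in>{1..n}. \<Sum>e\<in>{1..n div d}. f d * f e * mangoldt d)"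
    by (rule sum_divisors_swap)
  also have "\<dots> = (\<Sum>e\<in>{1..n}. \<Sum>d\<in>{1..n div e}. f d * f e * mangoldt d)"
    by (rule sum_hyperbola_swap)
  \<comment> \<open>Only \<open>f d\<close> is replaced by 1: keeping \<open>f e\<close> leaves the
    sum of f e / e, and the inner sum becomes \<open>psi (n div e)\<close>, at most 4 n / e. The
    final 5 is 4 + 1, the 1 coming from ln (n / m) \<le> n / m.\<close>
  also have "\<dots> \<le> (\<Sum>e\<in>{1..n}. \<Sum>d\<in>{1..n div e}. 1 * f e * mangoldt d)"
    using f by (intro sum_mono mult_right_mono mangoldt_nonneg) auto
  also have "\<dots> = (\<Sum>e\<in>{1..n}. f e * psi (n div e))"
    by (simp add: psi_def sum_distrib_left)
  also have "\<dots> \<le> (\<Sum>e\<in>{1..n}. f e * (4 * (real n / real e)))"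
  proof (intro sum_mono mult_left_mono f)
    fix e
    show "psi (n div e) \<le> 4 * (real n / real e)"
      using psi_le[of "n div e"] of_nat_div_le_of_nat[of n e, where ?'a = real] by linarith
  qed
  finally have 1: "(\<Sum>m\<in>{1..n}. f m * ln (real m)) \<le> (\<Sum>e\<in>{1..n}. f e * (4 * (real n / real e)))" .
  have 2: "(\<Sum>m\<in>{1..n}. f m * (ln (real n) - ln (real m))) \<le> (\<Sum>m\<in>{1..n}. f m * (real n / real m))"
  proof (intro sum_mono mult_left_mono f)
    fix m assume m: "m \<in> {1..n}"
    have "ln (real n / real m) \<le> real n / real m - 1" using m by (intro ln_le_minus_one) auto
    thus "ln (real n) - ln (real m) \<le> real n / real m" using m by (simp add: ln_div)
  qed
  have "(\<Sum>m\<in>{1..n}. f m) * ln (real n) =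
      (\<Sum>m\<in>{1..n}. f m * (ln (real n) - ln (real m))) + (\<Sum>m\<in>{1..n}. f m * ln (real m))"
    unfolding sum_distrib_right sum.distrib[symmetric] by (intro sum.cong refl) (simp add: algebra_simps)
  also have "\<dots> \<le> (\<Sum>m\<in>{1..n}. f m * (real n / real m)) + (\<Sum>e\<in>{1..n}. f e * (4 * (real n / real e)))"
    using 1 2 by linarith
  also have "\<dots> = 5 * real n * (\<Sum>m\<in>{1..n}. f m / real m)"
    by (simp add: sum_distrib_left sum.distrib[symmetric] mult_ac)
  finally show ?thesis .
qed

text \<open>For z < 1 the recurrence behind the case z \<ge> 1 has a negative coefficient z - 1 and
  yields no upper bound. Instead the Euler product bounds the sum with weights 1 / m by a multiple
  of (ln n)^z, and the saved logarithm lowers the exponent to z - 1.\<close>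

lemma sum_power_bigomega_le_le1:
  fixes z :: real
  assumes z: "0 < z" "z \<le> 1"
  obtains C where "C > 0"
    "\<And>n. n \<ge> 2 \<Longrightarrow> (\<Sum>m\<in>{1..n}. z ^ bigomega (primes_upto n) m) \<le> C * real n * ln (real n) powr (z - 1)"
proof -
  obtain M where M: "\<And>n. n \<ge> 2 \<Longrightarrow> \<bar>(\<Sum>p\<in>primes_upto n. 1 / real p) - ln (ln (real n))\<bar> \<le> M"
    using mertens_second by blast
  show ?thesis
  proof (rule that[of "5 * exp (z * M + 2)"])
    fix n :: nat assume n: "n \<ge> 2"
    let ?P = "primes_upto n"
    let ?f = "\<lambda>m. z ^ bigomega ?P m"
    have "(\<Prod>p\<in>?P. 1 / (1 - z / real p)) \<le> exp (z * (\<Sum>p\<in>?P. 1 / real p) + 2)"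
    proof (rule prod_le_exp_primes)
      fix p :: nat assume "prime p"
      hence p: "real p \<ge> 2" using prime_ge_2_nat[of p] by simp
      define x where "x = z / real p"
      have x: "0 \<le> x" "x \<le> 1 / 2" using p z by (auto simp: x_def field_simps)
      show "0 \<le> 1 / (1 - z / real p)" using x by (simp add: x_def[symmetric])
      have "- x - 2 * x ^ 2 \<le> ln (1 - x)" using x by (rule ln_one_minus_pos_lower_bound)
      hence "exp (- (x + 2 * x ^ 2)) \<le> 1 - x" using x by (simp add: ln_ge_iff)
      hence "1 / (1 - x) \<le> 1 / exp (- (x + 2 * x ^ 2))"
        using x by (intro divide_left_mono mult_pos_pos) auto
      also have "\<dots> = exp (x + 2 * x ^ 2)" by (subst exp_minus) (simp add: divide_inverse)
      also have "\<dots> \<le> exp (z / real p + 2 / real p ^ 2)"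
      proof -
        have "z ^ 2 \<le> 1" using z by (simp add: power_le_one)
        thus ?thesis by (simp add: x_def power_divide divide_right_mono)
      qed
      finally show "1 / (1 - z / real p) \<le> exp (z / real p + 2 / real p ^ 2)" by (simp add: x_def)
    qed auto
    also have "\<dots> \<le> exp (z * (ln (ln (real n)) + M) + 2)"
      using M[OF n] z by simp
    also have "\<dots> = exp (z * M + 2) * ln (real n) powr z"
      using n by (simp add: powr_def exp_add[symmetric] algebra_simps)
    finally have le: "(\<Prod>p\<in>?P. 1 / (1 - z / real p)) \<le> exp (z * M + 2) * ln (real n) powr z" .
    have "prime_factors m \<subseteq> ?P" if "m \<in> {1..n}" for m
    proof
      fix p assume "p \<in> prime_factors m"
      hence "prime p" "p dvd m" by (auto simp: in_prime_factors_iff)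
      moreover from this that have "p \<le> m" by (intro dvd_imp_le) auto
      ultimately show "p \<in> ?P" using that by (simp add: primes_upto_def)
    qed
    hence eq: "{m\<in>{1..n}. prime_factors m \<subseteq> ?P} = {1..n}" by blast
    have "(\<Sum>m\<in>{m\<in>{1..n}. prime_factors m \<subseteq> ?P}. ?f m / real m) \<le> (\<Prod>p\<in>?P. 1 / (1 - z / real p))"
      using z by (intro sum_power_bigomega_over_le_prod) (auto simp: primes_upto_def)
    hence "(\<Sum>m\<in>{1..n}. ?f m / real m) \<le> (\<Prod>p\<in>?P. 1 / (1 - z / real p))"
      unfolding eq .
    with le have le2: "(\<Sum>m\<in>{1..n}. ?f m / real m) \<le> exp (z * M + 2) * ln (real n) powr z" by linarith
    have "(\<Sum>m\<in>{1..n}. ?f m) * ln (real n) \<le> 5 * real n * (\<Sum>m\<in>{1..n}. ?f m / real m)"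
    proof (rule sum_multiplicative_ln_le)
      fix a b :: nat assume "a > 0" "b > 0"
      hence "bigomega ?P (a * b) = bigomega ?P a + bigomega ?P b" by (intro bigomega_mult) (auto simp: primes_upto_def)
      thus "?f (a * b) = ?f a * ?f b" by (simp add: power_add)
    qed (use z in \<open>auto simp: power_le_one\<close>)
    also have "\<dots> \<le> 5 * real n * (exp (z * M + 2) * ln (real n) powr z)"
      by (intro mult_left_mono le2) auto
    also have "ln (real n) powr z = ln (real n) powr (z - 1) * ln (real n)"
      using n by (simp add: powr_diff)
    finally show "(\<Sum>m\<in>{1..n}. ?f m) \<le> 5 * exp (z * M + 2) * real n * ln (real n) powr (z - 1)"
      using n by (simp add: mult_ac)
  qed auto
qed

section \<open>The multiplication table\<close>

definition product_set :: "nat \<Rightarrow> nat set" where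
  "product_set N = (\<lambda>(m, n). m * n) ` ({1..N} \<times> {1..N})"

lemma finite_product_set [simp]: "finite (product_set N)"
  by (simp add: product_set_def)

lemma ln2_bounds: "1 / 2 < ln (2::real)" "ln (2::real) < 1"
proof -
  have "exp (1 / 2) ^ 2 = exp (1::real)" by (simp flip: exp_of_nat_mult)
  hence "exp (1 / 2) ^ 2 < (2::real) ^ 2" using exp_le by simp
  hence "exp (1 / 2) < (2::real)" by (rule power_less_imp_less_base) simp
  hence "ln (exp (1 / 2)) < ln (2::real)" by (subst ln_less_cancel_iff) auto
  thus "1 / 2 < ln (2::real)" by simp
qed (rule ln_2_less_1)

lemma card_bigomega_ge_le:
  obtains C where "C > 0" "\<And>n. n \<ge> 3 \<Longrightarrow>
    real (card {k\<in>{1..n\<^sup>2}. ln (ln (real n)) / ln 2 \<le> real (bigomega (primes_upto (n\<^sup>2)) k)})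
      \<le> C * real n ^ 2 * ln (real n) powr (- energy_exponent)"
proof -
  \<comment> \<open>Minimises the exponent z - 1 - ln z / ln 2 of ln n; the minimum is minus
    \<open>energy_exponent\<close>. The bounds 1/2 < ln 2 < 1 put z into the admissible
    range.\<close>
  define z where "z = 1 / ln (2::real)"
  have z: "1 \<le> z" "z < 2" using ln2_bounds by (auto simp: z_def field_simps)
  obtain C where C: "C > 0"
    "\<And>n. n \<ge> 2 \<Longrightarrow> (\<Sum>m\<in>{1..n}. z ^ bigomega (primes_upto n) m) \<le> C * real n * ln (real n) powr (z - 1)"
    using sum_power_bigomega_le_ge1[OF z] by blast
  show ?thesis
  proof (rule that[of "C * 2 powr (z - 1)"])
    fix n :: nat assume n: "n \<ge> 3"
    define L where "L = ln (ln (real n))"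
    have lnn: "ln (real n) > 0" using n by simp
    let ?bigomega = "bigomega (primes_upto (n\<^sup>2))"
    let ?A = "{k\<in>{1..n\<^sup>2}. L / ln 2 \<le> real (?bigomega k)}"
    have "real (card ?A) = (\<Sum>k\<in>?A. 1)" by simp
    also have "\<dots> \<le> (\<Sum>k\<in>?A. z ^ ?bigomega k * z powr (- (L / ln 2)))"
    proof (rule sum_mono)
      fix k assume "k \<in> ?A"
      hence "z powr 0 \<le> z powr (real (?bigomega k) - L / ln 2)" using z by (intro powr_mono) auto
      thus "1 \<le> z ^ ?bigomega k * z powr (- (L / ln 2))" using z by (simp add: powr_realpow[symmetric] powr_diff powr_minus_divide)
    qed
    also have "\<dots> \<le> (\<Sum>k\<in>{1..n\<^sup>2}. z ^ ?bigomega k * z powr (- (L / ln 2)))"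
      using z by (intro sum_mono2) auto
    also have "\<dots> \<le> (C * real (n\<^sup>2) * ln (real (n\<^sup>2)) powr (z - 1)) * z powr (- (L / ln 2))"
    proof (subst sum_distrib_right[symmetric], intro mult_right_mono C(2))
      show "2 \<le> n\<^sup>2" using n power_mono[of 3 n 2] by simp
    qed auto
    also have "ln (real (n\<^sup>2)) powr (z - 1) = 2 powr (z - 1) * ln (real n) powr (z - 1)"
      using n by (simp add: ln_realpow powr_mult)
    also have "z powr (- (L / ln 2)) = ln (real n) powr (ln (ln 2) / ln 2)"
      using lnn by (simp add: z_def powr_def L_def ln_div)
    also have "C * real (n\<^sup>2) * (2 powr (z - 1) * ln (real n) powr (z - 1)) * ln (real n) powr (ln (ln 2) / ln 2)
      = C * 2 powr (z - 1) * real n ^ 2 * ln (real n) powr (z - 1 + ln (ln 2) / ln 2)"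
      by (simp add: powr_add mult_ac)
    also have "z - 1 + ln (ln 2) / ln 2 = - energy_exponent"
      by (simp add: z_def energy_exponent_def add_divide_distrib)
    finally show "real (card {k\<in>{1..n\<^sup>2}. ln (ln (real n)) / ln 2 \<le> real (?bigomega k)})
        \<le> C * 2 powr (z - 1) * real n ^ 2 * ln (real n) powr (- energy_exponent)"
      by (simp add: L_def)
  qed (use C in auto)
qed

lemma card_pairs_bigomega_le:
  obtains C where "C > 0" "\<And>n. n \<ge> 3 \<Longrightarrow>
    real (card {(a, b). a \<in> {1..n} \<and> b \<in> {1..n} \<and>
        real (bigomega (primes_upto n) a + bigomega (primes_upto n) b) \<le> ln (ln (real n)) / ln 2})
      \<le> C * real n ^ 2 * ln (real n) powr (- energy_exponent)"
proof -
  \<comment> \<open>Now the exponent is 2 (z - 1) - ln z / ln 2, with one factor for each of a and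
    b. It is minimal at this z, where it again equals minus \<open>energy_exponent\<close>; z \<le>
    1 is what a bound for the lower tail requires.\<close>
  define z where "z = 1 / (2 * ln (2::real))"
  have z: "0 < z" "z \<le> 1" using ln2_bounds by (auto simp: z_def field_simps)
  obtain C where C: "C > 0"
    "\<And>n. n \<ge> 2 \<Longrightarrow> (\<Sum>m\<in>{1..n}. z ^ bigomega (primes_upto n) m) \<le> C * real n * ln (real n) powr (z - 1)"
    using sum_power_bigomega_le_le1[OF z] by blast
  show ?thesis
  proof (rule that[of "C ^ 2"])
    fix n :: nat assume n: "n \<ge> 3"
    define L where "L = ln (ln (real n))"
    have lnn: "ln (real n) > 0" using n by simp
    let ?bigomega = "bigomega (primes_upto n)"
    let ?A = "{(a, b). a \<in> {1..n} \<and> b \<in> {1..n} \<and> real (?bigomega a + ?bigomega b) \<le> L / ln 2}"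
    have sub: "?A \<subseteq> {1..n} \<times> {1..n}" by auto
    have "real (card ?A) = (\<Sum>x\<in>?A. 1)" by simp
    also have "\<dots> \<le> (\<Sum>(a, b)\<in>?A. z ^ ?bigomega a * z ^ ?bigomega b * z powr (- (L / ln 2)))"
    proof (rule sum_mono, clarify)
      fix a b assume le: "real (?bigomega a + ?bigomega b) \<le> L / ln 2"
      have "z powr 0 \<le> z powr (real (?bigomega a + ?bigomega b) - L / ln 2)"
        using z le by (intro powr_mono') auto
      also have "\<dots> = z ^ ?bigomega a * z ^ ?bigomega b * z powr (- (L / ln 2))"
        using z by (simp add: powr_realpow[symmetric] powr_diff powr_minus_divide powr_add)
      finally show "1 \<le> z ^ ?bigomega a * z ^ ?bigomega b * z powr (- (L / ln 2))" using z by simp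
    qed
    also have "\<dots> \<le> (\<Sum>(a, b)\<in>{1..n} \<times> {1..n}. z ^ ?bigomega a * z ^ ?bigomega b * z powr (- (L / ln 2)))"
      using z sub by (intro sum_mono2) auto
    also have "\<dots> = (\<Sum>a\<in>{1..n}. z ^ ?bigomega a) ^ 2 * z powr (- (L / ln 2))"
      by (simp add: sum.cartesian_product[symmetric] sum_distrib_left sum_distrib_right power2_eq_square mult_ac)
    also have "\<dots> \<le> (C * real n * ln (real n) powr (z - 1)) ^ 2 * z powr (- (L / ln 2))"
      using n z by (intro mult_right_mono power_mono C(2) sum_nonneg) auto
    also have "z powr (- (L / ln 2)) = ln (real n) powr ((ln 2 + ln (ln 2)) / ln 2)"
    proof -
      obtain g where g: "g = ln 2 + ln (ln (2::real))" by blast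
      have "ln z = - g" by (simp add: z_def ln_div ln_mult g)
      hence "- (L / ln 2) * ln z = g / ln 2 * ln (ln (real n))"
        by (simp add: L_def mult.commute)
      thus ?thesis using lnn z by (simp add: powr_def g)
    qed
    also have "(C * real n * ln (real n) powr (z - 1)) ^ 2 * ln (real n) powr ((ln 2 + ln (ln 2)) / ln 2)
        = C ^ 2 * real n ^ 2 * ln (real n) powr ((z - 1) + (z - 1) + (ln 2 + ln (ln 2)) / ln 2)"
      by (simp only: powr_add) (simp add: power2_eq_square mult_ac)
    also have "(z - 1) + (z - 1) + (ln 2 + ln (ln 2)) / ln 2 = - energy_exponent"
      by (simp add: z_def energy_exponent_def add_divide_distrib)
    finally show "real (card {(a, b). a \<in> {1..n} \<and> b \<in> {1..n} \<and>
          real (?bigomega a + ?bigomega b) \<le> ln (ln (real n)) / ln 2})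
        \<le> C ^ 2 * real n ^ 2 * ln (real n) powr (- energy_exponent)"
      by (simp add: L_def)
  qed (use C in auto)
qed

lemma card_product_set_le:
  obtains C where "C > 0"
    "\<And>n. n \<ge> 3 \<Longrightarrow> real (card (product_set n)) \<le> C * real n ^ 2 * ln (real n) powr (- energy_exponent)"
proof -
  obtain C1 where C1: "C1 > 0" "\<And>n. n \<ge> 3 \<Longrightarrow>
    real (card {k\<in>{1..n\<^sup>2}. ln (ln (real n)) / ln 2 \<le> real (bigomega (primes_upto (n\<^sup>2)) k)})
      \<le> C1 * real n ^ 2 * ln (real n) powr (- energy_exponent)" using card_bigomega_ge_le by blast
  obtain C2 where C2: "C2 > 0" "\<And>n. n \<ge> 3 \<Longrightarrow>
    real (card {(a, b). a \<in> {1..n} \<and> b \<in> {1..n} \<and>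
        real (bigomega (primes_upto n) a + bigomega (primes_upto n) b) \<le> ln (ln (real n)) / ln 2})
      \<le> C2 * real n ^ 2 * ln (real n) powr (- energy_exponent)" using card_pairs_bigomega_le by blast
  show ?thesis
  proof (rule that[of "C1 + C2"])
    fix n :: nat assume n: "n \<ge> 3"
    let ?A = "{k\<in>{1..n\<^sup>2}. ln (ln (real n)) / ln 2 \<le> real (bigomega (primes_upto (n\<^sup>2)) k)}"
    let ?B = "{(a, b). a \<in> {1..n} \<and> b \<in> {1..n} \<and>
        real (bigomega (primes_upto n) a + bigomega (primes_upto n) b) \<le> ln (ln (real n)) / ln 2}"
    have finB: "finite ?B" by (rule finite_subset[of _ "{1..n} \<times> {1..n}"]) auto
    have "product_set n \<subseteq> ?A \<union> (\<lambda>(m, n). m * n) ` ?B"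
    proof
      fix k assume "k \<in> product_set n"
      then obtain a b where ab: "a \<in> {1..n}" "b \<in> {1..n}" "k = a * b"
        by (auto simp: product_set_def)
      have nn: "n \<le> n\<^sup>2" by (simp add: power2_eq_square)
      have "k \<le> n\<^sup>2" using ab by (simp add: power2_eq_square mult_le_mono)
      moreover have "k \<ge> 1" using ab by simp
      \<comment> \<open>The two counts use different sets of primes, but a factor m \<le> n has no
        prime factor above n, so they agree on a and b.\<close>
      moreover have "bigomega (primes_upto (n\<^sup>2)) m = bigomega (primes_upto n) m" if "m \<in> {1..n}" for m
        using that nn by (auto simp: bigomega_primes_upto_eq[of m "n\<^sup>2"] bigomega_primes_upto_eq[of m n])
      hence "bigomega (primes_upto (n\<^sup>2)) k = bigomega (primes_upto n) a + bigomega (primes_upto n) b"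
        using ab bigomega_mult[of "primes_upto (n\<^sup>2)" a b] by (auto simp: primes_upto_def[of "n\<^sup>2"])
      ultimately show "k \<in> ?A \<union> (\<lambda>(m, n). m * n) ` ?B"
        using ab by (cases "ln (ln (real n)) / ln 2 \<le> real (bigomega (primes_upto (n\<^sup>2)) k)") auto
    qed
    hence "card (product_set n) \<le> card (?A \<union> (\<lambda>(m, n). m * n) ` ?B)"
      using finB by (intro card_mono) auto
    also have "\<dots> \<le> card ?A + card ((\<lambda>(m, n). m * n) ` ?B)"
      by (rule card_Un_le)
    also have "card ((\<lambda>(m, n). m * n) ` ?B) \<le> card ?B"
      by (rule card_image_le[OF finB])
    finally have "real (card (product_set n)) \<le> real (card ?A) + real (card ?B)" by linarith
    also have "\<dots> \<le> C1 * real n ^ 2 * ln (real n) powr (- energy_exponent)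
        + C2 * real n ^ 2 * ln (real n) powr (- energy_exponent)"
      using C1(2)[OF n] C2(2)[OF n] by linarith
    finally show "real (card (product_set n)) \<le> (C1 + C2) * real n ^ 2 * ln (real n) powr (- energy_exponent)"
      by (simp add: algebra_simps)
  qed (use C1 C2 in auto)
qed

section \<open>Cauchy-Schwarz and the lower bound for the energy\<close>

lemma square_sum_le_card:
  fixes r :: "'a \<Rightarrow> real"
  assumes "finite A"
  shows "(\<Sum>x\<in>A. r x) ^ 2 \<le> real (card A) * (\<Sum>x\<in>A. r x ^ 2)"
proof (cases "A = {}")
  case False
  define c s where "c = real (card A)" and "s = (\<Sum>x\<in>A. r x)"
  have c: "c > 0" using assms False by (simp add: c_def card_gt_0_iff)
  \<comment> \<open>The right side is c^2 times the sum of the squared deviations of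
    \<open>r\<close> from its mean s / c.\<close>
  have "0 \<le> (\<Sum>x\<in>A. (c * r x - s) ^ 2)" by (intro sum_nonneg) auto
  also have "\<dots> = (\<Sum>x\<in>A. c ^ 2 * r x ^ 2 - 2 * c * s * r x + s ^ 2)"
    by (intro sum.cong refl) (simp add: power2_eq_square algebra_simps)
  also have "\<dots> = c ^ 2 * (\<Sum>x\<in>A. r x ^ 2) - 2 * c * s * (\<Sum>x\<in>A. r x) + c * s ^ 2"
    unfolding sum.distrib sum_subtractf sum_distrib_left[symmetric] by (simp add: c_def)
  also have "\<dots> = c * (c * (\<Sum>x\<in>A. r x ^ 2) - s ^ 2)"
    unfolding s_def[symmetric] by (simp add: power2_eq_square algebra_simps)
  finally show ?thesis using c by (simp add: zero_le_mult_iff c_def s_def)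
qed simp

lemma weighted_energy_ge:
  assumes w: "w \<in> weights N"
  shows "weight_norm1 N w ^ 4 \<le> real (card (product_set N)) * weighted_energy N w"
proof -
  let ?I = "{1..N}"
  let ?Q = "{(m1, m2, n1, n2). m1 \<in> ?I \<and> m2 \<in> ?I \<and> n1 \<in> ?I \<and> n2 \<in> ?I \<and> m1 * m2 = n1 * n2}"
  let ?F = "\<lambda>k. {x\<in>?I \<times> ?I. fst x * snd x = k}"
  define r where "r k = (\<Sum>x\<in>?F k. w (fst x) * w (snd x))" for k
  have finF: "finite (?F k)" for k by (rule finite_subset[of _ "?I \<times> ?I"]) auto
  have "weight_norm1 N w ^ 2 = (\<Sum>x\<in>?I \<times> ?I. w (fst x) * w (snd x))"
    by (simp add: weight_norm1_def power2_eq_square sum_product sum.cartesian_product case_prod_unfold)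
  also have "\<dots> = (\<Sum>k\<in>product_set N. r k)"
    unfolding r_def
    by (rule sum.group[symmetric, where g = "\<lambda>x. fst x * snd x"]) (auto simp: product_set_def)
  finally have n2: "weight_norm1 N w ^ 2 = (\<Sum>k\<in>product_set N. r k)" .
  have "weighted_energy N w = (\<Sum>(m1, m2, n1, n2)\<in>?Q. w m1 * w m2 * w n1 * w n2)"
    by (simp add: weighted_energy_def)
  also have "\<dots> = (\<Sum>(k, x, y)\<in>(SIGMA k:product_set N. ?F k \<times> ?F k).
      w (fst x) * w (snd x) * (w (fst y) * w (snd y)))"
    by (rule sum.reindex_bij_witness[of _ "\<lambda>(k, x, y). (fst x, snd x, fst y, snd y)"
          "\<lambda>(m1, m2, n1, n2). (m1 * m2, (m1, m2), (n1, n2))"]) (auto simp: product_set_def)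
  also have "\<dots> = (\<Sum>k\<in>product_set N. \<Sum>(x, y)\<in>?F k \<times> ?F k. w (fst x) * w (snd x) * (w (fst y) * w (snd y)))"
    by (subst sum.Sigma) (auto intro: finF)
  also have "\<dots> = (\<Sum>k\<in>product_set N. r k ^ 2)"
    unfolding r_def power2_eq_square sum_product sum.cartesian_product ..
  finally have E: "weighted_energy N w = (\<Sum>k\<in>product_set N. r k ^ 2)" .
  have "weight_norm1 N w ^ 4 = (\<Sum>k\<in>product_set N. r k) ^ 2"
    by (simp flip: n2 power_mult)
  also have "\<dots> \<le> real (card (product_set N)) * (\<Sum>k\<in>product_set N. r k ^ 2)"
    by (rule square_sum_le_card) simp
  finally show ?thesis by (simp add: E)
qed

lemma weight_norm1_pos:
  assumes "w \<in> weights N"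
  shows "weight_norm1 N w > 0"
proof -
  obtain m where "m \<in> {1..N}" "w m \<noteq> 0" using assms by (auto simp: weights_def)
  thus ?thesis unfolding weight_norm1_def using assms
    by (intro sum_pos2[of _ m]) (force simp: weights_def)+
qed

lemma weights_nonempty: "N \<ge> 1 \<Longrightarrow> weights N \<noteq> {}"
  by (auto simp: weights_def intro!: exI[of _ "\<lambda>_. 1"])

lemma min_energy_ge:
  assumes "N \<ge> 1"
  shows "real N ^ 2 / real (card (product_set N)) \<le> min_energy N"
  unfolding min_energy_def
proof (rule cINF_greatest)
  fix w assume w: "w \<in> weights N"
  have "(1, 1) \<in> {1..N} \<times> {1..N}" using assms by auto
  hence "card (product_set N) > 0" by (auto simp: card_gt_0_iff product_set_def)
  moreover have "weight_norm1 N w ^ 4 > 0" using weight_norm1_pos[OF w] by simp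
  moreover have "weight_norm1 N w ^ 4 * real N ^ 2 \<le> (real (card (product_set N)) * weighted_energy N w) * real N ^ 2"
    using weighted_energy_ge[OF w] by (rule mult_right_mono) simp
  ultimately show "real N ^ 2 / real (card (product_set N)) \<le> (real N)\<^sup>2 * weighted_energy N w / weight_norm1 N w ^ 4"
    by (simp add: field_simps)
qed (use assms weights_nonempty in auto)

lemma min_energy_le:
  assumes "w \<in> weights N"
  shows "min_energy N \<le> real N ^ 2 * weighted_energy N w / weight_norm1 N w ^ 4"
  unfolding min_energy_def
proof (rule cINF_lower[OF _ assms])
  have "weighted_energy N w \<ge> 0" if "w \<in> weights N" for w
    unfolding weighted_energy_def using that by (intro sum_nonneg) (auto simp: weights_def)
  thus "bdd_below ((\<lambda>w. (real N)\<^sup>2 * weighted_energy N w / weight_norm1 N w ^ 4) ` weights N)"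
    by (intro bdd_belowI2[of _ 0]) auto
qed

lemma min_energy_lower_bound:
  obtains c where "c > 0" "\<And>N. N \<ge> 3 \<Longrightarrow> c * ln (real N) powr energy_exponent \<le> min_energy N"
proof -
  obtain C where C: "C > 0"
    "\<And>n. n \<ge> 3 \<Longrightarrow> real (card (product_set n)) \<le> C * real n ^ 2 * ln (real n) powr (- energy_exponent)"
    using card_product_set_le by blast
  show ?thesis
  proof (rule that[of "1 / C"])
    fix N :: nat assume N: "N \<ge> 3"
    have "(1, 1) \<in> {1..N} \<times> {1..N}" using N by auto
    hence pos: "card (product_set N) > 0" by (auto simp: card_gt_0_iff product_set_def)
    have "1 / C * ln (real N) powr energy_exponent =
        real N ^ 2 / (C * real N ^ 2 * ln (real N) powr (- energy_exponent))"
      using N by (simp add: powr_minus field_simps)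
    also have "\<dots> \<le> real N ^ 2 / real (card (product_set N))"
      using C(2)[OF N] pos C(1) N by (intro divide_left_mono mult_pos_pos) auto
    also have "\<dots> \<le> min_energy N" using N by (intro min_energy_ge) auto
    finally show "1 / C * ln (real N) powr energy_exponent \<le> min_energy N" .
  qed (use C in auto)
qed

section \<open>Integers with prescribed numbers of prime factors in given ranges\<close>

locale prime_ranges =
  fixes P :: "nat \<Rightarrow> nat set" and J :: nat
  assumes fin: "i \<in> {1..J} \<Longrightarrow> finite (P i)"
    and prime: "i \<in> {1..J} \<Longrightarrow> p \<in> P i \<Longrightarrow> prime p"
    and disjoint: "i \<in> {1..J} \<Longrightarrow> j \<in> {1..J} \<Longrightarrow> p \<in> P i \<Longrightarrow> p \<in> P j \<Longrightarrow> i = j"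
begin

definition M :: "(nat \<Rightarrow> nat) \<Rightarrow> nat set" where
  "M j = {m. m > 0 \<and> prime_factors m \<subseteq> (\<Union>i\<in>{1..J}. P i) \<and> (\<forall>i\<in>{1..J}. bigomega (P i) m = j i)}"

definition H :: "(nat \<Rightarrow> nat) \<Rightarrow> real" where
  "H j = (\<Sum>m\<in>M j. 1 / real m)"

lemma M_pos: "m \<in> M j \<Longrightarrow> m > 0"
  by (simp add: M_def)

lemma bigomega_range_mult: "i \<in> {1..J} \<Longrightarrow> a > 0 \<Longrightarrow> b > 0 \<Longrightarrow> bigomega (P i) (a * b) = bigomega (P i) a + bigomega (P i) b"
  using prime by (intro bigomega_mult) auto

lemma bigomega_range_prime:
  assumes "i \<in> {1..J}" "k \<in> {1..J}" "p \<in> P i"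
  shows "bigomega (P k) p = (if k = i then 1 else 0)"
proof -
  have "p \<in> P k \<longleftrightarrow> k = i" using disjoint[of i k p] assms by blast
  thus ?thesis
    using bigomega_prime[OF prime[OF assms(2)] fin[OF assms(2)] prime[OF assms(1,3)]] by simp
qed

lemma M_mult:
  assumes "a > 0" "b > 0"
  shows "a * b \<in> M j \<longleftrightarrow> prime_factors a \<subseteq> (\<Union>i\<in>{1..J}. P i) \<and> prime_factors b \<subseteq> (\<Union>i\<in>{1..J}. P i) \<and>
    (\<forall>i\<in>{1..J}. bigomega (P i) a + bigomega (P i) b = j i)"
  using assms by (auto simp: M_def bigomega_range_mult prime_factors_product)

lemma M_prime_times_iff:
  assumes i: "i \<in> {1..J}" and p: "p \<in> P i" and m: "m > 0" and ji: "j i = Suc k"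
  shows "p * m \<in> M j \<longleftrightarrow> m \<in> M (j(i := k))"
proof -
  have pp: "prime p" using prime i p by blast
  hence "prime_factors p \<subseteq> (\<Union>i\<in>{1..J}. P i)" using i p by (auto simp: prime_prime_factors)
  moreover have "(\<forall>l\<in>{1..J}. bigomega (P l) p + bigomega (P l) m = j l) \<longleftrightarrow> (\<forall>l\<in>{1..J}. bigomega (P l) m = (j(i := k)) l)"
    using i p ji by (intro ball_cong refl) (auto simp: bigomega_range_prime)
  ultimately show ?thesis
    using m pp prime_gt_0_nat[OF pp] by (subst M_mult) (auto simp: M_def)
qed

lemma bigomega_range_pos_iff:
  assumes "i \<in> {1..J}" "m > 0"
  shows "bigomega (P i) m > 0 \<longleftrightarrow> (\<exists>p\<in>P i. p dvd m)"
proof -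
  have "bigomega (P i) m > 0 \<longleftrightarrow> (\<exists>p\<in>P i. multiplicity p m \<noteq> 0)"
    unfolding bigomega_def using sum_eq_0_iff[OF fin[OF assms(1)], of "\<lambda>p. multiplicity p m"] by (auto simp: neq0_conv[symmetric] simp del: neq0_conv)
  also have "\<dots> \<longleftrightarrow> (\<exists>p\<in>P i. p dvd m)"
  proof (intro bex_cong refl)
    fix p assume "p \<in> P i"
    hence "prime p" using prime assms by blast
    thus "multiplicity p m \<noteq> 0 \<longleftrightarrow> p dvd m"
      using assms prime_multiplicity_gt_zero_iff[of p m] by simp
  qed
  finally show ?thesis .
qed

lemma M_zero:
  assumes "\<And>i. i \<in> {1..J} \<Longrightarrow> j i = 0"
  shows "M j = {1}"
proof -
  have "m = 1" if m: "m \<in> M j" for m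
  proof (rule ccontr)
    assume "m \<noteq> 1"
    then obtain p where p: "prime p" "p dvd m" using prime_factor_nat by blast
    hence "p \<in> prime_factors m" using M_pos[OF m] by (simp add: in_prime_factors_iff)
    then obtain i where i: "i \<in> {1..J}" "p \<in> P i" using m by (auto simp: M_def)
    hence "bigomega (P i) m > 0" using bigomega_range_pos_iff M_pos[OF m] p by blast
    thus False using m i assms by (auto simp: M_def)
  qed
  moreover have "1 \<in> M j" using assms by (auto simp: M_def)
  ultimately show ?thesis by blast
qed

lemma sum_Suc_split:
  assumes "Suc n = (\<Sum>i\<in>{1..J}. j i)"
  obtains i k where "i \<in> {1..J}" "j i = Suc k" "n = (\<Sum>l\<in>{1..J}. (j(i := k)) l)"
proof -
  have "\<exists>i\<in>{1..J}. j i \<noteq> 0"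
  proof (rule ccontr)
    assume "\<not> ?thesis"
    thus False using assms by simp
  qed
  then obtain i where i: "i \<in> {1..J}" "j i \<noteq> 0" by blast
  then obtain k where k: "j i = Suc k" using not0_implies_Suc by blast
  have "(\<Sum>l\<in>{1..J}. j l) = Suc k + (\<Sum>l\<in>{1..J} - {i}. j l)"
    unfolding k[symmetric] by (rule sum.remove[OF _ i(1)]) simp
  moreover have "(\<Sum>l\<in>{1..J}. (j(i := k)) l) = k + (\<Sum>l\<in>{1..J} - {i}. j l)"
    by (subst sum.remove[OF _ i(1)]) auto
  ultimately show ?thesis using i k assms by (intro that[of i k]) auto
qed

text \<open>Besides finiteness, this keeps m so small that N / m leaves room for a large prime
  factor.\<close>

lemma M_le_power:
  assumes B: "\<And>i p. i \<in> {1..J} \<Longrightarrow> p \<in> P i \<Longrightarrow> real p \<le> B" "B \<ge> 1"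
  shows "m \<in> M j \<Longrightarrow> real m \<le> B ^ (\<Sum>i\<in>{1..J}. j i)"
proof (induction "\<Sum>i\<in>{1..J}. j i" arbitrary: j m)
  case 0
  hence "M j = {1}" by (intro M_zero) auto
  thus ?case using 0 B by simp
next
  case (Suc n)
  obtain i k where i: "i \<in> {1..J}" "j i = Suc k" and n: "n = (\<Sum>l\<in>{1..J}. (j(i := k)) l)"
    using Suc(2) by (rule sum_Suc_split)
  have m0: "m > 0" using Suc.prems by (rule M_pos)
  have "bigomega (P i) m > 0" using Suc.prems i by (auto simp: M_def)
  then obtain p where p: "p \<in> P i" "p dvd m" using bigomega_range_pos_iff[OF i(1) m0] by blast
  then obtain m' where m': "m = p * m'" by blast
  hence "m' > 0" using m0 by auto
  hence mem: "m' \<in> M (j(i := k))" using M_prime_times_iff[of i p m' j k] i p Suc.prems m' by simp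
  have "real m' \<le> B ^ n" using Suc(1)[OF n mem] by (simp only: n[symmetric])
  hence "real p * real m' \<le> B * B ^ n" using B(1)[OF i(1) p(1)] B(2) by (intro mult_mono) auto
  thus ?case using m' by (simp only: Suc(2)[symmetric] of_nat_mult power_Suc)
qed

lemma finite_M [simp]: "finite (M j)"
proof -
  define B where "B = Max (insert 1 (\<Union>i\<in>{1..J}. P i))"
  have finU: "finite (\<Union>i\<in>{1..J}. P i)" using fin by auto
  have "real p \<le> real B" if "i \<in> {1..J}" "p \<in> P i" for i p
    using finU that unfolding B_def of_nat_le_iff by (intro Max_ge) auto
  moreover have "real B \<ge> 1" using finU by (simp add: B_def Max_ge_iff)
  ultimately have "real m \<le> real (B ^ (\<Sum>i\<in>{1..J}. j i))" if "m \<in> M j" for m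
    using M_le_power[of "real B" m j] that by simp
  hence "M j \<subseteq> {..B ^ (\<Sum>i\<in>{1..J}. j i)}" unfolding of_nat_le_iff by auto
  thus ?thesis by (rule finite_subset) simp
qed

lemma H_nonneg: "H j \<ge> 0"
  by (auto simp: H_def intro!: sum_nonneg)

section \<open>The size of the reciprocal sums \<open>H\<close>\<close>

text \<open>Double counting of the pairs \<open>(m, p)\<close> with \<open>m \<in> M j\<close>, \<open>p \<in> P i\<close> and \<open>p dvd m\<close>.\<close>

lemma H_recurrence:
  assumes i: "i \<in> {1..J}" and ji: "j i = Suc k"
  shows "real (Suc k) * H j =
    (\<Sum>m\<in>M (j(i := k)). (1 / real m) * ((\<Sum>p\<in>P i. 1 / real p) + (\<Sum>p\<in>P i. real (multiplicity p m) / real p)))"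
proof -
  let ?j = "j(i := k)"
  have "real (Suc k) * H j = (\<Sum>m\<in>M j. \<Sum>p\<in>P i. real (multiplicity p m) / real m)"
    unfolding H_def sum_distrib_left
    by (intro sum.cong refl) (use i ji in \<open>auto simp: M_def bigomega_def sum_divide_distrib[symmetric] simp flip: of_nat_sum\<close>)
  also have "\<dots> = (\<Sum>p\<in>P i. \<Sum>m\<in>M j. real (multiplicity p m) / real m)"
    by (rule sum.swap)
  also have "\<dots> = (\<Sum>p\<in>P i. \<Sum>m\<in>M ?j. (1 + real (multiplicity p m)) / (real p * real m))"
  proof (rule sum.cong[OF refl])
    fix p assume p: "p \<in> P i"
    have pp: "prime p" using prime i p by blast
    have p0: "p > 0" using pp by (rule prime_gt_0_nat)
    have "(\<Sum>m\<in>M j. real (multiplicity p m) / real m) = (\<Sum>m\<in>{m\<in>M j. p dvd m}. real (multiplicity p m) / real m)"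
      by (rule sum.mono_neutral_right) (auto simp: not_dvd_imp_multiplicity_0)
    also have "\<dots> = (\<Sum>m\<in>M ?j. real (multiplicity p (p * m)) / real (p * m))"
    proof (rule sum.reindex_bij_witness[of _ "\<lambda>m. p * m" "\<lambda>m. m div p"])
      fix m assume m: "m \<in> {m\<in>M j. p dvd m}"
      then obtain m' where m': "m = p * m'" by blast
      with m have "m' > 0" using M_pos[of m j] by (auto intro: gr0I)
      thus "m div p \<in> M ?j" using M_prime_times_iff[of i p m' j k] i p ji m m' p0 by simp
    next
      fix m assume m: "m \<in> M ?j"
      thus "p * m \<in> {m\<in>M j. p dvd m}" using M_prime_times_iff[of i p m j k] i p ji M_pos by simp
    qed (use p0 in auto)
    also have "\<dots> = (\<Sum>m\<in>M ?j. (1 + real (multiplicity p m)) / (real p * real m))"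
    proof (rule sum.cong[OF refl])
      fix m assume "m \<in> M ?j"
      hence "multiplicity p (p * m) = multiplicity p p + multiplicity p m"
        using pp p0 M_pos by (intro prime_elem_multiplicity_mult_distrib) auto
      thus "real (multiplicity p (p * m)) / real (p * m) = (1 + real (multiplicity p m)) / (real p * real m)"
        using pp by simp
    qed
    finally show "(\<Sum>m\<in>M j. real (multiplicity p m) / real m) = (\<Sum>m\<in>M ?j. (1 + real (multiplicity p m)) / (real p * real m))" .
  qed
  also have "\<dots> = (\<Sum>m\<in>M ?j. \<Sum>p\<in>P i. (1 + real (multiplicity p m)) / (real p * real m))"
    by (rule sum.swap)
  also have "\<dots> = (\<Sum>m\<in>M ?j. (1 / real m) * ((\<Sum>p\<in>P i. 1 / real p) + (\<Sum>p\<in>P i. real (multiplicity p m) / real p)))"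
    by (intro sum.cong refl)
       (simp add: sum_distrib_left sum.distrib[symmetric] add_divide_distrib distrib_left mult_ac)
  finally show ?thesis .
qed

lemma H_ge:
  assumes i: "i \<in> {1..J}" and ji: "j i = Suc k"
  shows "(\<Sum>p\<in>P i. 1 / real p) * H (j(i := k)) \<le> real (Suc k) * H j"
proof -
  have "(\<Sum>p\<in>P i. 1 / real p) * H (j(i := k)) = (\<Sum>m\<in>M (j(i := k)). (1 / real m) * ((\<Sum>p\<in>P i. 1 / real p) + 0))"
    by (simp add: H_def sum_distrib_left sum_distrib_right mult.commute sum_divide_distrib)
  also have "\<dots> \<le> real (Suc k) * H j"
    unfolding H_recurrence[where j = j, OF assms] by (intro sum_mono mult_left_mono add_left_mono sum_nonneg) auto
  finally show ?thesis .
qed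

text \<open>Repeated primes are all that separates this from \<open>H_ge\<close>: the k prime
  factors of m in range i, each weighted by 1 / p, add at most k / y.\<close>

lemma H_le:
  assumes i: "i \<in> {1..J}" and ji: "j i = Suc k" and y: "y > 0" "\<And>p. p \<in> P i \<Longrightarrow> y \<le> real p"
  shows "real (Suc k) * H j \<le> ((\<Sum>p\<in>P i. 1 / real p) + real k / y) * H (j(i := k))"
proof -
  have "real (Suc k) * H j \<le> (\<Sum>m\<in>M (j(i := k)). (1 / real m) * ((\<Sum>p\<in>P i. 1 / real p) + real k / y))"
    unfolding H_recurrence[where j = j, OF assms(1,2)]
  proof (intro sum_mono mult_left_mono add_left_mono)
    fix m assume m: "m \<in> M (j(i := k))"
    have "(\<Sum>p\<in>P i. real (multiplicity p m) / real p) \<le> (\<Sum>p\<in>P i. real (multiplicity p m) / y)"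
    proof (intro sum_mono divide_left_mono)
      fix p assume "p \<in> P i"
      from y(2)[OF this] y(1) show "y \<le> real p" "0 < real p * y" by auto
    qed auto
    also have "\<dots> = real (bigomega (P i) m) / y" by (simp add: bigomega_def sum_divide_distrib)
    also have "bigomega (P i) m = k" using m i by (auto simp: M_def)
    finally show "(\<Sum>p\<in>P i. real (multiplicity p m) / real p) \<le> real k / y" .
  qed auto
  also have "\<dots> = ((\<Sum>p\<in>P i. 1 / real p) + real k / y) * H (j(i := k))"
    by (simp add: H_def sum_distrib_left)
  finally show ?thesis .
qed

text \<open>Types are plain functions of which only the values on {1..J} matter, so the base case is
  vanishing on {1..J}. A step removes one prime factor from one range.\<close>

lemma type_induct [case_names zero step]:
  fixes Q :: "(nat \<Rightarrow> nat) \<Rightarrow> bool"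
  assumes zero: "\<And>j. (\<And>i. i \<in> {1..J} \<Longrightarrow> j i = 0) \<Longrightarrow> Q j"
    and step: "\<And>j i k. i \<in> {1..J} \<Longrightarrow> j i = Suc k \<Longrightarrow> Q (j(i := k)) \<Longrightarrow> Q j"
  shows "Q j"
proof (induction "\<Sum>i\<in>{1..J}. j i" arbitrary: j)
  case 0
  thus ?case by (intro zero) auto
next
  case (Suc n)
  obtain i k where i: "i \<in> {1..J}" "j i = Suc k" and n: "n = (\<Sum>l\<in>{1..J}. (j(i := k)) l)"
    using Suc(2) by (rule sum_Suc_split)
  from Suc(1)[OF n] show ?case by (rule step[where j = j, OF i])
qed

text \<open>The expected size of \<open>H j\<close> if every range has reciprocal prime sum x: x^(j
  i) accounts for the ordered choices of j i primes, (j i)! for their orders.\<close>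

definition G :: "real \<Rightarrow> (nat \<Rightarrow> nat) \<Rightarrow> real" where
  "G x j = (\<Prod>i\<in>{1..J}. x ^ j i / fact (j i))"

lemma G_step:
  assumes i: "i \<in> {1..J}" and ji: "j i = Suc k"
  shows "real (Suc k) * G x j = x * G x (j(i := k))"
proof -
  have "real (Suc k) * (x ^ j i / fact (j i)) = x * (x ^ k / fact k)"
    by (simp add: ji del: of_nat_Suc)
  moreover have "G x j = (x ^ j i / fact (j i)) * (\<Prod>l\<in>{1..J} - {i}. x ^ j l / fact (j l))"
    unfolding G_def by (rule prod.remove[OF _ i]) simp
  moreover have "G x (j(i := k)) = (x ^ k / fact k) * (\<Prod>l\<in>{1..J} - {i}. x ^ j l / fact (j l))"
    unfolding G_def by (subst prod.remove[OF _ i]) auto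
  ultimately show ?thesis by (simp only: mult.assoc[symmetric])
qed

lemma H_zero: "(\<And>i. i \<in> {1..J} \<Longrightarrow> j i = 0) \<Longrightarrow> H j = 1"
  unfolding H_def by (subst M_zero) auto

lemma G_zero: "(\<And>i. i \<in> {1..J} \<Longrightarrow> j i = 0) \<Longrightarrow> G x j = 1"
  by (simp add: G_def)

lemma G_nonneg: "x \<ge> 0 \<Longrightarrow> G x j \<ge> 0"
  by (auto simp: G_def intro!: prod_nonneg)

text \<open>Iterates \<open>H_le\<close>, one prime factor at a time. Bounding the type by \<kappa>
  lets a single x absorb all the corrections k / y.\<close>

lemma H_le_G:
  assumes y: "y > 0" "\<And>i p. i \<in> {1..J} \<Longrightarrow> p \<in> P i \<Longrightarrow> y \<le> real p"
    and x: "x \<ge> 0" "\<And>i. i \<in> {1..J} \<Longrightarrow> (\<Sum>p\<in>P i. 1 / real p) + real \<kappa> / y \<le> x"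
  shows "(\<And>i. i \<in> {1..J} \<Longrightarrow> j i \<le> \<kappa>) \<Longrightarrow> H j \<le> G x j"
proof (induction j rule: type_induct)
  case (zero j)
  thus ?case using H_zero[of j] G_zero[of j x] by simp
next
  case (step j i k)
  have IH: "H (j(i := k)) \<le> G x (j(i := k))"
  proof (rule step.IH)
    fix l assume "l \<in> {1..J}"
    thus "(j(i := k)) l \<le> \<kappa>" using step.prems[of l] step.hyps by auto
  qed
  have "k \<le> \<kappa>" using step.prems[of i] step.hyps by auto
  hence "(\<Sum>p\<in>P i. 1 / real p) + real k / y \<le> x"
    using x(2)[OF step.hyps(1)] y(1) divide_right_mono[of "real k" "real \<kappa>" y] by simp
  hence "((\<Sum>p\<in>P i. 1 / real p) + real k / y) * H (j(i := k)) \<le> x * G x (j(i := k))"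
    using IH x(1) H_nonneg by (intro mult_mono) auto
  with H_le[where j = j, OF step.hyps y(1) y(2)[OF step.hyps(1)]]
  have "real (Suc k) * H j \<le> real (Suc k) * G x j"
    unfolding G_step[where j = j, OF step.hyps] by simp
  thus ?case by simp
qed

lemma G_le_H:
  assumes x: "x \<ge> 0" "\<And>i. i \<in> {1..J} \<Longrightarrow> x \<le> (\<Sum>p\<in>P i. 1 / real p)"
  shows "G x j \<le> H j"
proof (induction j rule: type_induct)
  case (zero j)
  thus ?case using H_zero[of j] G_zero[of j x] by simp
next
  case (step j i k)
  have "x * G x (j(i := k)) \<le> (\<Sum>p\<in>P i. 1 / real p) * H (j(i := k))"
    by (intro mult_mono x(2)[OF step.hyps(1)] step.IH G_nonneg[OF x(1)] sum_nonneg) auto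
  also have "\<dots> \<le> real (Suc k) * H j" by (rule H_ge[where j = j, OF step.hyps])
  finally have "real (Suc k) * G x j \<le> real (Suc k) * H j"
    unfolding G_step[where j = j, OF step.hyps] .
  thus ?case by simp
qed

section \<open>Pairs of integers of the same type\<close>

text \<open>What remains of the energy after summing over \<open>a\<close>, \<open>d\<close> and the large primes.\<close>

definition D :: "(nat \<Rightarrow> nat) \<Rightarrow> real" where
  "D j = (\<Sum>b\<in>M j. \<Sum>c\<in>M j. 1 / (real (max b c)) ^ 2)"

lemma D_zero: "(\<And>i. i \<in> {1..J} \<Longrightarrow> j i = 0) \<Longrightarrow> D j = 1"
  unfolding D_def by (subst (1 2) M_zero) auto

text \<open>Every counted integer is p c with p in range t and c of the reduced type. For fixed c
  there are at most 4 b / (c ln Y) primes Y < p \<le> b / c, and the sum of 1 / c is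
  \<open>H\<close>. Several pairs may give the same integer, which is harmless in an upper
  bound.\<close>

lemma card_M_le:
  assumes t: "t \<in> {1..J}" and jt: "j t = Suc k" and Y: "1 < Y" "\<And>p. p \<in> P t \<Longrightarrow> Y < real p"
  shows "real (card {c\<in>M j. c \<le> b}) \<le> 4 * real b / ln Y * H (j(t := k))"
proof -
  let ?j = "j(t := k)"
  let ?R = "\<lambda>c. {p\<in>P t. p * c \<le> b}"
  have finR: "finite (?R c)" for c using fin[OF t] by auto
  have "{c\<in>M j. c \<le> b} \<subseteq> (\<Union>c\<in>M ?j. (\<lambda>p. p * c) ` ?R c)"
  proof
    fix m assume m: "m \<in> {c\<in>M j. c \<le> b}"
    hence m0: "m > 0" using M_pos by auto
    have "bigomega (P t) m > 0" using m t jt by (auto simp: M_def)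
    then obtain p where p: "p \<in> P t" "p dvd m" using bigomega_range_pos_iff[OF t m0] by blast
    then obtain c where c: "m = p * c" by blast
    hence "c > 0" using m0 by auto
    hence "c \<in> M ?j" using M_prime_times_iff[of t p c j k] t jt p m c by simp
    thus "m \<in> (\<Union>c\<in>M ?j. (\<lambda>p. p * c) ` ?R c)" using c p m by auto
  qed
  hence "card {c\<in>M j. c \<le> b} \<le> card (\<Union>c\<in>M ?j. (\<lambda>p. p * c) ` ?R c)"
    using finR by (intro card_mono) auto
  also have "\<dots> \<le> (\<Sum>c\<in>M ?j. card ((\<lambda>p. p * c) ` ?R c))"
    by (rule card_UN_le) simp
  also have "\<dots> \<le> (\<Sum>c\<in>M ?j. card (?R c))"
    by (intro sum_mono card_image_le finR)
  finally have "real (card {c\<in>M j. c \<le> b}) \<le> (\<Sum>c\<in>M ?j. real (card (?R c)))"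
    by (simp flip: of_nat_sum)
  also have "\<dots> \<le> (\<Sum>c\<in>M ?j. 4 * real b / ln Y * (1 / real c))"
  proof (rule sum_mono)
    fix c assume "c \<in> M ?j"
    hence c: "c > 0" by (rule M_pos)
    have "card (?R c) \<le> card {p. prime p \<and> Y < real p \<and> real p \<le> real b / real c}"
    proof (rule card_mono)
      have "{p. prime p \<and> Y < real p \<and> real p \<le> real b / real c} \<subseteq> {..nat \<lfloor>real b / real c\<rfloor>}"
        by (auto simp: le_nat_floor)
      thus "finite {p. prime p \<and> Y < real p \<and> real p \<le> real b / real c}" by (rule finite_subset) simp
      show "?R c \<subseteq> {p. prime p \<and> Y < real p \<and> real p \<le> real b / real c}"
        using t prime Y(2) c by (auto simp: field_simps simp flip: of_nat_mult)
    qed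
    also have "real \<dots> \<le> 4 * max (real b / real c) 0 / ln Y"
      by (rule card_primes_between_le[OF Y(1)])
    finally show "real (card (?R c)) \<le> 4 * real b / ln Y * (1 / real c)"
      using max_absorb1[of 0 "real b / real c"] by (simp add: mult_ac)
  qed
  also have "\<dots> = 4 * real b / ln Y * H ?j" by (simp add: H_def sum_distrib_left)
  finally show ?thesis .
qed

text \<open>By symmetry the larger variable may be taken to be b, at the cost of a factor 2. The
  smaller one then has O(b / ln Y) choices up to a factor \<open>H\<close>, which turns 1 / b^2 into
  1 / b and gains 1 / ln Y.\<close>

lemma D_le:
  assumes t: "t \<in> {1..J}" and jt: "j t = Suc k" and Y: "1 < Y" "\<And>p. p \<in> P t \<Longrightarrow> Y < real p"
  shows "D j \<le> 8 / ln Y * H j * H (j(t := k))"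
proof -
  let ?f = "\<lambda>b c. if c \<le> b then 1 / real b ^ 2 else 0"
  have "D j \<le> (\<Sum>b\<in>M j. \<Sum>c\<in>M j. ?f b c + ?f c b)"
    unfolding D_def by (intro sum_mono) (auto simp: max_def)
  also have "\<dots> = (\<Sum>b\<in>M j. \<Sum>c\<in>M j. ?f b c) + (\<Sum>b\<in>M j. \<Sum>c\<in>M j. ?f c b)"
    by (simp add: sum.distrib)
  also have "(\<Sum>b\<in>M j. \<Sum>c\<in>M j. ?f c b) = (\<Sum>c\<in>M j. \<Sum>b\<in>M j. ?f c b)"
    by (rule sum.swap)
  also have "(\<Sum>b\<in>M j. \<Sum>c\<in>M j. ?f b c) + \<dots> = 2 * (\<Sum>b\<in>M j. \<Sum>c\<in>M j. ?f b c)"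
    by simp
  also have "\<dots> = 2 * (\<Sum>b\<in>M j. real (card {c\<in>M j. c \<le> b}) / real b ^ 2)"
    by (simp add: sum.inter_filter[symmetric] del: sum.inter_filter)
  also have "\<dots> \<le> 2 * (\<Sum>b\<in>M j. 4 * real b / ln Y * H (j(t := k)) / real b ^ 2)"
    by (intro mult_left_mono sum_mono divide_right_mono card_M_le[where j = j, OF t jt Y]) auto
  also have "\<dots> = 8 / ln Y * H (j(t := k)) * (\<Sum>b\<in>M j. real b / real b ^ 2)"
    unfolding sum_distrib_left by (intro sum.cong refl) (simp add: mult_ac)
  also have "(\<Sum>b\<in>M j. real b / real b ^ 2) = H j"
    unfolding H_def by (intro sum.cong refl) (auto simp: power2_eq_square dest: M_pos)
  finally show ?thesis by (simp only: mult.assoc mult.commute mult.left_commute)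
qed

end

section \<open>The energy of the extremal weights\<close>

text \<open>Ranges above t must be empty and contribute 1. Each of the others contributes the sum of
  the squares of the binomial coefficients, which is the central coefficient (2\<kappa> choose
  \<kappa>), at most 4^\<kappa>.\<close>

lemma sum_PiE_binomial_squares_le:
  assumes t: "t \<le> J"
  shows "(\<Sum>j\<in>PiE {1..J} (\<lambda>_. {..\<kappa>}).
      if \<forall>i\<in>{1..J}. t < i \<longrightarrow> j i = 0 then \<Prod>i\<in>{1..J}. real (\<kappa> choose j i) ^ 2 else 0) \<le> 4 ^ (\<kappa> * t)"
proof -
  let ?B = "\<lambda>i. if t < i then {0} else {..\<kappa>}"
  have eq: "{j\<in>PiE {1..J} (\<lambda>_. {..\<kappa>}). \<forall>i\<in>{1..J}. t < i \<longrightarrow> j i = 0} = PiE {1..J} ?B"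
    by (auto simp: PiE_iff extensional_def split: if_splits)
  have "(\<Sum>j\<in>PiE {1..J} (\<lambda>_. {..\<kappa>}).
      if \<forall>i\<in>{1..J}. t < i \<longrightarrow> j i = 0 then \<Prod>i\<in>{1..J}. real (\<kappa> choose j i) ^ 2 else 0) =
      (\<Sum>j\<in>PiE {1..J} ?B. \<Prod>i\<in>{1..J}. real (\<kappa> choose j i) ^ 2)"
    unfolding eq[symmetric] by (rule sum.inter_filter[symmetric]) (auto intro: finite_PiE)
  also have "\<dots> = (\<Prod>i\<in>{1..J}. \<Sum>s\<in>?B i. real (\<kappa> choose s) ^ 2)"
    by (rule prod_sum_PiE[symmetric]) auto
  also have "\<dots> \<le> (\<Prod>i\<in>{1..J}. if t < i then 1 else 4 ^ \<kappa>)"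
  proof (intro prod_mono conjI)
    fix i
    have "(\<Sum>s\<le>\<kappa>. real (\<kappa> choose s) ^ 2) = real ((2 * \<kappa>) choose \<kappa>)"
      by (simp flip: choose_square_sum)
    also have "\<dots> \<le> real (2 ^ (2 * \<kappa>))" by (intro of_nat_mono binomial_le_pow2)
    also have "\<dots> = 4 ^ \<kappa>" by (simp add: power_mult)
    finally show "(\<Sum>s\<in>?B i. real (\<kappa> choose s) ^ 2) \<le> (if t < i then 1 else 4 ^ \<kappa>)" by simp
  qed (auto intro!: sum_nonneg)
  also have "\<dots> = (\<Prod>i\<in>{i\<in>{1..J}. i \<le> t}. 4 ^ \<kappa>)"
    by (subst prod.inter_filter) (auto intro!: prod.cong simp: not_less)
  also have "{i\<in>{1..J}. i \<le> t} = {1..t}" using t by auto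
  finally show ?thesis by (simp add: power_mult)
qed

context prime_ranges
begin

text \<open>In a product a b with \<kappa> prime factors in each range, the binomial coefficient
  counts the ways to give j i of those in range i to b.\<close>

lemma G_complement:
  assumes "\<And>i. i \<in> {1..J} \<Longrightarrow> j i \<le> \<kappa>"
  shows "G x (\<lambda>i. \<kappa> - j i) * G x j = G x (\<lambda>_. \<kappa>) * (\<Prod>i\<in>{1..J}. real (\<kappa> choose j i))"
  unfolding G_def prod.distrib[symmetric]
proof (rule prod.cong[OF refl])
  fix i assume "i \<in> {1..J}"
  hence le: "j i \<le> \<kappa>" by (rule assms)
  hence "x ^ (\<kappa> - j i) * x ^ j i = x ^ \<kappa>" by (simp flip: power_add)
  thus "x ^ (\<kappa> - j i) / fact (\<kappa> - j i) * (x ^ j i / fact (j i)) = x ^ \<kappa> / fact \<kappa> * real (\<kappa> choose j i)"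
    using le by (simp add: binomial_fact mult_ac)
qed

text \<open>
  The divisor \<open>4 ^ (\<kappa> * t)\<close> gained from the top range \<open>t\<close> occupied by \<open>b\<close> and \<open>c\<close> pays
  for the number of ways to distribute the prime factors in the ranges \<open>1, \<dots>, t\<close>.
\<close>

lemma sum_H_D_le:
  assumes Y: "\<And>t. t \<in> {1..J} \<Longrightarrow> 1 < Y t" "\<And>t p. t \<in> {1..J} \<Longrightarrow> p \<in> P t \<Longrightarrow> Y t < real p"
    and gain: "\<And>t. t \<in> {1..J} \<Longrightarrow> 4 ^ (\<kappa> * t) \<le> ln (Y t)"
    and x: "x > 0" "real \<kappa> \<le> x"
    and HG: "\<And>j. (\<And>i. i \<in> {1..J} \<Longrightarrow> j i \<le> \<kappa>) \<Longrightarrow> H j \<le> G x j"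
  shows "(\<Sum>j\<in>PiE {1..J} (\<lambda>_. {..\<kappa>}). H (\<lambda>i. \<kappa> - j i) ^ 2 * D j) \<le> 8 * (real J + 1) * G x (\<lambda>_. \<kappa>) ^ 2"
proof -
  define g where "g = G x (\<lambda>_. \<kappa>)"
  let ?PE = "PiE {1..J} (\<lambda>_. {..\<kappa>}) :: (nat \<Rightarrow> nat) set"
  let ?low = "\<lambda>t (j :: nat \<Rightarrow> nat). \<forall>i\<in>{1..J}. t < i \<longrightarrow> j i = 0"
  let ?C = "\<lambda>j. \<Prod>i\<in>{1..J}. real (\<kappa> choose j i) ^ 2"
  have finPE: "finite ?PE" by (intro finite_PiE) auto
  have C: "?C j = (\<Prod>i\<in>{1..J}. real (\<kappa> choose j i)) ^ 2" for j
    by (simp add: prod_power_distrib)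
  have one: "H (\<lambda>i. \<kappa> - j i) ^ 2 * D j \<le> 8 * g ^ 2 * (\<Sum>t\<in>{0..J}. (1 / 4 ^ (\<kappa> * t)) * (if ?low t j then ?C j else 0))"
    if j: "j \<in> ?PE" for j
  proof -
    have jle: "j i \<le> \<kappa>" if "i \<in> {1..J}" for i using j that by (auto simp: PiE_iff)
    have GG: "(G x (\<lambda>i. \<kappa> - j i) * G x j) ^ 2 = g ^ 2 * ?C j"
      unfolding C g_def by (subst G_complement) (use jle in \<open>auto simp: power_mult_distrib\<close>)
    \<comment> \<open>t is the highest range in which b and c have prime factors; t = 0 stands for b
      = c = 1, where nothing is gained and nothing has to be distributed.\<close>
    obtain t where t: "t \<in> {0..J}" "?low t j" and
      bound: "H (\<lambda>i. \<kappa> - j i) ^ 2 * D j \<le> 8 * (1 / 4 ^ (\<kappa> * t)) * (G x (\<lambda>i. \<kappa> - j i) * G x j) ^ 2"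
    proof (cases "\<forall>i\<in>{1..J}. j i = 0")
      case True
      have "H (\<lambda>i. \<kappa> - j i) ^ 2 \<le> G x (\<lambda>i. \<kappa> - j i) ^ 2"
        by (intro power_mono HG H_nonneg) auto
      also have "\<dots> \<le> 8 * G x (\<lambda>i. \<kappa> - j i) ^ 2" by simp
      finally show ?thesis using True D_zero[of j] G_zero[of j x]
        by (intro that[of 0]) auto
    next
      case False
      define A where "A = {i\<in>{1..J}. j i \<noteq> 0}"
      define t where "t = Max A"
      have A: "finite A" "A \<noteq> {}" using False by (auto simp: A_def)
      have tA: "t \<in> A" unfolding t_def using A by (rule Max_in)
      hence tJ: "t \<in> {1..J}" by (auto simp: A_def)
      obtain k where k: "j t = Suc k" using tA not0_implies_Suc by (auto simp: A_def)
      have low: "?low t j"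
      proof (intro ballI impI)
        fix i assume i: "i \<in> {1..J}" "t < i"
        show "j i = 0"
        proof (rule ccontr)
          assume "j i \<noteq> 0"
          hence "i \<le> t" unfolding t_def using i A by (intro Max_ge) (auto simp: A_def)
          thus False using i by simp
        qed
      qed
      \<comment> \<open>Removing a prime factor does not increase \<open>G\<close>: since \<kappa>
        \<le> x, the numbers x^k / k! increase up to k = \<kappa>.\<close>
      have "x * G x (j(t := k)) = real (Suc k) * G x j"
        by (rule G_step[where j = j, OF tJ k, symmetric])
      also have "\<dots> \<le> x * G x j"
        using jle[OF tJ] k x G_nonneg[of x j] by (intro mult_right_mono) auto
      finally have Gk: "G x (j(t := k)) \<le> G x j" using x by simp
      have Hk: "H (j(t := k)) \<le> G x (j(t := k))"
      proof (rule HG)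
        fix i assume "i \<in> {1..J}"
        thus "(j(t := k)) i \<le> \<kappa>" using jle[of i] k by auto
      qed
      have lnY: "ln (Y t) > 0" using Y(1)[OF tJ] by simp
      have "D j \<le> 8 / ln (Y t) * H j * H (j(t := k))"
        by (rule D_le[where j = j, OF tJ k Y(1)[OF tJ] Y(2)[OF tJ]])
      also have "\<dots> \<le> 8 / 4 ^ (\<kappa> * t) * G x j * G x j"
      proof (intro mult_mono divide_left_mono gain[OF tJ] HG jle H_nonneg order.trans[OF Hk Gk])
        show "0 < ln (Y t) * 4 ^ (\<kappa> * t)" using lnY by simp
      qed (use G_nonneg[of x j] H_nonneg x in auto)
      finally have Dj: "D j \<le> 8 / 4 ^ (\<kappa> * t) * G x j * G x j" .
      have "H (\<lambda>i. \<kappa> - j i) ^ 2 * D j \<le> G x (\<lambda>i. \<kappa> - j i) ^ 2 * (8 / 4 ^ (\<kappa> * t) * G x j * G x j)"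
        by (intro mult_mono power_mono HG Dj H_nonneg) (auto simp: D_def intro!: sum_nonneg)
      also have "\<dots> = 8 * (1 / 4 ^ (\<kappa> * t)) * (G x (\<lambda>i. \<kappa> - j i) * G x j) ^ 2"
        by (simp add: power2_eq_square)
      finally show ?thesis using tJ low by (intro that[of t]) auto
    qed
    have "H (\<lambda>i. \<kappa> - j i) ^ 2 * D j \<le> 8 * g ^ 2 * ((1 / 4 ^ (\<kappa> * t)) * (if ?low t j then ?C j else 0))"
      using bound t(2) unfolding GG by (simp add: mult_ac)
    \<comment> \<open>t depends on j. Adding the terms of all other t makes the bound uniform in j,
      so that the sums can be exchanged; the price is the factor J + 1.\<close>
    also have "\<dots> \<le> 8 * g ^ 2 * (\<Sum>t\<in>{0..J}. (1 / 4 ^ (\<kappa> * t)) * (if ?low t j then ?C j else 0))"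
      using t(1) by (intro mult_left_mono member_le_sum) (auto intro!: divide_nonneg_nonneg prod_nonneg)
    finally show ?thesis .
  qed
  have "(\<Sum>j\<in>?PE. H (\<lambda>i. \<kappa> - j i) ^ 2 * D j) \<le>
      (\<Sum>j\<in>?PE. 8 * g ^ 2 * (\<Sum>t\<in>{0..J}. (1 / 4 ^ (\<kappa> * t)) * (if ?low t j then ?C j else 0)))"
    by (intro sum_mono one)
  also have "\<dots> = 8 * g ^ 2 * (\<Sum>t\<in>{0..J}. (1 / 4 ^ (\<kappa> * t)) * (\<Sum>j\<in>?PE. if ?low t j then ?C j else 0))"
    unfolding sum_distrib_left[symmetric] by (subst sum.swap) (simp only: sum_distrib_left)
  also have "\<dots> \<le> 8 * g ^ 2 * (\<Sum>t\<in>{0..J}. (1 / 4 ^ (\<kappa> * t)) * 4 ^ (\<kappa> * t))"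
    by (intro mult_left_mono sum_mono sum_PiE_binomial_squares_le) auto
  also have "\<dots> = 8 * (real J + 1) * g ^ 2" by simp
  finally show ?thesis by (simp add: g_def)
qed

end

text \<open>With a the gcd of x1 and y1, the cofactors b and c are coprime, so c divides x2 and d is
  the quotient.\<close>

lemma four_number_factorization:
  fixes x1 x2 y1 y2 :: nat
  assumes "x1 * x2 = y1 * y2" "x1 > 0" "y1 > 0"
  obtains a b c d where "x1 = a * b" "y1 = a * c" "x2 = c * d" "y2 = b * d"
proof -
  define a where "a = gcd x1 y1"
  have a: "a > 0" using assms by (simp add: a_def)
  have "gcd x1 y1 \<noteq> 0" using assms by simp
  then obtain b c where bc: "x1 = b * a" "y1 = c * a" "coprime b c"
    unfolding a_def using gcd_coprime_exists by blast
  have eq: "b * x2 = c * y2" using assms(1) bc a by (simp add: mult_ac)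
  hence "c dvd b * x2" by simp
  hence "c dvd x2" using bc(3) by (simp add: coprime_commute coprime_dvd_mult_right_iff)
  then obtain d where d: "x2 = c * d" by blast
  have "c > 0" using bc assms by auto
  with eq d have "y2 = b * d" by (simp add: mult_ac)
  thus ?thesis using bc d by (intro that[of a b c d]) (auto simp: mult_ac)
qed

text \<open>\<open>Y\<close> separates the primes of the ranges from the large primes, so that the
  large prime of an element of \<open>S\<close> is determined and cannot be confused with a factor
  of the remaining part.\<close>

locale energy_setup = prime_ranges +
  fixes \<kappa> N :: nat and Y :: real
  assumes Y_gt: "1 < Y" and le_Y: "i \<in> {1..J} \<Longrightarrow> p \<in> P i \<Longrightarrow> real p \<le> Y"
begin

abbreviation K where "K \<equiv> M (\<lambda>_. \<kappa>)"

section \<open>Parametrising the solutions of m1 m2 = n1 n2\<close>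

definition big :: "real \<Rightarrow> nat set" where
  "big X = {q. prime q \<and> Y < real q \<and> real q \<le> X}"

definition S :: "nat set" where
  "S = {n. \<exists>q m. n = q * m \<and> prime q \<and> Y < real q \<and> m \<in> K \<and> q * m \<le> N}"

lemma finite_big [simp]: "finite (big X)"
  by (rule finite_subset[of _ "{..nat \<lfloor>X\<rfloor>}"]) (auto simp: big_def le_nat_floor)

lemma S_subset: "S \<subseteq> {1..N}"
  by (auto simp: S_def Suc_le_eq dest: M_pos prime_gt_0_nat)

lemma finite_S [simp]: "finite S"
  using S_subset by (rule finite_subset) simp

lemma big_prime_not_dvd:
  assumes "prime q" "Y < real q" "m \<in> M j"
  shows "\<not> q dvd m"
proof
  assume "q dvd m"
  hence "q \<in> prime_factors m" using assms M_pos by (auto simp: in_prime_factors_iff)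
  moreover have "prime_factors m \<subseteq> (\<Union>i\<in>{1..J}. P i)" using assms(3) unfolding M_def by blast
  ultimately obtain i where "i \<in> {1..J}" "q \<in> P i" by blast
  hence "real q \<le> Y" by (rule le_Y)
  with assms(2) show False by simp
qed

lemma big_prime_dvd_times:
  assumes "prime q" "Y < real q" "prime r" "m \<in> M j" "q dvd r * m"
  shows "q = r"
proof -
  have "q dvd r \<or> q dvd m" using assms by (simp add: prime_dvd_mult_iff)
  thus ?thesis using big_prime_not_dvd[OF assms(1,2,4)] primes_dvd_imp_eq[OF assms(1,3)] by blast
qed

text \<open>A large prime divides no element of \<open>K\<close>, so once q1 is cancelled, q2 can
  only be matched by r2.\<close>

lemma big_prime_cancel:
  assumes "prime q1" "prime q2" "prime r2" "Y < real q2" "x1 \<in> K" "x2 \<in> K" "y1 \<in> K" "y2 \<in> K"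
    and eq: "q1 * x1 * (q2 * x2) = q1 * y1 * (r2 * y2)"
  shows "q2 = r2" "x1 * x2 = y1 * y2"
proof -
  have q1: "q1 > 0" using assms by (simp add: prime_gt_0_nat)
  have eq': "q2 * (x1 * x2) = y1 * (r2 * y2)" using eq q1 by (simp add: mult_ac)
  hence "q2 dvd y1 * (r2 * y2)" by (metis dvd_triv_left)
  hence "q2 dvd r2 * y2" using assms big_prime_not_dvd by (simp add: prime_dvd_mult_iff)
  thus "q2 = r2" using assms big_prime_dvd_times by blast
  thus "x1 * x2 = y1 * y2" using eq' assms(2) by (simp add: prime_gt_0_nat)
qed

text \<open>\<open>j\<close> is the common type of b and c, and its complement that of a and d. As
  q1 a b and q1 a c are both at most N, q1 is at most N / (a max b c), and likewise q2 with d; these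
  two bounds are the origin of the square of the maximum in \<open>D\<close>.\<close>

definition Z :: "(nat \<Rightarrow> nat) \<Rightarrow> (((nat \<times> nat) \<times> (nat \<times> nat)) \<times> (nat \<times> nat)) set" where
  "Z j = (SIGMA ((a, d), (b, c)):(M (\<lambda>i. \<kappa> - j i) \<times> M (\<lambda>i. \<kappa> - j i)) \<times> (M j \<times> M j).
     big (real N / (real a * real (max b c))) \<times> big (real N / (real d * real (max b c))))"

text \<open>
  In \<open>m1 * m2 = n1 * n2\<close> the large primes of \<open>n1, n2\<close> are those of \<open>m1, m2\<close>, either in
  the same order (\<open>rep1\<close>) or swapped (\<open>rep2\<close>).
\<close>

definition rep1 :: "((nat \<times> nat) \<times> (nat \<times> nat)) \<times> (nat \<times> nat) \<Rightarrow> nat \<times> nat \<times> nat \<times> nat" where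
  "rep1 = (\<lambda>(((a, d), (b, c)), (q1, q2)). (q1 * (a * b), q2 * (c * d), q1 * (a * c), q2 * (b * d)))"

definition rep2 :: "((nat \<times> nat) \<times> (nat \<times> nat)) \<times> (nat \<times> nat) \<Rightarrow> nat \<times> nat \<times> nat \<times> nat" where
  "rep2 = (\<lambda>(((a, d), (b, c)), (q1, q2)). (q1 * (a * b), q2 * (c * d), q2 * (b * d), q1 * (a * c)))"

lemma finite_Z [simp]: "finite (Z j)"
  unfolding Z_def by (rule finite_SigmaI) auto

lemma decompose:
  assumes x: "x1 \<in> K" "x2 \<in> K" "y1 \<in> K" "y2 \<in> K" and eq: "x1 * x2 = y1 * y2"
    and q: "prime q1" "Y < real q1" "prime q2" "Y < real q2"
    and le: "q1 * x1 \<le> N" "q1 * y1 \<le> N" "q2 * x2 \<le> N" "q2 * y2 \<le> N"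
  shows "\<exists>j\<in>PiE {1..J} (\<lambda>_. {..\<kappa>}). \<exists>a b c d. (((a, d), (b, c)), (q1, q2)) \<in> Z j \<and>
    x1 = a * b \<and> y1 = a * c \<and> x2 = c * d \<and> y2 = b * d"
proof -
  have pos: "x1 > 0" "x2 > 0" "y1 > 0" "y2 > 0" using x M_pos by blast+
  obtain a b c d where abcd: "x1 = a * b" "y1 = a * c" "x2 = c * d" "y2 = b * d"
    using four_number_factorization[OF eq pos(1,3)] by blast
  have p: "a > 0" "b > 0" "c > 0" "d > 0" using pos abcd by auto
  \<comment> \<open>b and c have the same type, as both complement that of a. The restriction to
    {1..J} puts j into \<open>PiE\<close>.\<close>
  define j where "j = (\<lambda>i\<in>{1..J}. bigomega (P i) b)"
  have pf: "prime_factors a \<subseteq> (\<Union>i\<in>{1..J}. P i)" "prime_factors b \<subseteq> (\<Union>i\<in>{1..J}. P i)"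
      "prime_factors c \<subseteq> (\<Union>i\<in>{1..J}. P i)" "prime_factors d \<subseteq> (\<Union>i\<in>{1..J}. P i)"
    and om: "\<And>i. i \<in> {1..J} \<Longrightarrow> bigomega (P i) a + bigomega (P i) b = \<kappa>"
      "\<And>i. i \<in> {1..J} \<Longrightarrow> bigomega (P i) a + bigomega (P i) c = \<kappa>"
      "\<And>i. i \<in> {1..J} \<Longrightarrow> bigomega (P i) c + bigomega (P i) d = \<kappa>"
    using x(1,2,3) p unfolding abcd by (simp_all only: M_mult simp_thms)
  have ji: "bigomega (P i) b = j i" "bigomega (P i) c = j i" "bigomega (P i) a = \<kappa> - j i" "bigomega (P i) d = \<kappa> - j i" "j i \<le> \<kappa>"
    if "i \<in> {1..J}" for i
    using om[OF that] that by (simp_all add: j_def)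
  have mem: "b \<in> M j" "c \<in> M j" "a \<in> M (\<lambda>i. \<kappa> - j i)" "d \<in> M (\<lambda>i. \<kappa> - j i)"
    using pf ji p by (auto simp: M_def)
  have jP: "j \<in> PiE {1..J} (\<lambda>_. {..\<kappa>})" using ji by (auto simp: PiE_iff j_def extensional_def)
  have bnd: "real q \<le> real N / (real e * real (max b c))"
    if "q * (e * b) \<le> N" "q * (e * c) \<le> N" "e > 0" for q e
  proof -
    have "q * (e * max b c) \<le> N" using that by (simp add: max_def)
    hence "real q * (real e * real (max b c)) \<le> real N" by (simp flip: of_nat_mult of_nat_max)
    thus ?thesis using that p by (simp add: pos_le_divide_eq)
  qed
  have "(((a, d), (b, c)), (q1, q2)) \<in> Z j"
    using mem q le p bnd[of q1 a] bnd[of q2 d] unfolding abcd Z_def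
    by (simp add: big_def mult_ac)
  thus ?thesis using jP abcd by blast
qed

lemma energy_set_subset:
  "{(m1, m2, n1, n2). m1 \<in> S \<and> m2 \<in> S \<and> n1 \<in> S \<and> n2 \<in> S \<and> m1 * m2 = n1 * n2}
    \<subseteq> (\<Union>j\<in>PiE {1..J} (\<lambda>_. {..\<kappa>}). rep1 ` Z j \<union> rep2 ` Z j)"
proof (clarify)
  fix m1 m2 n1 n2 assume S: "m1 \<in> S" "m2 \<in> S" "n1 \<in> S" "n2 \<in> S" and eq: "m1 * m2 = n1 * n2"
  obtain q1 x1 where 1: "m1 = q1 * x1" "prime q1" "Y < real q1" "x1 \<in> K" "q1 * x1 \<le> N"
    using S(1) by (auto simp: S_def)
  obtain q2 x2 where 2: "m2 = q2 * x2" "prime q2" "Y < real q2" "x2 \<in> K" "q2 * x2 \<le> N"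
    using S(2) by (auto simp: S_def)
  obtain r1 y1 where 3: "n1 = r1 * y1" "prime r1" "Y < real r1" "y1 \<in> K" "r1 * y1 \<le> N"
    using S(3) by (auto simp: S_def)
  obtain r2 y2 where 4: "n2 = r2 * y2" "prime r2" "Y < real r2" "y2 \<in> K" "r2 * y2 \<le> N"
    using S(4) by (auto simp: S_def)
  have "q1 dvd (r1 * y1) * (r2 * y2)" using eq 1(1) 3(1) 4(1) by (metis dvd_triv_left dvd_mult2)
  hence "q1 dvd r1 * y1 \<or> q1 dvd r2 * y2" using 1(2) by (simp only: prime_dvd_mult_iff)
  hence "q1 = r1 \<or> q1 = r2" using 1 3 4 big_prime_dvd_times by blast
  thus "(m1, m2, n1, n2) \<in> (\<Union>j\<in>PiE {1..J} (\<lambda>_. {..\<kappa>}). rep1 ` Z j \<union> rep2 ` Z j)"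
  proof
    assume r: "q1 = r1"
    have e: "q1 * x1 * (q2 * x2) = q1 * y1 * (r2 * y2)" using eq 1 2 3 4 r by simp
    note c = big_prime_cancel[OF 1(2) 2(2) 4(2) 2(3) 1(4) 2(4) 3(4) 4(4) e]
    have "q1 * y1 \<le> N" "q2 * y2 \<le> N" using 3 4 r c(1) by auto
    from decompose[OF 1(4) 2(4) 3(4) 4(4) c(2) 1(2,3) 2(2,3) 1(5) this(1) 2(5) this(2)]
    obtain j a b c' d where j: "j \<in> PiE {1..J} (\<lambda>_. {..\<kappa>})" "(((a, d), (b, c')), (q1, q2)) \<in> Z j"
      "x1 = a * b" "y1 = a * c'" "x2 = c' * d" "y2 = b * d" by blast
    have "(m1, m2, n1, n2) = rep1 (((a, d), (b, c')), (q1, q2))"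
      using 1(1) 2(1) 3(1) 4(1) r c(1) j by (simp add: rep1_def)
    thus ?thesis using j(1,2) by blast
  next
    assume r: "q1 = r2"
    have e: "q1 * x1 * (q2 * x2) = q1 * y2 * (r1 * y1)" using eq 1 2 3 4 r by simp
    note c = big_prime_cancel[OF 1(2) 2(2) 3(2) 2(3) 1(4) 2(4) 4(4) 3(4) e]
    have "q1 * y2 \<le> N" "q2 * y1 \<le> N" using 3 4 r c(1) by auto
    from decompose[OF 1(4) 2(4) 4(4) 3(4) c(2) 1(2,3) 2(2,3) 1(5) this(1) 2(5) this(2)]
    obtain j a b c' d where j: "j \<in> PiE {1..J} (\<lambda>_. {..\<kappa>})" "(((a, d), (b, c')), (q1, q2)) \<in> Z j"
      "x1 = a * b" "y2 = a * c'" "x2 = c' * d" "y1 = b * d" by blast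
    have "(m1, m2, n1, n2) = rep2 (((a, d), (b, c')), (q1, q2))"
      using 1(1) 2(1) 3(1) 4(1) r c(1) j by (simp add: rep2_def)
    thus ?thesis using j(1,2) by blast
  qed
qed

text \<open>There are at most 4 N / (ln Y a max b c) choices for q1, and similarly for q2 with d.
  The sum of the products splits: a and d give a factor \<open>H\<close> each, b and c give
  \<open>D\<close>.\<close>

lemma card_Z_le: "real (card (Z j)) \<le> (4 * real N / ln Y) ^ 2 * (H (\<lambda>i. \<kappa> - j i) ^ 2 * D j)"
proof -
  let ?A = "M (\<lambda>i. \<kappa> - j i)"
  define q where "q = 4 * real N / ln Y"
  have big: "real (card (big (real N / (real e * real (max b c))))) \<le> q * (1 / (real e * real (max b c)))" for e b c
  proof -
    have "real (card (big (real N / (real e * real (max b c))))) \<le> 4 * max (real N / (real e * real (max b c))) 0 / ln Y"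
      unfolding big_def by (rule card_primes_between_le[OF Y_gt])
    also have "max (real N / (real e * real (max b c))) 0 = real N / (real e * real (max b c))"
      by (rule max_absorb1) simp
    finally show ?thesis by (simp add: q_def mult_ac)
  qed
  have "real (card (Z j)) = (\<Sum>((a, d), (b, c))\<in>(?A \<times> ?A) \<times> (M j \<times> M j).
      real (card (big (real N / (real a * real (max b c))))) * real (card (big (real N / (real d * real (max b c))))))"
    unfolding Z_def by (subst card_SigmaI) (auto simp: card_cartesian_product case_prod_unfold)
  also have "\<dots> \<le> (\<Sum>((a, d), (b, c))\<in>(?A \<times> ?A) \<times> (M j \<times> M j).
      (q * (1 / (real a * real (max b c)))) * (q * (1 / (real d * real (max b c)))))"
  proof (rule sum_mono, goal_cases)
    case (1 y)
    obtain a d b c where y: "y = ((a, d), (b, c))" by (metis surj_pair)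
    have "q \<ge> 0" using Y_gt by (simp add: q_def)
    thus ?case
      unfolding y prod.case by (intro mult_mono big mult_nonneg_nonneg) auto
  qed
  also have "\<dots> = (\<Sum>(x, y)\<in>(?A \<times> ?A) \<times> (M j \<times> M j).
      (1 / real (fst x) * (1 / real (snd x))) * (q ^ 2 * (1 / real (max (fst y) (snd y)) ^ 2)))"
    by (intro sum.cong refl) (simp add: case_prod_unfold power2_eq_square mult_ac)
  also have "\<dots> = (\<Sum>x\<in>?A \<times> ?A. 1 / real (fst x) * (1 / real (snd x))) *
      (\<Sum>y\<in>M j \<times> M j. q ^ 2 * (1 / real (max (fst y) (snd y)) ^ 2))"
    by (simp only: sum_product sum.cartesian_product)
  also have "(\<Sum>y\<in>M j \<times> M j. q ^ 2 * (1 / real (max (fst y) (snd y)) ^ 2)) = q ^ 2 * D j"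
    by (simp only: sum_distrib_left[symmetric] D_def sum.cartesian_product case_prod_unfold)
  also have "(\<Sum>x\<in>?A \<times> ?A. 1 / real (fst x) * (1 / real (snd x))) = (\<Sum>a\<in>?A. \<Sum>d\<in>?A. 1 / real a * (1 / real d))"
    by (simp only: sum.cartesian_product case_prod_unfold)
  also have "(\<Sum>a\<in>?A. \<Sum>d\<in>?A. 1 / real a * (1 / real d)) = H (\<lambda>i. \<kappa> - j i) ^ 2"
    by (simp only: H_def power2_eq_square sum_product)
  finally show ?thesis by (simp add: q_def mult_ac)
qed

text \<open>The factor 2 stands for the two orders in which the large primes can recur.\<close>

lemma energy_S_le:
  "weighted_energy N (\<lambda>n. if n \<in> S then 1 else 0)
    \<le> 2 * (4 * real N / ln Y) ^ 2 * (\<Sum>j\<in>PiE {1..J} (\<lambda>_. {..\<kappa>}). H (\<lambda>i. \<kappa> - j i) ^ 2 * D j)"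
proof -
  let ?w = "\<lambda>n. if n \<in> S then 1 else 0 :: real"
  let ?I = "{(m1, m2, n1, n2). m1 \<in> {1..N} \<and> m2 \<in> {1..N} \<and> n1 \<in> {1..N} \<and> n2 \<in> {1..N} \<and> m1 * m2 = n1 * n2}"
  let ?Q = "{(m1, m2, n1, n2). m1 \<in> S \<and> m2 \<in> S \<and> n1 \<in> S \<and> n2 \<in> S \<and> m1 * m2 = n1 * n2}"
  let ?PE = "PiE {1..J} (\<lambda>_. {..\<kappa>}) :: (nat \<Rightarrow> nat) set"
  have finPE: "finite ?PE" by (intro finite_PiE) auto
  have finI: "finite ?I"
    by (rule finite_subset[of _ "{1..N} \<times> {1..N} \<times> {1..N} \<times> {1..N}"]) auto
  have "?Q \<subseteq> ?I" using S_subset by blast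
  hence "weighted_energy N ?w = (\<Sum>x\<in>?Q. 1)"
    unfolding weighted_energy_def using finI
    by (intro sum.mono_neutral_cong_right) (auto split: if_splits)
  also have "\<dots> = real (card ?Q)" by simp
  finally have E: "weighted_energy N ?w = real (card ?Q)" .
  have "card ?Q \<le> card (\<Union>j\<in>?PE. rep1 ` Z j \<union> rep2 ` Z j)"
    by (rule card_mono[OF _ energy_set_subset])
      (intro finite_UN_I finPE finite_UnI finite_imageI finite_Z)
  also have "\<dots> \<le> (\<Sum>j\<in>?PE. card (rep1 ` Z j \<union> rep2 ` Z j))"
    by (rule card_UN_le) (rule finPE)
  also have "\<dots> \<le> (\<Sum>j\<in>?PE. card (Z j) + card (Z j))"
  proof (rule sum_mono)
    fix j
    have "card (rep1 ` Z j \<union> rep2 ` Z j) \<le> card (rep1 ` Z j) + card (rep2 ` Z j)"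
      by (rule card_Un_le)
    also have "\<dots> \<le> card (Z j) + card (Z j)"
      by (rule add_mono; rule card_image_le; rule finite_Z)
    finally show "card (rep1 ` Z j \<union> rep2 ` Z j) \<le> card (Z j) + card (Z j)" .
  qed
  finally have "real (card ?Q) \<le> real (\<Sum>j\<in>?PE. card (Z j) + card (Z j))"
    by (rule of_nat_mono)
  also have "\<dots> \<le> (\<Sum>j\<in>?PE. 2 * (4 * real N / ln Y) ^ 2 * (H (\<lambda>i. \<kappa> - j i) ^ 2 * D j))"
    unfolding of_nat_sum
  proof (rule sum_mono)
    fix j
    show "real (card (Z j) + card (Z j)) \<le> 2 * (4 * real N / ln Y) ^ 2 * (H (\<lambda>i. \<kappa> - j i) ^ 2 * D j)"
      using card_Z_le[of j] by (simp only: of_nat_add mult.assoc)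
  qed
  finally show ?thesis unfolding E by (simp only: sum_distrib_left)
qed

text \<open>For every m the primes between \<open>N div m div c\<close> and \<open>N div m\<close>
  exceed Y, and their logarithms, each at most ln N, add up to at least N / (2 c m). As q and m are
  determined by q m, the counts can be summed over m.\<close>

lemma card_S_ge:
  assumes K: "c > 0"
    "\<And>n. n \<ge> c \<Longrightarrow> real n / real c \<le> (\<Sum>p\<in>primes_upto n - primes_upto (n div c). ln (real p))"
    and big: "\<And>m. m \<in> K \<Longrightarrow> Y \<le> real (N div m div c)"
    and N: "N \<ge> 2"
  shows "real N / (2 * real c * ln (real N)) * H (\<lambda>_. \<kappa>) \<le> real (card S)"
proof -
  let ?F = "\<lambda>m. {q. prime q \<and> Y < real q \<and> q * m \<le> N}"
  have finF: "finite (?F m)" if "m \<in> K" for m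
  proof (rule finite_subset)
    show "?F m \<subseteq> {..N}" using M_pos[OF that] by (auto elim: order.trans[rotated])
  qed simp
  have inj: "inj_on (\<lambda>(m, q). q * m) (SIGMA m:K. ?F m)"
  proof (rule inj_onI, clarsimp)
    fix m q m' q' assume a: "m \<in> K" "prime q" "Y < real q" "m' \<in> K" "prime q'" "Y < real q'" "q * m = q' * m'"
    have "q dvd q' * m'" using a(7) by (metis dvd_triv_left)
    hence "q = q'" using a big_prime_dvd_times by blast
    thus "m = m' \<and> q = q'" using a by (auto simp: prime_gt_0_nat)
  qed
  have "S = (\<lambda>(m, q). q * m) ` (SIGMA m:K. ?F m)"
    by (auto simp: S_def)
  hence "card S = card (SIGMA m:K. ?F m)" using card_image[OF inj] by simp
  also have "\<dots> = (\<Sum>m\<in>K. card (?F m))"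
    by (rule card_SigmaI) (use finF in auto)
  finally have cS: "real (card S) = (\<Sum>m\<in>K. real (card (?F m)))" by simp
  have "real N / (2 * real c * ln (real N)) * H (\<lambda>_. \<kappa>) = (\<Sum>m\<in>K. real N / (2 * real c * ln (real N)) * (1 / real m))"
    by (simp add: H_def sum_distrib_left)
  also have "\<dots> \<le> (\<Sum>m\<in>K. real (card (?F m)))"
  proof (rule sum_mono)
    fix m assume m: "m \<in> K"
    have m0: "m > 0" using M_pos[OF m] .
    define n where "n = N div m"
    have lnN: "ln (real N) > 0" using N by simp
    have nc: "real (n div c) > 1" using big[OF m] Y_gt by (simp add: n_def)
    hence "n div c \<ge> 1" by simp
    hence n: "n \<ge> c" "n \<ge> 1" using K(1) by (auto simp: Suc_le_eq div_greater_zero_iff)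
    let ?B = "primes_upto n - primes_upto (n div c)"
    have sub: "?B \<subseteq> ?F m"
    proof
      fix q assume q: "q \<in> ?B"
      hence "prime q" "q \<le> N div m" "n div c < q" by (auto simp: primes_upto_def n_def)
      moreover from this have "real (n div c) < real q" by simp
      hence "Y < real q" using big[OF m] by (simp add: n_def)
      ultimately show "q \<in> ?F m" using m0 by (simp add: less_eq_div_iff_mult_less_eq)
    qed
    have nN: "n \<le> N" by (simp add: n_def)
    have "real N < real m * (real n + 1)"
    proof -
      have "N < m * (n + 1)" using m0 by (simp add: n_def dividend_less_times_div algebra_simps)
      thus ?thesis by (simp flip: of_nat_mult of_nat_add of_nat_1 of_nat_Suc del: of_nat_Suc)
    qed
    also have "\<dots> \<le> real m * (2 * real n)" using n by (intro mult_left_mono) auto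
    finally have "real N / (2 * real m) \<le> real n" using m0 by (simp add: field_simps)
    hence "real N / (2 * real c * ln (real N)) * (1 / real m) \<le> real n / real c / ln (real N)"
      using K(1) lnN divide_right_mono[of "real N / (2 * real m)" "real n" "real c * ln (real N)"]
      by (simp add: mult_ac)
    also have "\<dots> \<le> (\<Sum>p\<in>?B. ln (real p)) / ln (real N)"
      using K(2)[OF n(1)] lnN by (intro divide_right_mono) auto
    also have "\<dots> \<le> (\<Sum>p\<in>?B. ln (real N)) / ln (real N)"
    proof (intro divide_right_mono sum_mono)
      fix p assume "p \<in> ?B"
      hence "prime p" "p \<le> N" using nN by (auto simp: primes_upto_def)
      thus "ln (real p) \<le> ln (real N)" using N by (subst ln_le_cancel_iff) (auto simp: prime_gt_0_nat)
    qed (use lnN in auto)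
    also have "\<dots> = real (card ?B)" using lnN by simp
    also have "\<dots> \<le> real (card (?F m))" using card_mono[OF finF[OF m] sub] by simp
    finally show "real N / (2 * real c * ln (real N)) * (1 / real m) \<le> real (card (?F m))" .
  qed
  finally show ?thesis by (simp add: cS)
qed

text \<open>The powers of N cancel, and 512 is 2 * 4^2 from the energy times 2^4 from the
  norm.\<close>

lemma min_energy_le_G:
  assumes K: "c > 0"
    "\<And>n. n \<ge> c \<Longrightarrow> real n / real c \<le> (\<Sum>p\<in>primes_upto n - primes_upto (n div c). ln (real p))"
    and big: "\<And>m. m \<in> K \<Longrightarrow> Y \<le> real (N div m div c)"
    and N: "N \<ge> 2"
    and u: "0 < u" "u \<le> H (\<lambda>_. \<kappa>)"
    and v: "(\<Sum>j\<in>PiE {1..J} (\<lambda>_. {..\<kappa>}). H (\<lambda>i. \<kappa> - j i) ^ 2 * D j) \<le> v"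
  shows "min_energy N \<le> 512 * real c ^ 4 * ln (real N) ^ 4 / ln Y ^ 2 * v / u ^ 4"
proof -
  let ?w = "\<lambda>n. if n \<in> S then 1 else 0 :: real"
  have lnN: "ln (real N) > 0" using N by simp
  have lnY: "ln Y > 0" using Y_gt by simp
  define s where "s = real N / (2 * real c * ln (real N)) * u"
  have s: "s > 0" using u N K(1) lnN by (simp add: s_def)
  have "s \<le> real N / (2 * real c * ln (real N)) * H (\<lambda>_. \<kappa>)"
    unfolding s_def using u lnN by (intro mult_left_mono) auto
  also have "\<dots> \<le> real (card S)" by (rule card_S_ge[OF K big N])
  finally have sS: "s \<le> real (card S)" .
  have norm: "weight_norm1 N ?w = real (card S)"
  proof -
    have "weight_norm1 N ?w = (\<Sum>m\<in>S. 1)"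
      unfolding weight_norm1_def using S_subset by (intro sum.mono_neutral_cong_right) auto
    thus ?thesis by simp
  qed
  have "card S \<noteq> 0" using s sS by auto
  hence "S \<noteq> {}" by auto
  then obtain n0 where "n0 \<in> S" by blast
  hence w: "?w \<in> weights N" using S_subset by (auto simp: weights_def)
  have "min_energy N \<le> real N ^ 2 * weighted_energy N ?w / weight_norm1 N ?w ^ 4"
    by (rule min_energy_le[OF w])
  also have "\<dots> \<le> real N ^ 2 * (2 * (4 * real N / ln Y) ^ 2 * v) / s ^ 4"
  proof (rule frac_le)
    show "real N ^ 2 * weighted_energy N ?w \<le> real N ^ 2 * (2 * (4 * real N / ln Y) ^ 2 * v)"
      by (intro mult_left_mono order.trans[OF energy_S_le] v) auto
    have "0 \<le> (\<Sum>j\<in>PiE {1..J} (\<lambda>_. {..\<kappa>}). H (\<lambda>i. \<kappa> - j i) ^ 2 * D j)"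
      by (auto simp: D_def intro!: sum_nonneg mult_nonneg_nonneg)
    hence "v \<ge> 0" using v by linarith
    thus "0 \<le> real N ^ 2 * (2 * (4 * real N / ln Y) ^ 2 * v)" by simp
  qed (use s sS norm in \<open>auto intro!: power_mono\<close>)
  also have "\<dots> = 512 * real c ^ 4 * ln (real N) ^ 4 / ln Y ^ 2 * v / u ^ 4"
    using N K(1) lnN lnY u by (simp add: s_def power_divide power_mult_distrib field_simps)
  finally show ?thesis .
qed

end

section \<open>Choice of the parameters\<close>

lemma mertens_second_interval:
  obtains C where "C \<ge> 0"
    "\<And>a b. 2 \<le> a \<Longrightarrow> a \<le> b \<Longrightarrow>
      \<bar>(\<Sum>p\<in>{p. prime p \<and> a < real p \<and> real p \<le> b}. 1 / real p) - (ln (ln b) - ln (ln a))\<bar> \<le> C"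
proof -
  obtain C where C: "\<And>n. n \<ge> 2 \<Longrightarrow> \<bar>(\<Sum>p\<in>primes_upto n. 1 / real p) - ln (ln (real n))\<bar> \<le> C"
    using mertens_second by blast
  define s where "s x = (\<Sum>p\<in>primes_upto (nat \<lfloor>x\<rfloor>). 1 / real p)" for x :: real
  have s: "\<bar>s x - ln (ln x)\<bar> \<le> C + ln 2" if x: "x \<ge> 2" for x
  proof -
    define n where "n = nat \<lfloor>x\<rfloor>"
    have n: "n \<ge> 2" "real n \<le> x" "x < real n + 1" using x unfolding n_def by linarith+
    \<comment> \<open>Rounding x down to n therefore changes lnln x by at most ln 2.\<close>
    have "x \<le> real n ^ 2"
    proof -
      have "2 * real n \<le> real n * real n" using n(1) by (intro mult_right_mono) auto
      moreover have "real n + 1 \<le> 2 * real n" using n(1) by simp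
      ultimately show ?thesis using n(3) unfolding power2_eq_square by linarith
    qed
    hence "ln x \<le> ln (real n ^ 2)" using x n by (subst ln_le_cancel_iff) auto
    also have "\<dots> = 2 * ln (real n)" using n by (simp add: ln_realpow)
    finally have "ln (ln x) \<le> ln (2 * ln (real n))" using x n by (subst ln_le_cancel_iff) auto
    also have "\<dots> = ln 2 + ln (ln (real n))" using n by (simp add: ln_mult)
    finally have "ln (ln x) \<le> ln 2 + ln (ln (real n))" .
    moreover have "ln (ln (real n)) \<le> ln (ln x)" using x n by simp
    moreover have "ln (2::real) \<ge> 0" by simp
    ultimately show ?thesis using C[OF n(1)] unfolding s_def n_def[symmetric] by linarith
  qed
  show ?thesis
  proof (rule that[of "2 * (C + ln 2)"])
    show "0 \<le> 2 * (C + ln 2)" using order.trans[OF abs_ge_zero s[OF order_refl]] by simp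
    fix a b :: real assume ab: "2 \<le> a" "a \<le> b"
    have mem: "p \<in> primes_upto (nat \<lfloor>x\<rfloor>) \<longleftrightarrow> prime p \<and> real p \<le> x" if "x \<ge> 2" for p x
    proof -
      have "p \<le> nat \<lfloor>x\<rfloor> \<longleftrightarrow> real p \<le> x" using that by (simp add: le_nat_iff le_floor_iff)
      thus ?thesis by (simp add: primes_upto_def)
    qed
    have "{p. prime p \<and> a < real p \<and> real p \<le> b} = primes_upto (nat \<lfloor>b\<rfloor>) - primes_upto (nat \<lfloor>a\<rfloor>)"
      using ab by (auto simp: mem)
    moreover have "primes_upto (nat \<lfloor>a\<rfloor>) \<subseteq> primes_upto (nat \<lfloor>b\<rfloor>)"
      using ab by (auto simp: mem)
    ultimately have "(\<Sum>p\<in>{p. prime p \<and> a < real p \<and> real p \<le> b}. 1 / real p) = s b - s a"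
      unfolding s_def by (simp add: sum_diff)
    thus "\<bar>(\<Sum>p\<in>{p. prime p \<and> a < real p \<and> real p \<le> b}. 1 / real p) - (ln (ln b) - ln (ln a))\<bar> \<le> 2 * (C + ln 2)"
      using s[of a] s[of b] ab by simp
  qed
qed

text \<open>With L = ln T, a prime is in range i when lnln p lies between h i L and h (i + 1) L, so
  each range has reciprocal prime sum h L + O(1). Of the J + 2 pieces, those with index 1 to J serve
  as ranges. Piece 0 is left out, so that all primes exceed exp (T^h) and repeated factors are
  negligible; piece J + 1, beyond exp (T^(1 - h)), is left to the large primes.\<close>

definition ranges :: "real \<Rightarrow> real \<Rightarrow> nat \<Rightarrow> nat set" where
  "ranges T h i = {p. prime p \<and> exp (T powr (h * real i)) < real p \<and> real p \<le> exp (T powr (h * (real i + 1)))}"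

lemma finite_ranges: "finite (ranges T h i)"
  by (rule finite_subset[of _ "{..nat \<lfloor>exp (T powr (h * (real i + 1)))\<rfloor>}"])
     (auto simp: ranges_def le_nat_floor)

lemma ranges_disjoint:
  assumes "T \<ge> 1" "h \<ge> 0" "p \<in> ranges T h i" "p \<in> ranges T h j"
  shows "i = j"
proof -
  have "\<not> i < j" if "p \<in> ranges T h i" "p \<in> ranges T h j" for i j
  proof
    assume "i < j"
    hence "T powr (h * (real i + 1)) \<le> T powr (h * real j)"
      using assms by (intro powr_mono mult_left_mono) auto
    hence "exp (T powr (h * (real i + 1))) \<le> exp (T powr (h * real j))" by simp
    thus False using that unfolding ranges_def mem_Collect_eq by linarith
  qed
  thus ?thesis using assms by (meson linorder_neqE_nat)
qed

text \<open>For \<open>L = ln T\<close> this is the largest \<open>\<kappa>\<close> with \<open>4 ^ \<kappa> \<le> T powr h\<close>.\<close>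

definition kap :: "real \<Rightarrow> real \<Rightarrow> nat" where
  "kap h L = nat \<lfloor>h * L / (2 * ln 2)\<rfloor>"

lemma kap_le:
  assumes "h \<ge> 0" "L \<ge> 0"
  shows "real (kap h L) * (2 * ln 2) \<le> h * L" "real (kap h L) \<le> h * L"
proof -
  have "real (kap h L) \<le> h * L / (2 * ln 2)" using assms by (simp add: kap_def)
  thus *: "real (kap h L) * (2 * ln 2) \<le> h * L" by (simp add: field_simps)
  have "real (kap h L) * 1 \<le> real (kap h L) * (2 * ln 2)"
    using ln2_bounds by (intro mult_left_mono) auto
  thus "real (kap h L) \<le> h * L" using * by linarith
qed

lemma min_energy_upper_bound:
  fixes J :: nat
  defines "h \<equiv> 1 / (real J + 2)"
  obtains C L0 A where "C \<ge> 0"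
    "\<forall>N\<ge>3. ln (ln (real N)) \<ge> L0 \<longrightarrow> (let L = ln (ln (real N)); \<kappa> = kap h L in
      min_energy N \<le> exp (A + (2 + 2 * h) * L
        + 2 * real J * (real \<kappa> * ln (h * L + C + 1) - 2 * real \<kappa> * ln (h * L - C) + ln (fact \<kappa>))))"
proof -
  obtain C where C: "C \<ge> 0" "\<And>a b. 2 \<le> a \<Longrightarrow> a \<le> b \<Longrightarrow>
      \<bar>(\<Sum>p\<in>{p. prime p \<and> a < real p \<and> real p \<le> b}. 1 / real p) - (ln (ln b) - ln (ln a))\<bar> \<le> C"
    using mertens_second_interval by blast
  obtain c :: nat where c: "c > 0"
    "\<And>n. n \<ge> c \<Longrightarrow> real n / real c \<le> (\<Sum>p\<in>primes_upto n - primes_upto (n div c). ln (real p))"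
    using chebyshev_lower by blast
  have h: "0 < h" "h \<le> 1 / 2" "h * (real J + 2) = 1" by (auto simp: h_def field_simps)
  \<comment> \<open>(C + 1) / h makes h L - C positive, 2 ln (2 c) gives ln (2 c) \<le> T / 2, and 4
    (J + 1) / h^2 gives E \<le> 1/2 below.\<close>
  define L0 where "L0 = Max {C + 1, (C + 1) / h, 2 * ln (2 * real c), 4 * (real J + 1) / h ^ 2, 1}"
  have L0: "L0 \<ge> C + 1" "L0 \<ge> (C + 1) / h" "L0 \<ge> 2 * ln (2 * real c)" "L0 \<ge> 4 * (real J + 1) / h ^ 2" "L0 \<ge> 1"
    by (auto simp: L0_def)
  define A where "A = ln (512 * real c ^ 4 * (8 * (real J + 1)))"
  show ?thesis
  proof (rule that[OF C(1)], intro allI impI)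
    fix N :: nat assume N: "N \<ge> 3" "ln (ln (real N)) \<ge> L0"
    define T L where "T = ln (real N)" and "L = ln T"
    define \<kappa> where "\<kappa> = kap h L"
    have LL0: "L \<ge> L0" using N by (simp add: L_def T_def)
    have L: "L \<ge> 1" using LL0 L0 by linarith
    have T0: "T > 0" using N by (simp add: T_def)
    have TL: "T = exp L" using T0 by (simp add: L_def)
    have T1: "T \<ge> 1" using TL L by simp
    have TLge: "L \<le> T" using exp_ge_add_one_self[of L] TL by linarith
    have powT: "T powr s = exp (s * L)" for s using T0 by (simp add: powr_def L_def)
    have kap: "real \<kappa> * (2 * ln 2) \<le> h * L" "real \<kappa> \<le> h * L"
      unfolding \<kappa>_def using h L by (intro kap_le; simp)+
    define Y where "Y = exp (T powr (1 - h))"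
    \<comment> \<open>Upper and lower bounds for the reciprocal prime sum of a range; the extra 1 in
      \<open>x\<close> absorbs the correction \<kappa> / y for repeated primes.\<close>
    define x \<mu> where "x = h * L + C + 1" and "\<mu> = h * L - C"
    have hL: "h * L \<ge> C + 1"
    proof -
      have "C + 1 \<le> h * L0" using L0(2) h by (simp add: field_simps)
      also have "\<dots> \<le> h * L" using LL0 h by (intro mult_left_mono) auto
      finally show ?thesis .
    qed
    have x: "x > 0" "real \<kappa> \<le> x" using kap hL C(1) by (auto simp: x_def)
    have \<mu>: "\<mu> > 0" using hL by (simp add: \<mu>_def)
    interpret energy_setup "ranges T h" J \<kappa> N Y
    proof unfold_locales
      show "finite (ranges T h i)" for i by (rule finite_ranges)
      show "prime p" if "p \<in> ranges T h i" for i p using that by (simp add: ranges_def)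
      show "i = j" if "p \<in> ranges T h i" "p \<in> ranges T h j" for i j p
        using T1 less_imp_le[OF h(1)] that by (rule ranges_disjoint)
      show "1 < Y" using T0 by (simp add: Y_def)
    next
      fix i p assume i: "i \<in> {1..J}" and p: "p \<in> ranges T h i"
      have "h * (real i + 1) \<le> h * (real J + 1)" using i h by (intro mult_left_mono) auto
      also have "\<dots> = 1 - h" using h(3) by (simp add: algebra_simps)
      finally have "T powr (h * (real i + 1)) \<le> T powr (1 - h)" using T1 by (intro powr_mono) auto
      hence "exp (T powr (h * (real i + 1))) \<le> Y" by (simp add: Y_def)
      moreover have "real p \<le> exp (T powr (h * (real i + 1)))" using p by (simp add: ranges_def)
      ultimately show "real p \<le> Y" by linarith
    qed
    have sums: "\<bar>(\<Sum>p\<in>ranges T h i. 1 / real p) - h * L\<bar> \<le> C" for i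
    proof -
      have "2 \<le> exp (T powr (h * real i))"
      proof -
        have "T powr 0 \<le> T powr (h * real i)" using T1 h by (intro powr_mono) auto
        hence "1 \<le> T powr (h * real i)" using T0 by simp
        thus ?thesis using exp_ge_add_one_self[of "T powr (h * real i)"] by linarith
      qed
      moreover have "exp (T powr (h * real i)) \<le> exp (T powr (h * (real i + 1)))"
        using T1 h by (simp add: powr_mono)
      ultimately show ?thesis
        using C(2)[of "exp (T powr (h * real i))" "exp (T powr (h * (real i + 1)))"] T0
        by (simp add: ranges_def powT algebra_simps)
    qed
    define y where "y = exp (T powr h)"
    have y: "y > 0" "\<And>i p. i \<in> {1..J} \<Longrightarrow> p \<in> ranges T h i \<Longrightarrow> y \<le> real p"
    proof -
      show "y > 0" by (simp add: y_def)
      fix i p assume i: "i \<in> {1..J}" and p: "p \<in> ranges T h i"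
      have "h * 1 \<le> h * real i" using i h by (intro mult_left_mono) auto
      hence "T powr h \<le> T powr (h * real i)" using T1 by (intro powr_mono) auto
      hence "y \<le> exp (T powr (h * real i))" by (simp add: y_def)
      moreover have "exp (T powr (h * real i)) < real p" using p by (simp add: ranges_def)
      ultimately show "y \<le> real p" by linarith
    qed
    have "real \<kappa> \<le> y"
    proof -
      have "h * L \<le> exp (h * L)" using exp_ge_add_one_self[of "h * L"] by linarith
      also have "\<dots> = T powr h" by (simp add: powT)
      also have "\<dots> \<le> y" unfolding y_def using exp_ge_add_one_self[of "T powr h"] by linarith
      finally show ?thesis using kap by linarith
    qed
    hence "real \<kappa> / y \<le> 1" using y(1) by simp
    hence sx: "(\<Sum>p\<in>ranges T h i. 1 / real p) + real \<kappa> / y \<le> x" for i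
      using sums[of i] by (simp add: x_def)
    have HG: "H j \<le> G x j" if "\<And>i. i \<in> {1..J} \<Longrightarrow> j i \<le> \<kappa>" for j
      using that x(1) sx by (intro H_le_G[OF y]) auto
    have "(\<Sum>j\<in>PiE {1..J} (\<lambda>_. {..\<kappa>}). H (\<lambda>i. \<kappa> - j i) ^ 2 * D j) \<le> 8 * (real J + 1) * G x (\<lambda>_. \<kappa>) ^ 2"
    proof (rule sum_H_D_le[where Y = "\<lambda>t. exp (T powr (h * real t))"])
      fix t
      show "1 < exp (T powr (h * real t))" using T0 by simp
      show "p \<in> ranges T h t \<Longrightarrow> exp (T powr (h * real t)) < real p" for p
        by (simp add: ranges_def)
      have "(4::real) ^ (\<kappa> * t) = exp (real \<kappa> * (2 * ln 2) * real t)"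
      proof -
        have "ln (4::real) = 2 * ln 2" using ln_realpow[of 2 2] by simp
        hence "(4::real) = exp (2 * ln 2)" by (metis exp_ln zero_less_numeral)
        hence "(4::real) ^ (\<kappa> * t) = exp (2 * ln 2) ^ (\<kappa> * t)" by simp
        thus ?thesis by (simp add: exp_of_nat_mult[symmetric] mult_ac)
      qed
      also have "\<dots> \<le> exp (h * L * real t)" using kap by (simp add: mult_right_mono)
      finally show "4 ^ (\<kappa> * t) \<le> ln (exp (T powr (h * real t)))" by (simp add: powT mult_ac)
    qed (use x HG in auto)
    moreover have u: "0 < G \<mu> (\<lambda>_. \<kappa>)" "G \<mu> (\<lambda>_. \<kappa>) \<le> H (\<lambda>_. \<kappa>)"
    proof -
      show "0 < G \<mu> (\<lambda>_. \<kappa>)" using \<mu> by (auto simp: G_def intro!: prod_pos)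
      have "\<mu> \<le> (\<Sum>p\<in>ranges T h i. 1 / real p)" for i using sums[of i] by (simp add: \<mu>_def)
      thus "G \<mu> (\<lambda>_. \<kappa>) \<le> H (\<lambda>_. \<kappa>)" using \<mu> by (intro G_le_H) auto
    qed
    moreover have "Y \<le> real (N div m div c)" if m: "m \<in> K" for m
    proof -
      have Y1: "Y \<ge> 1" using Y_gt by simp
      have "real m \<le> Y ^ (\<Sum>i\<in>{1..J}. \<kappa>)"
        using le_Y Y1 m by (rule M_le_power)
      hence mY: "real m \<le> Y ^ (J * \<kappa>)" by simp
      \<comment> \<open>As m \<le> Y^(J \<kappa>), it suffices that 2 c Y^(J \<kappa> + 1) \<le> N,
        where the 2 pays for the rounding in \<open>div\<close>. In logarithms the power of Y
        becomes T^(1 - h) (J \<kappa> + 1), at most T E, and E is small because exp (h L) outgrows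
        L.\<close>
      define E where "E = exp (- h * L) * (L * (real J + 1))"
      have "ln (2 * real c) + T powr (1 - h) * (real (J * \<kappa>) + 1) \<le> T / 2 + T * E"
      proof (intro add_mono)
        show "ln (2 * real c) \<le> T / 2" using L0(3) LL0 TLge by linarith
        have Tpow: "T powr (1 - h) = T * exp (- h * L)"
        proof -
          have "T powr (1 - h) = exp (L + - h * L)" unfolding powT by (simp add: algebra_simps)
          thus ?thesis unfolding exp_add TL[symmetric] .
        qed
        have "h * L \<le> 1 * L" using h L by (intro mult_right_mono) auto
        hence kL: "real \<kappa> \<le> L" using kap by linarith
        have "real (J * \<kappa>) + 1 \<le> real J * L + L"
          using kL L by (intro add_mono) (auto intro: mult_left_mono)
        hence "T powr (1 - h) * (real (J * \<kappa>) + 1) \<le> T powr (1 - h) * (L * (real J + 1))"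
          by (intro mult_left_mono) (auto simp: algebra_simps)
        thus "T powr (1 - h) * (real (J * \<kappa>) + 1) \<le> T * E"
          unfolding Tpow E_def by (simp only: mult_ac)
      qed
      also have "E \<le> 1 / 2"
      proof -
        have hL0: "h * L > 0" using h L by simp
        have "1 + h * L + (h * L) ^ 2 / 2 \<le> exp (h * L)" using hL0 by (intro exp_lower_Taylor_quadratic) auto
        hence q: "(h * L) ^ 2 / 2 \<le> exp (h * L)" using hL0 by linarith
        have "4 * (real J + 1) \<le> L * h ^ 2"
        proof -
          have "4 * (real J + 1) \<le> L0 * h ^ 2" using L0(4) h by (simp add: field_simps)
          also have "\<dots> \<le> L * h ^ 2" using LL0 by (intro mult_right_mono) auto
          finally show ?thesis .
        qed
        hence "4 * (real J + 1) * L \<le> (h * L) ^ 2"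
          using L mult_right_mono[of "4 * (real J + 1)" "L * h ^ 2" L] by (simp add: power2_eq_square mult_ac)
        hence "2 * (L * (real J + 1)) \<le> exp (h * L)" using q by (simp add: algebra_simps)
        thus ?thesis by (simp add: E_def exp_minus field_simps)
      qed
      finally have "ln (2 * real c) + T powr (1 - h) * (real (J * \<kappa>) + 1) \<le> T"
        using T0 by (simp add: mult_left_mono)
      hence "exp (ln (2 * real c) + T powr (1 - h) * (real (J * \<kappa>) + 1)) \<le> exp T" by simp
      also have "exp T = real N" using N by (simp add: T_def)
      also have "exp (ln (2 * real c) + T powr (1 - h) * (real (J * \<kappa>) + 1)) = 2 * real c * (Y ^ (J * \<kappa>) * Y)"
        using c(1) by (simp add: exp_add Y_def exp_of_nat_mult[symmetric] algebra_simps)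
      finally have "2 * real c * (Y ^ (J * \<kappa>) * Y) \<le> real N" .
      moreover have "2 * real c * (real m * Y) \<le> 2 * real c * (Y ^ (J * \<kappa>) * Y)"
        using mY Y1 by (intro mult_left_mono mult_right_mono) auto
      ultimately have "2 * Y * real (m * c) \<le> real N" by (simp add: mult_ac)
      moreover have mc: "real (m * c) > 0" using c(1) M_pos[OF m] by simp
      ultimately have "2 * Y \<le> real N / real (m * c)" by (simp add: pos_le_divide_eq)
      also have "\<dots> < real (N div (m * c)) + 1"
        using floor_divide_of_nat_eq[of N "m * c", where ?'a = real] by linarith
      finally show ?thesis using Y1 by (simp add: div_mult2_eq)
    qed
    ultimately have "min_energy N \<le> 512 * real c ^ 4 * ln (real N) ^ 4 / ln Y ^ 2 *
        (8 * (real J + 1) * G x (\<lambda>_. \<kappa>) ^ 2) / G \<mu> (\<lambda>_. \<kappa>) ^ 4"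
      using N c by (intro min_energy_le_G) auto
    \<comment> \<open>The coefficient 2 + 2 h is 4 - 2 (1 - h), from (ln N)^4 / (ln Y)^2.\<close>
    also have "\<dots> = exp (A + (2 + 2 * h) * L
        + 2 * real J * (real \<kappa> * ln x - 2 * real \<kappa> * ln \<mu> + ln (fact \<kappa>)))"
    proof -
      have Gexp: "G z (\<lambda>_. \<kappa>) = exp (real J * (real \<kappa> * ln z - ln (fact \<kappa>)))" if "z > 0" for z
      proof -
        have "z ^ \<kappa> / fact \<kappa> = exp (real \<kappa> * ln z - ln (fact \<kappa>))"
          using that by (simp add: exp_diff exp_of_nat_mult)
        thus ?thesis by (simp add: G_def exp_of_nat_mult)
      qed
      have "512 * real c ^ 4 * (8 * (real J + 1)) = exp A" using c(1) by (simp add: A_def)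
      moreover have "ln (real N) ^ 4 = exp (4 * L)" unfolding T_def[symmetric] TL
        by (simp flip: exp_of_nat_mult)
      moreover have "ln Y ^ 2 = exp (2 * (1 - h) * L)"
        unfolding Y_def powT ln_exp by (simp add: exp_of_nat_mult[symmetric] mult_ac)
      ultimately have "512 * real c ^ 4 * ln (real N) ^ 4 / ln Y ^ 2 *
          (8 * (real J + 1) * G x (\<lambda>_. \<kappa>) ^ 2) / G \<mu> (\<lambda>_. \<kappa>) ^ 4
        = exp A * exp (4 * L) / exp (2 * (1 - h) * L) * G x (\<lambda>_. \<kappa>) ^ 2 / G \<mu> (\<lambda>_. \<kappa>) ^ 4"
        by (simp add: mult_ac)
      also have "\<dots> = exp (A + 4 * L - 2 * (1 - h) * L
          + 2 * (real J * (real \<kappa> * ln x - ln (fact \<kappa>))) - 4 * (real J * (real \<kappa> * ln \<mu> - ln (fact \<kappa>))))"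
        unfolding Gexp[OF x(1)] Gexp[OF \<mu>] exp_of_nat_mult[symmetric]
        by (simp only: exp_add exp_diff) (simp add: mult_ac)
      finally show ?thesis by (simp add: algebra_simps)
    qed
    finally show "let L = ln (ln (real N)); \<kappa> = kap h L in
      min_energy N \<le> exp (A + (2 + 2 * h) * L
        + 2 * real J * (real \<kappa> * ln (h * L + C + 1) - 2 * real \<kappa> * ln (h * L - C) + ln (fact \<kappa>)))"
      unfolding Let_def T_def[symmetric] L_def[symmetric] \<kappa>_def[symmetric] x_def \<mu>_def .
  qed
qed

section \<open>The exponent\<close>

text \<open>For \<kappa> about h L / (2 ln 2), the quantity (h L)^\<kappa> / \<kappa>! is about (2 e
  ln 2)^\<kappa>. The left side is the exponent of its square, per unit of h L.\<close>

lemma energy_exponent_eq: "(1 + ln (2 * ln 2)) / ln 2 = 2 - energy_exponent"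
  by (simp add: energy_exponent_def ln_mult field_simps)

lemma kap_tendsto:
  assumes "h > 0"
  shows "((\<lambda>L. real (kap h L) / L) \<longlongrightarrow> h / (2 * ln 2)) at_top"
proof (rule tendsto_sandwich[of "\<lambda>L. h / (2 * ln 2) - 1 / L" _ _ "\<lambda>L. h / (2 * ln 2)"])
  have floor: "h * L / (2 * ln 2) - 1 \<le> real (kap h L)" "real (kap h L) \<le> h * L / (2 * ln 2)" if "L > 0" for L
  proof -
    have "0 \<le> h * L / (2 * ln 2)" using that assms by simp
    thus "h * L / (2 * ln 2) - 1 \<le> real (kap h L)" "real (kap h L) \<le> h * L / (2 * ln 2)"
      unfolding kap_def by linarith+
  qed
  show "\<forall>\<^sub>F L in at_top. h / (2 * ln 2) - 1 / L \<le> real (kap h L) / L"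
    using eventually_gt_at_top[of 0]
  proof eventually_elim
    case (elim L)
    have "(h * L / (2 * ln 2) - 1) / L \<le> real (kap h L) / L"
      using floor(1)[OF elim] elim by (intro divide_right_mono) auto
    thus ?case using elim by (simp add: diff_divide_distrib)
  qed
  show "\<forall>\<^sub>F L in at_top. real (kap h L) / L \<le> h / (2 * ln 2)"
    using eventually_gt_at_top[of 0]
  proof eventually_elim
    case (elim L)
    have "real (kap h L) / L \<le> (h * L / (2 * ln 2)) / L"
      using floor(2)[OF elim] elim by (intro divide_right_mono) auto
    thus ?case using elim by simp
  qed
  have "((\<lambda>L::real. h / (2 * ln 2) - 1 / L) \<longlongrightarrow> h / (2 * ln 2) - 0) at_top"
    by (intro tendsto_intros tendsto_divide_0[OF tendsto_const] filterlim_at_top_imp_at_infinity filterlim_ident)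
  thus "((\<lambda>L::real. h / (2 * ln 2) - 1 / L) \<longlongrightarrow> h / (2 * ln 2)) at_top" by simp
qed auto

text \<open>Each logarithm is split as ln (t / L) + ln L. The terms \<kappa> ln L, of higher order
  than L, then carry the coefficients 1, -2 and 1 and cancel; everything else converges after
  division by L.\<close>

lemma upper_exponent_tendsto:
  fixes A C h J :: real
  assumes h: "h > 0"
  shows "((\<lambda>L. (A + (2 + 2 * h) * L + 2 * J * (real (kap h L) * ln (h * L + C + 1)
      - 2 * real (kap h L) * ln (h * L - C)
      + (real (kap h L) * ln (real (kap h L)) - real (kap h L) + ln (real (kap h L)) + 1))) / L)
    \<longlongrightarrow> 2 + 2 * h - J * h * (2 - energy_exponent)) at_top"
proof -
  define k where "k L = real (kap h L)" for L
  define r where "r = h / (2 * ln (2::real))"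
  have r: "r > 0" using h by (simp add: r_def)
  have inv: "((\<lambda>L::real. c / L) \<longlongrightarrow> 0) at_top" for c
    by (intro tendsto_divide_0[OF tendsto_const] filterlim_at_top_imp_at_infinity filterlim_ident)
  have k: "((\<lambda>L. k L / L) \<longlongrightarrow> r) at_top"
    unfolding k_def r_def by (rule kap_tendsto[OF h])
  have lin: "((\<lambda>L. (h * L + c) / L) \<longlongrightarrow> h) at_top" for c
  proof -
    have "((\<lambda>L. h + c / L) \<longlongrightarrow> h + 0) at_top" by (intro tendsto_intros inv)
    moreover have "\<forall>\<^sub>F L in at_top. h + c / L = (h * L + c) / L"
      using eventually_gt_at_top[of 0] by eventually_elim (simp add: field_simps)
    ultimately show ?thesis by (auto elim: Lim_transform_eventually)
  qed
  have xL: "((\<lambda>L. (h * L + C + 1) / L) \<longlongrightarrow> h) at_top" using lin[of "C + 1"] by (simp add: add.assoc)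
  have mL: "((\<lambda>L. (h * L - C) / L) \<longlongrightarrow> h) at_top" using lin[of "- C"] by simp
  have lnL: "((\<lambda>L::real. ln L / L) \<longlongrightarrow> 0) at_top" by (rule ln_x_over_x_tendsto_0)
  have ev: "\<forall>\<^sub>F L in at_top. L > 0 \<and> k L / L > 0 \<and> (h * L + C + 1) / L > 0 \<and> (h * L - C) / L > 0"
    using eventually_gt_at_top[of 0] order_tendstoD(1)[OF k r] order_tendstoD(1)[OF xL h] order_tendstoD(1)[OF mL h]
    by eventually_elim auto
  have main: "((\<lambda>L. A / L + (2 + 2 * h) + 2 * J * (k L / L * (ln ((h * L + C + 1) / L)
      - 2 * ln ((h * L - C) / L) + ln (k L / L) - 1) + (ln (k L / L) / L + ln L / L) + 1 / L))
    \<longlongrightarrow> 0 + (2 + 2 * h) + 2 * J * (r * (ln h - 2 * ln h + ln r - 1) + (0 + 0) + 0)) at_top"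
  proof (intro tendsto_intros inv xL mL k lnL)
    show "((\<lambda>L. ln (k L / L) / L) \<longlongrightarrow> 0) at_top"
      using tendsto_mult[OF tendsto_ln[OF k] inv[of 1]] r by simp
  qed (use h r in auto)
  have lim: "0 + (2 + 2 * h) + 2 * J * (r * (ln h - 2 * ln h + ln r - 1) + (0 + 0) + 0)
      = 2 + 2 * h - J * h * (2 - energy_exponent)"
  proof -
    obtain g where g: "g = 1 + ln (2 * ln (2::real))" by blast
    have "ln h - 2 * ln h + ln r - 1 = - g"
      using h by (simp add: r_def ln_div g)
    hence "2 * J * (r * (ln h - 2 * ln h + ln r - 1)) = - (J * h * (g / ln 2))"
      by (simp add: r_def)
    hence "2 * J * (r * (ln h - 2 * ln h + ln r - 1)) = - (J * h * ((1 + ln (2 * ln 2)) / ln 2))"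
      by (simp only: g)
    thus ?thesis unfolding energy_exponent_eq by simp
  qed
  have "\<forall>\<^sub>F L in at_top. A / L + (2 + 2 * h) + 2 * J * (k L / L * (ln ((h * L + C + 1) / L)
      - 2 * ln ((h * L - C) / L) + ln (k L / L) - 1) + (ln (k L / L) / L + ln L / L) + 1 / L)
    = (A + (2 + 2 * h) * L + 2 * J * (k L * ln (h * L + C + 1) - 2 * k L * ln (h * L - C)
      + (k L * ln (k L) - k L + ln (k L) + 1))) / L"
    using ev
  proof eventually_elim
    case (elim L)
    hence pos: "L > 0" "k L > 0" "h * L + C + 1 > 0" "h * L - C > 0"
      by (auto simp: zero_less_divide_iff)
    define a b d e where "a = ln (h * L + C + 1)" and "b = ln (h * L - C)" and "d = ln (k L)" and "e = ln L"
    have lns: "ln ((h * L + C + 1) / L) = a - e" "ln ((h * L - C) / L) = b - e" "ln (k L / L) = d - e"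
      using pos by (simp_all add: ln_div a_def b_def d_def e_def)
    thus ?case
      unfolding lns a_def[symmetric] b_def[symmetric] d_def[symmetric] e_def[symmetric]
      using pos by (simp add: field_simps)
  qed
  from Lim_transform_eventually[OF main[unfolded lim] this] show ?thesis by (simp add: k_def)
qed

section \<open>Bounds for \<open>min_energy\<close> up to \<epsilon> in the exponent\<close>

lemma filterlim_lnln: "filterlim (\<lambda>N. ln (ln (real N))) at_top sequentially"
  by (intro filterlim_compose[OF ln_at_top] filterlim_real_sequentially)

lemma min_energy_upper:
  assumes "\<epsilon> > 0"
  shows "\<forall>\<^sub>F N in sequentially. min_energy N \<le> exp ((energy_exponent + \<epsilon>) * ln (ln (real N)))"
proof -
  \<comment> \<open>Since J h = 1 - 2 h, the limit exceeds \<open>energy_exponent\<close> by h times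
    (6 - 2 \<open>energy_exponent\<close>); J is taken so large that this is below
    \<epsilon>.\<close>
  obtain J :: nat where J: "(6 + 2 * \<bar>energy_exponent\<bar>) / \<epsilon> < real J" using reals_Archimedean2 by blast
  define h where "h = 1 / (real J + 2)"
  have h: "h > 0" by (simp add: h_def)
  have Jh: "real J * h = 1 - 2 * h" by (simp add: h_def field_simps)
  obtain C L0 A where C: "C \<ge> 0" and ub:
    "\<forall>N\<ge>3. ln (ln (real N)) \<ge> L0 \<longrightarrow> (let L = ln (ln (real N)); \<kappa> = kap h L in
      min_energy N \<le> exp (A + (2 + 2 * h) * L
        + 2 * real J * (real \<kappa> * ln (h * L + C + 1) - 2 * real \<kappa> * ln (h * L - C) + ln (fact \<kappa>))))"
    by (rule min_energy_upper_bound[of J, folded h_def]) (rule that; assumption)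
  define F where "F L = A + (2 + 2 * h) * L + 2 * real J * (real (kap h L) * ln (h * L + C + 1)
      - 2 * real (kap h L) * ln (h * L - C)
      + (real (kap h L) * ln (real (kap h L)) - real (kap h L) + ln (real (kap h L)) + 1))" for L
  have "2 + 2 * h - real J * h * (2 - energy_exponent) = energy_exponent + h * (6 - 2 * energy_exponent)"
    unfolding Jh by (simp add: algebra_simps)
  also have "\<dots> < energy_exponent + \<epsilon>"
  proof -
    have "6 - 2 * energy_exponent \<le> 6 + 2 * \<bar>energy_exponent\<bar>" by linarith
    also have "\<dots> < \<epsilon> * (real J + 2)" using J assms by (simp add: field_simps) 
    finally show ?thesis by (simp add: h_def field_simps)
  qed
  finally have "\<forall>\<^sub>F L in at_top. F L / L < energy_exponent + \<epsilon>"
    using order_tendstoD(2)[OF upper_exponent_tendsto[OF h, of A "real J" C]] unfolding F_def by blast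
  moreover have "\<forall>\<^sub>F L in at_top. 1 \<le> kap h L"
  proof -
    have "h / (2 * ln 2) > (0::real)" using h by simp
    from order_tendstoD(1)[OF kap_tendsto[OF h] this] show ?thesis
      using eventually_gt_at_top[of 0]
    proof eventually_elim
      case (elim L)
      hence "real (kap h L) > 0" by (simp add: zero_less_divide_iff)
      thus ?case by simp
    qed
  qed
  ultimately have "\<forall>\<^sub>F L in at_top. F L \<le> (energy_exponent + \<epsilon>) * L \<and> 1 \<le> kap h L \<and> L0 \<le> L"
    using eventually_gt_at_top[of 0] eventually_ge_at_top[of L0]
    by eventually_elim (auto simp: field_simps)
  from eventually_compose_filterlim[OF this filterlim_lnln] eventually_ge_at_top[of "3::nat"]
  show ?thesis
  proof eventually_elim
    case (elim N)
    define L where "L = ln (ln (real N))"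
    have "ln (fact (kap h L) :: real) \<le> real (kap h L) * ln (real (kap h L)) - real (kap h L) + ln (real (kap h L)) + 1"
      using elim by (intro ln_fact_le_stirling) (auto simp: L_def)
    hence "A + (2 + 2 * h) * L + 2 * real J * (real (kap h L) * ln (h * L + C + 1)
        - 2 * real (kap h L) * ln (h * L - C) + ln (fact (kap h L))) \<le> F L"
      unfolding F_def by (intro add_left_mono mult_left_mono) auto
    also have "\<dots> \<le> (energy_exponent + \<epsilon>) * L" using elim by (simp add: L_def)
    finally have "exp (A + (2 + 2 * h) * L + 2 * real J * (real (kap h L) * ln (h * L + C + 1)
        - 2 * real (kap h L) * ln (h * L - C) + ln (fact (kap h L)))) \<le> exp ((energy_exponent + \<epsilon>) * L)"
      by simp
    moreover have "min_energy N \<le> exp (A + (2 + 2 * h) * L + 2 * real J * (real (kap h L) * ln (h * L + C + 1)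
        - 2 * real (kap h L) * ln (h * L - C) + ln (fact (kap h L))))"
      using ub elim by (simp add: Let_def L_def)
    ultimately show ?case unfolding L_def by (rule order.trans[rotated])
  qed
qed

lemma min_energy_lower:
  assumes "\<epsilon> > 0"
  shows "\<forall>\<^sub>F N in sequentially. exp ((energy_exponent - \<epsilon>) * ln (ln (real N))) \<le> min_energy N"
proof -
  obtain c where c: "c > 0" "\<And>N. N \<ge> 3 \<Longrightarrow> c * ln (real N) powr energy_exponent \<le> min_energy N"
    using min_energy_lower_bound by blast
  \<comment> \<open>From here on (ln N)^\<epsilon> \<ge> 1 / c, which absorbs the constant of the
    lower bound.\<close>
  have "\<forall>\<^sub>F N in sequentially. ln (ln (real N)) \<ge> - ln c / \<epsilon>"
    using filterlim_lnln by (simp add: filterlim_at_top)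
  thus ?thesis using eventually_ge_at_top[of "3::nat"]
  proof eventually_elim
    case (elim N)
    define L where "L = ln (ln (real N))"
    have lnN: "ln (real N) > 0" using elim by simp
    have "- ln c \<le> \<epsilon> * L" using elim assms by (simp add: L_def field_simps)
    hence "exp ((energy_exponent - \<epsilon>) * L) \<le> exp (ln c + energy_exponent * L)"
      by (simp add: algebra_simps)
    also have "\<dots> = c * ln (real N) powr energy_exponent"
      using c(1) lnN by (simp add: exp_add powr_def L_def)
    also have "\<dots> \<le> min_energy N" using elim by (intro c) auto
    finally show ?case by (simp add: L_def)
  qed
qed

theorem theorem2:
  shows "\<exists>\<epsilon> :: nat \<Rightarrow> real. \<epsilon> \<longlonglongrightarrow> 0 \<and>
    (\<forall>\<^sub>F N in sequentially. min_energy N = ln (real N) powr (energy_exponent + \<epsilon> N))"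
proof (intro exI conjI)
  let ?e = "\<lambda>N. ln (min_energy N) / ln (ln (real N)) - energy_exponent"
  have LL: "\<forall>\<^sub>F N in sequentially. ln (ln (real N)) > 0"
    using filterlim_lnln by (simp add: filterlim_at_top_dense)
  have pos: "\<forall>\<^sub>F N in sequentially. min_energy N > 0"
    using min_energy_lower[of 1, simplified] by eventually_elim (rule order.strict_trans2[OF exp_gt_zero])
  show "?e \<longlonglongrightarrow> 0"
  proof (rule tendstoI)
    fix \<epsilon> :: real assume e: "\<epsilon> > 0"
    have "\<forall>\<^sub>F N in sequentially. min_energy N \<le> exp ((energy_exponent + \<epsilon> / 2) * ln (ln (real N)))"
      using e by (intro min_energy_upper) simp
    moreover have "\<forall>\<^sub>F N in sequentially. exp ((energy_exponent - \<epsilon> / 2) * ln (ln (real N))) \<le> min_energy N"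
      using e by (intro min_energy_lower) simp
    ultimately show "\<forall>\<^sub>F N in sequentially. dist (?e N) 0 < \<epsilon>" using LL pos
    proof eventually_elim
      case (elim N)
      define L where "L = ln (ln (real N))"
      have L: "L > 0" using elim by (simp add: L_def)
      have "ln (min_energy N) \<le> ln (exp ((energy_exponent + \<epsilon> / 2) * L))"
        using elim(1,4) by (subst ln_le_cancel_iff) (auto simp: L_def)
      hence 1: "ln (min_energy N) / L \<le> energy_exponent + \<epsilon> / 2" using L by (simp add: pos_divide_le_eq ln_exp)
      have "(energy_exponent - \<epsilon> / 2) * L \<le> ln (min_energy N)"
        using elim(2,4) by (simp add: L_def ln_ge_iff)
      hence 2: "energy_exponent - \<epsilon> / 2 \<le> ln (min_energy N) / L" using L by (simp add: pos_le_divide_eq)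
      show ?case using 1 2 e by (simp add: dist_real_def L_def[symmetric] abs_less_iff)
    qed
  qed
  show "\<forall>\<^sub>F N in sequentially. min_energy N = ln (real N) powr (energy_exponent + ?e N)"
    using LL pos eventually_ge_at_top[of "3::nat"]
  proof eventually_elim
    case (elim N)
    have "ln (real N) > 0" using elim(3) by simp
    thus ?case using elim by (simp add: powr_def)
  qed
qed

end
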